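(* Let $\mathbf{u}^*\in U_{ad}$ be a strict local solution of the continuous optimal control problem $\min\{j(\mathbf{u}):\mathbf{u}\in U_{ad}\}$, and let $\{\mathbf{u}^*_h\}_{h>0}\subset U_{ad}$ be a sequence of local minima of the discrete problems $\min\{j_h(\mathbf{u}_h):\mathbf{u}_h\in U_{ad}\}$ such that $\mathbf{u}^*_h\to\mathbf{u}^*$ in $\mathbb{R}^\ell$ as $h\downarrow0$. Let $\boldsymbol{y}^*,\boldsymbol{p}^*$ and $\boldsymbol{y}^*_h,\boldsymbol{p}^*_h$ be the corresponding continuous and discrete states and adjoint states. Suppose that $\mathbf{u}^*$ satisfies the second-order condition: there exist $\tau,\nu>0$ such that $j''(\mathbf{u}^* )\mathbf{v}^2\ge\nu\|\mathbf{v}\|_{\mathbb{R}^\ell}^2$ for all $\mathbf{v}\in\mathbf{C}^\tau_{\mathbf{u}^*}$. Assume further that $\boldsymbol{f}\in\mathbf{H}(\mathrm{div},\Omega)$, that $\mu,\varepsilon_\sigma\in PW^{1,\infty}(\Omega)$, and that there exist $\mathfrak{s},\tilde{\mathfrak{s}}\in(0,1]$ such that, for arbitrary $\mathbf{u}\in U_{ad}$, $\|\boldsymbol{p}_{\mathbf{u}}-\boldsymbol{p}_{\mathbf{u},h}\|_\Omega\lesssim h^{\mathfrak{s}}$ and $\|\mathbf{curl}(\boldsymbol{p}_{\mathbf{u}}-\boldsymbol{p}_{\mathbf{u},h})\|_\Omega\lesssim h^{\tilde{\mathfrak{s}}}$. Then, for $s\in[0,\mathfrak{t})$, there exists $h_\dagger>0$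 such that $$\|\mathbf{u}^*-\mathbf{u}^*_h\|_{\mathbb{R}^\ell}+\|\boldsymbol{y}^*-\boldsymbol{y}^*_h\|_{\mathbf{H}(\mathbf{curl},\Omega)}+\|\boldsymbol{p}^*-\boldsymbol{p}^*_h\|_{\mathbf{H}(\mathbf{curl},\Omega)}\lesssim h^{\min\{s,\mathfrak{s},\tilde{\mathfrak{s}}\}}\qquad\forall\,h<h_\dagger.$$
   Context: $\Omega\subset\mathbb{R}^3$ is an open, bounded, simply connected polyhedral domain with Lipschitz boundary $\Gamma$ and outward unit normal $\boldsymbol{n}$. $\mathbf{L}^2(\Omega;\mathbb{C})$ is the space of $\mathbb{C}^3$-valued square integrable fields; $(\boldsymbol v,\boldsymbol w)_\Omega=\int_\Omega \boldsymbol v\cdot\overline{\boldsymbol w}$ and $\|\cdot\|_\Omega$ are its inner product and norm ($\boldsymbol v\cdot\boldsymbol w=\sum_i v_iw_i$). $\mathbf{H}(\mathrm{div},\Omega)$ and $\mathbf{H}(\mathbf{curl},\Omega)$ are the spaces of $\boldsymbol{w}\in\mathbf{L}^2(\Omega;\mathbb{C})$ with square integrable divergence, respectively curl, with graph norms; $\mathbf{H}_0(\mathbf{curl},\Omega)=\{\boldsymbol{w}\in\mathbf{H}(\mathbf{curl},\Omega):\boldsymbol{w}\times\boldsymbol{n}=\mathbf{0}\text{ on }\Gamma\}$; $\mathbf{H}^s(\mathbf{curl},\Omega)=\{\boldsymbol{w}\in\mathbf{H}^s(\Omega;\mathbb{C}):\mathbf{curl}\,\boldsymbol{w}\in\mathbf{H}^s(\Omega;\mathbb{C})\}$.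 Data: $\omega>0$; $\mu\in L^\infty(\Omega)$ real with $\mu\ge\mu_0>0$; $\varepsilon,\sigma\in L^\infty(\Omega)$ real with $0<\varepsilon_+\le\varepsilon\le\varepsilon^+$ and $0<\sigma_+\le\sigma\le\sigma^+$ (constants); $\varepsilon_\sigma:=\varepsilon+i\sigma\omega^{-1}$; $\ell\in\mathbb{N}$; $\mathcal{P}=\{\Omega_k\}_{k=1}^\ell$ is a partition of $\Omega$ into pairwise disjoint subdomains with $\overline\Omega=\cup_k\overline{\Omega}_k$; $PW^{1,\infty}(\Omega)=\{\zeta\in L^\infty(\Omega;\mathbb{C}):\zeta|_{\Omega_k}\in W^{1,\infty}(\Omega_k;\mathbb{C}),\ 1\le k\le\ell\}$. For $\mathbf{u}\in\mathbb{R}^\ell$, $\varepsilon_\sigma\cdot\mathbf{u}$ denotes the function equal to $\mathbf{u}_k\varepsilon_\sigma$ on $\Omega_k$. $\boldsymbol{f},\boldsymbol{y}_\Omega,\boldsymbol{E}_\Omega\in\mathbf{L}^2(\Omega;\mathbb{C})$, $\alpha>0$. Vector inequalities are componentwise; $\mathbf{a},\mathbf{b}\in\mathbb{R}^\ell$ with $\mathbf{0}<\mathbf{a}<\mathbf{b}$ and $U_{ad}:=\{\mathbf{v}\in\mathbb{R}^\ell:\mathbf{a}\le\mathbf{v}\le\mathbf{b}\}$. Meshes: $\{\mathscr{T}_h\}_{h>0}$ is a collection of conforming, shape regular simplicial meshes of $\overline\Omega$, all refinements of an initial mesh, with $h=\max_{T\in\mathscr{T}_h}\mathrm{diam}(T)$,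 such that each $T\in\mathscr{T}_h$ is contained in (the closure of) one element of $\mathcal{P}$. $\mathbf{V}(\mathscr{T}_h)=\{\boldsymbol{v}_h\in\mathbf{H}_0(\mathbf{curl},\Omega):\boldsymbol{v}_h|_T\in[\mathbb{P}_0(T)]^3\oplus\boldsymbol{x}\times[\widetilde{\mathbb{P}}_0(T)]^3\ \forall T\in\mathscr{T}_h\}$ is the lowest-order Nédélec space ($\widetilde{\mathbb P}_0$: homogeneous polynomials of degree $0$). Write $a_{\mathbf{u}}(\boldsymbol{y},\boldsymbol{w})=(\mu^{-1}\mathbf{curl}\,\boldsymbol{y},\mathbf{curl}\,\boldsymbol{w})_\Omega-\omega^2((\varepsilon_\sigma\cdot\mathbf{u})\boldsymbol{y},\boldsymbol{w})_\Omega$. For $\mathbf{u}>\mathbf{0}$: $\mathcal{S}\mathbf{u}\in\mathbf{H}_0(\mathbf{curl},\Omega)$ is the unique solution of $a_{\mathbf{u}}(\mathcal{S}\mathbf{u},\boldsymbol{w})=(\boldsymbol{f},\boldsymbol{w})_\Omega$ for all $\boldsymbol{w}\in\mathbf{H}_0(\mathbf{curl},\Omega)$, and $\mathcal{S}_h\mathbf{u}\in\mathbf{V}(\mathscr{T}_h)$ is the unique solution of $a_{\mathbf{u}}(\mathcal{S}_h\mathbf{u},\boldsymbol{w}_h)=(\boldsymbol{f},\boldsymbol{w}_h)_\Omega$ for all $\boldsymbol{w}_h\in\mathbf{V}(\mathscr{T}_h)$. With $\mathcal{J}(\boldsymbol{y},\mathbf{u})=\tfrac12\|\boldsymbol{y}-\boldsymbol{y}_\Omega\|_\Omega^2+\tfrac12\|\mathbf{curl}\,\boldsymbol{y}-\boldsymbol{E}_\Omega\|_\Omega^2+\tfrac{\alpha}{2}\|\mathbf{u}\|_{\mathbb{R}^\ell}^2$,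 set $j(\mathbf{u})=\mathcal{J}(\mathcal{S}\mathbf{u},\mathbf{u})$, $j_h(\mathbf{u})=\mathcal{J}(\mathcal{S}_h\mathbf{u},\mathbf{u})$; $j''(\mathbf{u})\mathbf{v}^2$ is the second derivative of $j$ applied to $(\mathbf{v},\mathbf{v})$. Adjoint: for $\mathbf{u}\in U_{ad}$ and $\boldsymbol{y}=\mathcal{S}\mathbf{u}$, $\boldsymbol{p}_{\mathbf{u}}\in\mathbf{H}_0(\mathbf{curl},\Omega)$ is the unique solution of $a_{\mathbf{u}}(\boldsymbol{p}_{\mathbf{u}},\boldsymbol{w})=(\overline{\boldsymbol{y}-\boldsymbol{y}_\Omega},\boldsymbol{w})_\Omega+(\overline{\mathbf{curl}\,\boldsymbol{y}-\boldsymbol{E}_\Omega},\mathbf{curl}\,\boldsymbol{w})_\Omega$ for all $\boldsymbol{w}\in\mathbf{H}_0(\mathbf{curl},\Omega)$, and $\boldsymbol{p}_{\mathbf{u},h}\in\mathbf{V}(\mathscr{T}_h)$ is its finite element approximation: the solution of the same equation (same right-hand side, with $\boldsymbol{y}=\mathcal{S}\mathbf{u}$) with test functions in $\mathbf{V}(\mathscr{T}_h)$. Moreover $\boldsymbol{y}^*=\mathcal{S}\mathbf{u}^*$, $\boldsymbol{p}^*=\boldsymbol{p}_{\mathbf{u}^*}$, $\boldsymbol{y}^*_h=\mathcal{S}_h\mathbf{u}^*_h$, and $\boldsymbol{p}^*_h\in\mathbf{V}(\mathscr{T}_h)$ is the unique solution of $a_{\mathbf{u}^*_h}(\boldsymbol{p}^*_h,\boldsymbol{w}_h)=(\overline{\boldsymbol{y}^*_h-\boldsymbol{y}_\Omega},\boldsymbol{w}_h)_\Omega+(\overline{\mathbf{curl}\,\boldsymbol{y}^*_h-\boldsymbol{E}_\Omega},\mathbf{curl}\,\boldsymbol{w}_h)_\Omega$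 for all $\boldsymbol{w}_h\in\mathbf{V}(\mathscr{T}_h)$. Cone: with $\bar{\mathfrak{d}}_k=\alpha\mathbf{u}^*_k+\omega^2\mathfrak{Re}\{\int_{\Omega_k}\varepsilon_\sigma\boldsymbol{y}^*\cdot\boldsymbol{p}^*\}$, $\mathbf{C}^\tau_{\mathbf{u}^*}$ is the set of $\mathbf{v}\in\mathbb{R}^\ell$ such that for every $k$: $\mathbf{v}_k\ge0$ if $\mathbf{u}^*_k=\mathbf{a}_k$; $\mathbf{v}_k\le0$ if $\mathbf{u}^*_k=\mathbf{b}_k$; and $\mathbf{v}_k=0$ if $|\bar{\mathfrak{d}}_k|>\tau$. Exponent $\mathfrak{t}$: when $\mu,\varepsilon_\sigma\in PW^{1,\infty}(\Omega)$, $\mathfrak{t}\in(0,\tfrac12)$ denotes the (known to exist) regularity exponent such that, for right-hand sides $\boldsymbol{f}\in\mathbf{H}(\mathrm{div},\Omega)$ and $\mathbf{u}\in U_{ad}$, $\mathcal{S}\mathbf{u}\in\mathbf{H}^s(\mathbf{curl},\Omega)$ and $\|\mathcal{S}\mathbf{u}-\mathcal{S}_h\mathbf{u}\|_{\mathbf{H}(\mathbf{curl},\Omega)}\lesssim h^s\|\boldsymbol{f}\|_{\mathbf{H}(\mathrm{div},\Omega)}$ for all $s\in[0,\mathfrak{t})$. $A\lesssim B$ means $A\le CB$ with $C>0$ independent of $A$, $B$ and of discretization parameters (in particular, in the assumptions on $\boldsymbol p_{\mathbf u}$, independent of $\mathbf u$ and $h$). *)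

theory Defs
  imports "HOL-Analysis.Analysis"
begin

text \<open>
  Fields on an open set \<open>G\<close> are total functions on \<open>real^3\<close> of which only the values on \<open>G\<close>,
  up to Lebesgue null sets, are relevant. Elements of function spaces are representatives,
  not equivalence classes.
\<close>

type_synonym vfield = "real^3 \<Rightarrow> complex^3"


section \<open>Domains\<close>

text \<open>
  Near each boundary point the domain is, in suitable orthonormal coordinates, the region
  below the graph of a Lipschitz function of two variables.
\<close>

definition lipschitz_boundary :: "(real^3) set \<Rightarrow> bool" where
  "lipschitz_boundary G \<longleftrightarrow>
     (\<forall>x\<in>frontier G. \<exists>Q :: real^3 \<Rightarrow> real^3. \<exists>g :: real^2 \<Rightarrow> real. \<exists>L r.
        orthogonal_transformation Q \<and> L-lipschitz_on UNIV g \<and> r > 0 \<and>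
        (\<forall>y\<in>ball x r. y \<in> G \<longleftrightarrow> Q y $ 3 < g (vector [Q y $ 1, Q y $ 2])))"

text \<open>The boundary is a finite union of (convex, hence also of arbitrary) planar polygons.\<close>

definition polyhedral_boundary :: "(real^3) set \<Rightarrow> bool" where
  "polyhedral_boundary G \<longleftrightarrow>
     (\<exists>F. finite F \<and> (\<forall>P\<in>F. polytope P \<and> aff_dim P = 2) \<and> frontier G = \<Union>F)"

definition subdomain :: "(real^3) set \<Rightarrow> bool" where
  "subdomain G \<longleftrightarrow> open G \<and> connected G \<and> G \<noteq> {}"


section \<open>Lebesgue spaces and algebra of complex vectors\<close>

definition Linf :: "(real^3) set \<Rightarrow> (real^3 \<Rightarrow> 'b::real_normed_vector) \<Rightarrow> bool" where
  "Linf G z \<longleftrightarrow> z \<in> borel_measurable (lebesgue_on G) \<and>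
     (\<exists>B. AE x in lebesgue_on G. norm (z x) \<le> B)"

definition L2 :: "(real^3) set \<Rightarrow> (real^3 \<Rightarrow> 'b::real_normed_vector) \<Rightarrow> bool" where
  "L2 G w \<longleftrightarrow> w \<in> borel_measurable (lebesgue_on G) \<and>
     integrable (lebesgue_on G) (\<lambda>x. (norm (w x))\<^sup>2)"

definition L2norm :: "(real^3) set \<Rightarrow> (real^3 \<Rightarrow> 'b::real_normed_vector) \<Rightarrow> real" where
  "L2norm G w = sqrt (integral\<^sup>L (lebesgue_on G) (\<lambda>x. (norm (w x))\<^sup>2))"

text \<open>The bilinear product, without complex conjugation.\<close>

definition cdot :: "complex^3 \<Rightarrow> complex^3 \<Rightarrow> complex" where
  "cdot v w = (\<Sum>i\<in>UNIV. v $ i * w $ i)"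

definition vcnj :: "complex^3 \<Rightarrow> complex^3" where
  "vcnj v = (\<chi> i. cnj (v $ i))"

definition ccross :: "complex^3 \<Rightarrow> complex^3 \<Rightarrow> complex^3" where
  "ccross v w = vector [v $ 2 * w $ 3 - v $ 3 * w $ 2,
                        v $ 3 * w $ 1 - v $ 1 * w $ 3,
                        v $ 1 * w $ 2 - v $ 2 * w $ 1]"

definition L2inner :: "(real^3) set \<Rightarrow> vfield \<Rightarrow> vfield \<Rightarrow> complex" where
  "L2inner G v w = integral\<^sup>L (lebesgue_on G) (\<lambda>x. cdot (v x) (vcnj (w x)))"


section \<open>Smooth functions and weak derivatives\<close>

definition pderiv_at :: "3 \<Rightarrow> (real^3 \<Rightarrow> 'b::real_normed_vector) \<Rightarrow> real^3 \<Rightarrow> 'b" where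
  "pderiv_at i \<phi> x = frechet_derivative \<phi> (at x) (axis i 1)"

primrec Ck :: "nat \<Rightarrow> (real^3 \<Rightarrow> 'b::real_normed_vector) \<Rightarrow> bool" where
  "Ck 0 \<phi> \<longleftrightarrow> continuous_on UNIV \<phi>"
| "Ck (Suc k) \<phi> \<longleftrightarrow> (\<forall>x. \<phi> differentiable at x) \<and> (\<forall>i. Ck k (pderiv_at i \<phi>))"

definition smooth :: "(real^3 \<Rightarrow> 'b::real_normed_vector) \<Rightarrow> bool" where
  "smooth \<phi> \<longleftrightarrow> (\<forall>k. Ck k \<phi>)"

definition test_function :: "(real^3) set \<Rightarrow> (real^3 \<Rightarrow> 'b::real_normed_vector) \<Rightarrow> bool" where
  "test_function G \<phi> \<longleftrightarrow> smooth \<phi> \<and>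
     compact (closure {x. \<phi> x \<noteq> 0}) \<and> closure {x. \<phi> x \<noteq> 0} \<subseteq> G"

definition grad :: "(real^3 \<Rightarrow> complex) \<Rightarrow> vfield" where
  "grad \<phi> x = (\<chi> i. pderiv_at i \<phi> x)"

definition curl :: "vfield \<Rightarrow> vfield" where
  "curl \<phi> x = vector [pderiv_at 2 \<phi> x $ 3 - pderiv_at 3 \<phi> x $ 2,
                     pderiv_at 3 \<phi> x $ 1 - pderiv_at 1 \<phi> x $ 3,
                     pderiv_at 1 \<phi> x $ 2 - pderiv_at 2 \<phi> x $ 1]"

definition has_weak_pderiv ::
  "(real^3) set \<Rightarrow> 3 \<Rightarrow> (real^3 \<Rightarrow> complex) \<Rightarrow> (real^3 \<Rightarrow> complex) \<Rightarrow> bool" where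
  "has_weak_pderiv G i z g \<longleftrightarrow>
     (\<forall>\<phi>. test_function G \<phi> \<longrightarrow>
        integral\<^sup>L (lebesgue_on G) (\<lambda>x. z x * pderiv_at i \<phi> x) =
        - integral\<^sup>L (lebesgue_on G) (\<lambda>x. g x * \<phi> x))"

definition has_weak_div :: "(real^3) set \<Rightarrow> vfield \<Rightarrow> (real^3 \<Rightarrow> complex) \<Rightarrow> bool" where
  "has_weak_div G w g \<longleftrightarrow>
     (\<forall>\<phi>. test_function G \<phi> \<longrightarrow>
        integral\<^sup>L (lebesgue_on G) (\<lambda>x. cdot (w x) (grad \<phi> x)) =
        - integral\<^sup>L (lebesgue_on G) (\<lambda>x. g x * \<phi> x))"

definition has_weak_curl :: "(real^3) set \<Rightarrow> vfield \<Rightarrow> vfield \<Rightarrow> bool" where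
  "has_weak_curl G w g \<longleftrightarrow>
     (\<forall>\<phi>. test_function G \<phi> \<longrightarrow>
        integral\<^sup>L (lebesgue_on G) (\<lambda>x. cdot (w x) (curl \<phi> x)) =
        integral\<^sup>L (lebesgue_on G) (\<lambda>x. cdot (g x) (\<phi> x)))"

text \<open>
  The square integrable weak divergence and weak curl are unique up to null sets; the choice
  operator picks a representative.
\<close>

definition weak_div :: "(real^3) set \<Rightarrow> vfield \<Rightarrow> (real^3 \<Rightarrow> complex)" where
  "weak_div G w = (SOME g. L2 G g \<and> has_weak_div G w g)"

definition weak_curl :: "(real^3) set \<Rightarrow> vfield \<Rightarrow> vfield" where
  "weak_curl G w = (SOME g. L2 G g \<and> has_weak_curl G w g)"


section \<open>Function spaces\<close>

definition Hdiv :: "(real^3) set \<Rightarrow> vfield set" where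
  "Hdiv G = {w. L2 G w \<and> (\<exists>g. L2 G g \<and> has_weak_div G w g)}"

definition Hdiv_norm :: "(real^3) set \<Rightarrow> vfield \<Rightarrow> real" where
  "Hdiv_norm G w = sqrt ((L2norm G w)\<^sup>2 + (L2norm G (weak_div G w))\<^sup>2)"

definition Hcurl :: "(real^3) set \<Rightarrow> vfield set" where
  "Hcurl G = {w. L2 G w \<and> (\<exists>g. L2 G g \<and> has_weak_curl G w g)}"

definition Hcurl_norm :: "(real^3) set \<Rightarrow> vfield \<Rightarrow> real" where
  "Hcurl_norm G w = sqrt ((L2norm G w)\<^sup>2 + (L2norm G (weak_curl G w))\<^sup>2)"

text \<open>
  For \<open>w\<close> in \<open>Hcurl G\<close> the trace \<open>w \<times> n\<close> on the boundary is the functional given by Green's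
  formula: the value below is the boundary integral of \<open>(w \<times> n) \<cdot> \<phi>\<close> when \<open>w\<close> is smooth up to
  the boundary.
\<close>

definition tangential_trace :: "(real^3) set \<Rightarrow> vfield \<Rightarrow> vfield \<Rightarrow> complex" where
  "tangential_trace G w \<phi> =
     integral\<^sup>L (lebesgue_on G) (\<lambda>x. cdot (w x) (curl \<phi> x)) -
     integral\<^sup>L (lebesgue_on G) (\<lambda>x. cdot (weak_curl G w x) (\<phi> x))"

definition H0curl :: "(real^3) set \<Rightarrow> vfield set" where
  "H0curl G = {w \<in> Hcurl G. \<forall>\<phi>. smooth \<phi> \<longrightarrow> tangential_trace G w \<phi> = 0}"

text \<open>Sobolev--Slobodeckij space; used for \<open>0 \<le> s < 1\<close> only.\<close>

definition Hs :: "(real^3) set \<Rightarrow> real \<Rightarrow> vfield set" where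
  "Hs G s = {w. L2 G w \<and>
     (s = 0 \<or>
      (\<integral>\<^sup>+x. (\<integral>\<^sup>+y. ennreal ((norm (w x - w y))\<^sup>2 / norm (x - y) powr (3 + 2 * s))
          \<partial>lebesgue_on G) \<partial>lebesgue_on G) < \<infinity>)}"

definition Hscurl :: "(real^3) set \<Rightarrow> real \<Rightarrow> vfield set" where
  "Hscurl G s = {w \<in> Hcurl G. w \<in> Hs G s \<and> weak_curl G w \<in> Hs G s}"

definition W1inf :: "(real^3) set \<Rightarrow> (real^3 \<Rightarrow> complex) \<Rightarrow> bool" where
  "W1inf G z \<longleftrightarrow> Linf G z \<and> (\<forall>i. \<exists>g. Linf G g \<and> has_weak_pderiv G i z g)"

definition PW1inf :: "(real^3) set \<Rightarrow> ('l \<Rightarrow> (real^3) set) \<Rightarrow> (real^3 \<Rightarrow> complex) \<Rightarrow> bool" where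
  "PW1inf G P z \<longleftrightarrow> Linf G z \<and> (\<forall>k. W1inf (P k) z)"


section \<open>Meshes and the lowest-order Nedelec space\<close>

definition simplicial_mesh :: "(real^3) set \<Rightarrow> (real^3) set set \<Rightarrow> bool" where
  "simplicial_mesh G M \<longleftrightarrow> triangulation M \<and> (\<forall>T\<in>M. 3 simplex T) \<and> \<Union>M = closure G"

definition inradius :: "(real^3) set \<Rightarrow> real" where
  "inradius T = Sup {r. 0 \<le> r \<and> (\<exists>x. cball x r \<subseteq> T)}"

text \<open>
  The meshes are indexed by their mesh size, which ranges over a set \<open>H\<close> of positive reals
  accumulating at \<open>0\<close>. (\<open>H\<close> cannot contain all positive reals, since the mesh size is bounded.)
\<close>

definition mesh_family ::
  "(real^3) set \<Rightarrow> ('l \<Rightarrow> (real^3) set) \<Rightarrow> real set \<Rightarrow> (real \<Rightarrow> (real^3) set set) \<Rightarrow> bool" where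
  "mesh_family G P H \<T> \<longleftrightarrow>
     H \<subseteq> {0<..} \<and> 0 islimpt H \<and>
     (\<forall>h\<in>H. simplicial_mesh G (\<T> h) \<and> h = Max (diameter ` \<T> h)) \<and>
     (\<exists>\<kappa>. \<forall>h\<in>H. \<forall>T\<in>\<T> h. diameter T \<le> \<kappa> * inradius T) \<and>
     (\<exists>M0. simplicial_mesh G M0 \<and> (\<forall>h\<in>H. \<forall>T\<in>\<T> h. \<exists>T0\<in>M0. T \<subseteq> T0)) \<and>
     (\<forall>h\<in>H. \<forall>T\<in>\<T> h. \<exists>k. T \<subseteq> closure (P k))"

definition nedelec :: "(real^3) set \<Rightarrow> (real^3) set set \<Rightarrow> vfield set" where
  "nedelec G M = {v \<in> H0curl G.
     \<forall>T\<in>M. \<exists>a b :: complex^3. AE x in lebesgue_on T.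
       v x = a + ccross (\<chi> i. complex_of_real (x $ i)) b}"


section \<open>The control problem\<close>

text \<open>
  The index type \<open>'l\<close> plays the role of \<open>{1..\<ell>}\<close>. Fields: domain, partition, angular frequency,
  permeability, permittivity, conductivity, desired state, desired curl, Tikhonov
  parameter, lower and upper control bounds.
\<close>

record ('l::finite) control_data =
  Dom :: "(real^3) set"
  Part :: "'l \<Rightarrow> (real^3) set"
  freq :: real
  perm :: "real^3 \<Rightarrow> real"
  epsil :: "real^3 \<Rightarrow> real"
  conduc :: "real^3 \<Rightarrow> real"
  ydes :: vfield
  Edes :: vfield
  tikh :: real
  lower :: "real^'l"
  upper :: "real^'l"

text \<open>
  The partition covers the domain up to a null set; this is implicit in the use of
  piecewise defined coefficients.
\<close>

definition admissible_data :: "('l::finite) control_data \<Rightarrow> bool" where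
  "admissible_data D \<longleftrightarrow>
     open (Dom D) \<and> bounded (Dom D) \<and> Dom D \<noteq> {} \<and> simply_connected (Dom D) \<and>
     polyhedral_boundary (Dom D) \<and> lipschitz_boundary (Dom D) \<and>
     (\<forall>k. subdomain (Part D k) \<and> Part D k \<subseteq> Dom D) \<and>
     (\<forall>k m. k \<noteq> m \<longrightarrow> Part D k \<inter> Part D m = {}) \<and>
     closure (Dom D) = (\<Union>k. closure (Part D k)) \<and>
     negligible (Dom D - (\<Union>k. Part D k)) \<and>
     freq D > 0 \<and>
     Linf (Dom D) (perm D) \<and> (\<exists>\<mu>0>0. AE x in lebesgue_on (Dom D). \<mu>0 \<le> perm D x) \<and>
     Linf (Dom D) (epsil D) \<and> (\<exists>e>0. AE x in lebesgue_on (Dom D). e \<le> epsil D x) \<and>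
     Linf (Dom D) (conduc D) \<and> (\<exists>c>0. AE x in lebesgue_on (Dom D). c \<le> conduc D x) \<and>
     L2 (Dom D) (ydes D) \<and> L2 (Dom D) (Edes D) \<and> tikh D > 0 \<and>
     (\<forall>k. 0 < lower D $ k \<and> lower D $ k < upper D $ k)"

definition Uad :: "('l::finite) control_data \<Rightarrow> (real^'l) set" where
  "Uad D = {v. \<forall>k. lower D $ k \<le> v $ k \<and> v $ k \<le> upper D $ k}"

definition eps_sigma :: "('l::finite) control_data \<Rightarrow> real^3 \<Rightarrow> complex" where
  "eps_sigma D x = complex_of_real (epsil D x) + \<i> * complex_of_real (conduc D x / freq D)"

definition eps_sigma_u :: "('l::finite) control_data \<Rightarrow> real^'l \<Rightarrow> real^3 \<Rightarrow> complex" where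
  "eps_sigma_u D u x = (\<Sum>k | x \<in> Part D k. complex_of_real (u $ k) * eps_sigma D x)"

definition form_a :: "('l::finite) control_data \<Rightarrow> real^'l \<Rightarrow> vfield \<Rightarrow> vfield \<Rightarrow> complex" where
  "form_a D u y w =
     L2inner (Dom D) (\<lambda>x. inverse (perm D x) *\<^sub>R weak_curl (Dom D) y x) (weak_curl (Dom D) w)
     - complex_of_real ((freq D)\<^sup>2) * L2inner (Dom D) (\<lambda>x. eps_sigma_u D u x *s y x) w"

text \<open>
  The solution in the space \<open>V\<close> of the variational problem with right-hand side \<open>F\<close>. It is
  unique as an element of \<open>L2\<close>, that is, up to null sets.
\<close>

definition var_solution ::
  "('l::finite) control_data \<Rightarrow> real^'l \<Rightarrow> vfield set \<Rightarrow> (vfield \<Rightarrow> complex) \<Rightarrow> vfield" where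
  "var_solution D u V F = (SOME y. y \<in> V \<and> (\<forall>w\<in>V. form_a D u y w = F w))"

definition state :: "('l::finite) control_data \<Rightarrow> vfield \<Rightarrow> real^'l \<Rightarrow> vfield" where
  "state D f u = var_solution D u (H0curl (Dom D)) (L2inner (Dom D) f)"

definition dstate ::
  "('l::finite) control_data \<Rightarrow> (real^3) set set \<Rightarrow> vfield \<Rightarrow> real^'l \<Rightarrow> vfield" where
  "dstate D M f u = var_solution D u (nedelec (Dom D) M) (L2inner (Dom D) f)"

definition adjoint_rhs :: "('l::finite) control_data \<Rightarrow> vfield \<Rightarrow> vfield \<Rightarrow> complex" where
  "adjoint_rhs D y w =
     L2inner (Dom D) (\<lambda>x. vcnj (y x - ydes D x)) w +
     L2inner (Dom D) (\<lambda>x. vcnj (weak_curl (Dom D) y x - Edes D x)) (weak_curl (Dom D) w)"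

definition adjoint_state :: "('l::finite) control_data \<Rightarrow> vfield \<Rightarrow> real^'l \<Rightarrow> vfield" where
  "adjoint_state D f u = var_solution D u (H0curl (Dom D)) (adjoint_rhs D (state D f u))"

text \<open>The finite element approximation of the adjoint state, driven by the exact state.\<close>

definition adjoint_state_fe ::
  "('l::finite) control_data \<Rightarrow> (real^3) set set \<Rightarrow> vfield \<Rightarrow> real^'l \<Rightarrow> vfield" where
  "adjoint_state_fe D M f u =
     var_solution D u (nedelec (Dom D) M) (adjoint_rhs D (state D f u))"

text \<open>The discrete adjoint state, driven by the discrete state.\<close>

definition dadjoint_state ::
  "('l::finite) control_data \<Rightarrow> (real^3) set set \<Rightarrow> vfield \<Rightarrow> real^'l \<Rightarrow> vfield" where
  "dadjoint_state D M f u =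
     var_solution D u (nedelec (Dom D) M) (adjoint_rhs D (dstate D M f u))"

definition cost :: "('l::finite) control_data \<Rightarrow> vfield \<Rightarrow> real^'l \<Rightarrow> real" where
  "cost D y u =
     1/2 * (L2norm (Dom D) (\<lambda>x. y x - ydes D x))\<^sup>2 +
     1/2 * (L2norm (Dom D) (\<lambda>x. weak_curl (Dom D) y x - Edes D x))\<^sup>2 +
     tikh D / 2 * (norm u)\<^sup>2"

definition red_cost :: "('l::finite) control_data \<Rightarrow> vfield \<Rightarrow> real^'l \<Rightarrow> real" where
  "red_cost D f u = cost D (state D f u) u"

definition dred_cost ::
  "('l::finite) control_data \<Rightarrow> (real^3) set set \<Rightarrow> vfield \<Rightarrow> real^'l \<Rightarrow> real" where
  "dred_cost D M f u = cost D (dstate D M f u) u"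

definition second_deriv :: "('a::real_normed_vector \<Rightarrow> real) \<Rightarrow> 'a \<Rightarrow> 'a \<Rightarrow> 'a \<Rightarrow> real" where
  "second_deriv J u v w =
     frechet_derivative (\<lambda>z. frechet_derivative J (at z) v) (at u) w"

definition local_min_on :: "('a::metric_space) set \<Rightarrow> ('a \<Rightarrow> real) \<Rightarrow> 'a \<Rightarrow> bool" where
  "local_min_on U J u \<longleftrightarrow> u \<in> U \<and> (\<exists>\<delta>>0. \<forall>v\<in>U. dist v u < \<delta> \<longrightarrow> J u \<le> J v)"

definition strict_local_min_on :: "('a::metric_space) set \<Rightarrow> ('a \<Rightarrow> real) \<Rightarrow> 'a \<Rightarrow> bool" where
  "strict_local_min_on U J u \<longleftrightarrow>
     u \<in> U \<and> (\<exists>\<delta>>0. \<forall>v\<in>U. v \<noteq> u \<and> dist v u < \<delta> \<longrightarrow> J u < J v)"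

definition dfrak :: "('l::finite) control_data \<Rightarrow> vfield \<Rightarrow> real^'l \<Rightarrow> 'l \<Rightarrow> real" where
  "dfrak D f u k = tikh D * u $ k + (freq D)\<^sup>2 *
     Re (integral\<^sup>L (lebesgue_on (Part D k))
           (\<lambda>x. eps_sigma D x * cdot (state D f u x) (adjoint_state D f u x)))"

definition critical_cone ::
  "('l::finite) control_data \<Rightarrow> vfield \<Rightarrow> real^'l \<Rightarrow> real \<Rightarrow> (real^'l) set" where
  "critical_cone D f u \<tau> = {v. \<forall>k.
     (u $ k = lower D $ k \<longrightarrow> v $ k \<ge> 0) \<and>
     (u $ k = upper D $ k \<longrightarrow> v $ k \<le> 0) \<and>
     (\<bar>dfrak D f u k\<bar> > \<tau> \<longrightarrow> v $ k = 0)}"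

text \<open>
  \<open>t\<close> is an exponent of regularity and finite element convergence, with a constant
  depending on neither the control, the right-hand side nor the mesh.
\<close>

definition regularity_exponent ::
  "('l::finite) control_data \<Rightarrow> real set \<Rightarrow> (real \<Rightarrow> (real^3) set set) \<Rightarrow> real \<Rightarrow> bool" where
  "regularity_exponent D H \<T> t \<longleftrightarrow> 0 < t \<and> t < 1/2 \<and>
     (\<forall>s. 0 \<le> s \<and> s < t \<longrightarrow>
        (\<forall>g\<in>Hdiv (Dom D). \<forall>u\<in>Uad D. state D g u \<in> Hscurl (Dom D) s) \<and>
        (\<exists>C>0. \<forall>g\<in>Hdiv (Dom D). \<forall>u\<in>Uad D. \<forall>h\<in>H.
           Hcurl_norm (Dom D) (\<lambda>x. state D g u x - dstate D (\<T> h) g u x)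
             \<le> C * h powr s * Hdiv_norm (Dom D) g))"

end

theory Submission
  imports Defs
begin

text \<open>
  A field \<open>w\<close> in \<open>H0curl\<close> is identified with the pair of classes of \<open>w\<close> and its weak curl in the
  Hilbert space \<open>L\<^sup>2 \<times> L\<^sup>2\<close>; both \<open>H0curl\<close> and the Nedelec space become closed subspaces. There the
  state and adjoint equations read \<open>\<langle>(A\<^sub>0 + \<Sum>\<^sub>k z\<^sub>k A\<^sub>k) y - g, w\<rangle> = 0\<close>, with a form that is
  coercive after multiplying the test function by \<open>1 - \<i> \<theta>\<close>, so that Lax--Milgram gives solutions
  depending differentiably on \<open>z\<close>. The reduced costs have gradient components
  \<open>\<alpha> z\<^sub>k - \<langle>A\<^sub>k y, conj p\<rangle>\<close>, and the finite element errors bound the difference of the continuous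
  and the discrete gradient by a multiple of \<open>h powr e\<close>.

  For small \<open>h\<close> the components of \<open>uh - u\<close> with a multiplier exceeding \<open>\<tau>\<close> vanish, because both
  controls sit at the same bound, so \<open>uh - u\<close> lies in the critical cone. Differentiability of the
  gradient at \<open>u\<close> and the second-order condition give
  \<open>\<nu>/2 |uh - u|\<^sup>2 \<le> \<langle>j'(uh) - j'(u), uh - u\<rangle>\<close>, and the two variational inequalities bound the
  right-hand side by \<open>\<langle>j'(uh) - jh'(uh), uh - u\<rangle>\<close>. When \<open>s = 0\<close>, a slightly larger exponent below
  \<open>t\<close> still makes the discrete gradients converge.
\<close>


section \<open>Lax--Milgram\<close>

text \<open>All abstract arguments take place in a real Hilbert space. A complex equation is
  equivalent to its real part as soon as the test space is stable under multiplication by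
  \<open>\<i>\<close>. The Maxwell form is complex symmetric but not Hermitian, so the symmetry
  behind the adjoint calculus reads \<open>A x \<bullet> J y = A y \<bullet> J x\<close> with
  \<open>J\<close> the complex conjugation; hence trial spaces have to be invariant under complex
  scaling and conjugation. \<open>H0curl\<close> and all Nedelec spaces are instances of one
  abstract setting with one stability constant. Gradients are derivatives in the full control space,
  so the equations must be solvable for parameters in a neighbourhood of the admissible box. The
  obstacle in the translation is that a weak curl is a chosen representative: it depends linearly on
  the field, up to null sets, only because a difference of two weak curls is annihilated by all bump
  functions and thus vanishes almost everywhere. Zero tangential trace is tested with all smooth
  fields, so the graph of the curl on \<open>H0curl\<close> is cut out by continuous linear
  equations and is closed.\<close>

lemma orthogonal_projection_exists:
  fixes V :: "'h::{real_inner,complete_space} set"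
  assumes V: "subspace V" "closed V"
  shows "\<exists>p\<in>V. \<forall>w\<in>V. (x - p) \<bullet> w = 0"
proof -
  have ne: "V \<noteq> {}" using subspace_0[OF V(1)] by auto
  define d where "d = infdist x V"
  have d0: "0 \<le> d" by (simp add: d_def infdist_nonneg)
  have dle: "d \<le> norm (x - v)" if "v \<in> V" for v
    using infdist_le[OF that, of x] by (simp add: d_def dist_norm)
  have "\<exists>v\<in>V. dist x v < d + 1 / real (Suc n)" for n
  proof -
    have "d < d + 1 / real (Suc n)" by simp
    then show ?thesis unfolding d_def by (subst (asm) infdist_notempty[OF ne])
        (metis (no_types, lifting) cINF_less_iff[OF ne bdd_below_image_dist] infdist_notempty[OF ne])
  qed
  then obtain p where p: "\<And>n. p n \<in> V" "\<And>n. dist x (p n) < d + 1 / real (Suc n)" by metis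
  have sq: "(norm (x - p n))\<^sup>2 \<le> d\<^sup>2 + (2 * d + 1) * (1 / real (Suc n))" for n
  proof -
    have "norm (x - p n) \<le> d + 1 / real (Suc n)" using p(2)[of n] by (simp add: dist_norm)
    then have "(norm (x - p n))\<^sup>2 \<le> (d + 1 / real (Suc n))\<^sup>2" by (intro power_mono) auto
    also have "\<dots> = d\<^sup>2 + 2 * d * (1 / real (Suc n)) + (1 / real (Suc n)) * (1 / real (Suc n))"
      by (simp add: power2_eq_square algebra_simps)
    also have "\<dots> \<le> d\<^sup>2 + 2 * d * (1 / real (Suc n)) + 1 * (1 / real (Suc n))"
      by (intro add_left_mono mult_right_mono) auto
    finally show ?thesis by (simp add: algebra_simps)
  qed
  \<comment> \<open>Parallelogram identity: the midpoint of two almost minimizers lies in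
    \<open>V\<close>, so its distance to \<open>x\<close> is at least \<open>d\<close>, which forces
    the two to be close.\<close>
  have par: "(norm (p m - p n))\<^sup>2 \<le> 2 * (2 * d + 1) * (1 / real (Suc m) + 1 / real (Suc n))" for m n
  proof -
    have mid: "(1/2) *\<^sub>R (p m + p n) \<in> V" using V(1) p(1) by (simp add: subspace_add subspace_scale)
    have "d\<^sup>2 \<le> (norm (x - (1/2) *\<^sub>R (p m + p n)))\<^sup>2" using dle[OF mid] d0 by (intro power_mono)
    moreover have "(norm (p m - p n))\<^sup>2 = 2 * (norm (x - p m))\<^sup>2 + 2 * (norm (x - p n))\<^sup>2
        - 4 * (norm (x - (1/2) *\<^sub>R (p m + p n)))\<^sup>2"
      by (simp add: power2_norm_eq_inner inner_diff_left inner_diff_right inner_add_left inner_add_right inner_commute algebra_simps)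
    moreover have "2 * (2 * d + 1) * (1 / real (Suc m) + 1 / real (Suc n))
        = 2 * ((2 * d + 1) * (1 / real (Suc m))) + 2 * ((2 * d + 1) * (1 / real (Suc n)))"
      by (rule trans[OF distrib_left]) (simp only: mult.assoc)
    ultimately show ?thesis using sq[of m] sq[of n] by argo
  qed
  have "Cauchy p"
  proof (rule CauchyI)
    fix e :: real assume e: "0 < e"
    obtain N where N: "4 * (2 * d + 1) / e\<^sup>2 < real N" using reals_Archimedean2 by blast
    have "norm (p m - p n) < e" if "N \<le> m" "N \<le> n" for m n
    proof -
      have Np: "0 < real (Suc N)" by simp
      have "1 / real (Suc m) + 1 / real (Suc n) \<le> 2 / real (Suc N)"
      proof -
        have "1 / real (Suc m) \<le> 1 / real (Suc N)" "1 / real (Suc n) \<le> 1 / real (Suc N)"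
          using that by (simp_all add: frac_le)
        then show ?thesis by simp
      qed
      then have "(norm (p m - p n))\<^sup>2 \<le> 2 * (2 * d + 1) * (2 / real (Suc N))"
        using par[of m n] d0 by (smt (verit) mult_left_mono)
      also have "\<dots> < e\<^sup>2"
      proof -
        have "4 * (2 * d + 1) < e\<^sup>2 * real (Suc N)" using N e by (simp add: field_simps)
           (smt (verit) zero_less_power)
        then show ?thesis using Np by (simp add: field_simps)
      qed
      finally show ?thesis using e power_less_imp_less_base by fastforce
    qed
    then show "\<exists>M. \<forall>m\<ge>M. \<forall>n\<ge>M. norm (p m - p n) < e" by blast
  qed
  then obtain q where q: "p \<longlonglongrightarrow> q" using Cauchy_convergent convergent_def by blast
  have qV: "q \<in> V" using closed_sequentially[OF V(2)] p(1) q by blast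
  have nq: "norm (x - q) \<le> d"
  proof (rule LIMSEQ_le)
    show "(\<lambda>n. norm (x - p n)) \<longlonglongrightarrow> norm (x - q)" by (intro tendsto_intros q)
    show "(\<lambda>n. d + 1 / real (Suc n)) \<longlonglongrightarrow> d"
      using tendsto_add[OF tendsto_const[of d] LIMSEQ_inverse_real_of_nat] by (simp add: inverse_eq_divide)
    show "\<exists>N. \<forall>n\<ge>N. norm (x - p n) \<le> d + 1 / real (Suc n)" using p(2) by (auto simp: dist_norm less_imp_le)
  qed
  have "(x - q) \<bullet> w = 0" if w: "w \<in> V" for w
  proof (cases "w = 0")
    case False
    \<comment> \<open>The minimizer of the quadratic polynomial
      \<open>norm (x - q - t *\<^sub>R w)\<close> squared in \<open>t\<close>. A nonzero inner
      product with \<open>w\<close> would push the distance below \<open>d\<close>.\<close>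
    define t where "t = ((x - q) \<bullet> w) / (w \<bullet> w)"
    have ww: "w \<bullet> w > 0" using False by simp
    have "q + t *\<^sub>R w \<in> V" using V(1) w qV by (simp add: subspace_add subspace_scale)
    from dle[OF this] nq have "norm (x - q) \<le> norm (x - (q + t *\<^sub>R w))" by simp
    then have "(norm (x - q))\<^sup>2 \<le> (norm (x - q - t *\<^sub>R w))\<^sup>2" by (simp add: power_mono diff_diff_eq)
    also have "\<dots> = (norm (x - q))\<^sup>2 - 2 * t * ((x - q) \<bullet> w) + t * t * (w \<bullet> w)"
      by (simp only: power2_norm_eq_inner) (simp add: inner_diff_left inner_diff_right inner_commute algebra_simps)
    also have "\<dots> = (norm (x - q))\<^sup>2 - ((x - q) \<bullet> w)\<^sup>2 / (w \<bullet> w)"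
      using ww by (simp add: t_def field_simps power2_eq_square)
    finally have "((x - q) \<bullet> w)\<^sup>2 / (w \<bullet> w) \<le> 0" by simp
    then have "((x - q) \<bullet> w)\<^sup>2 \<le> 0" using ww by (simp add: divide_le_0_iff)
    then show ?thesis by simp
  qed simp
  then show ?thesis using qV by blast
qed

text \<open>With \<open>P\<close> the orthogonal projection onto \<open>V\<close> the equation says
  \<open>P (A y - g) = 0\<close>, that is, \<open>y\<close> is a fixed point of the damped iteration
  \<open>T\<close>. Coercivity and boundedness make \<open>T\<close> a contraction for a suitable
  step length.\<close>

theorem Lax_Milgram:
  fixes V :: "'h::{real_inner,complete_space} set" and A :: "'h \<Rightarrow> 'h"
  assumes V: "subspace V" "closed V" and A: "bounded_linear A"
    and c: "0 < c" and coercive: "\<And>y. y \<in> V \<Longrightarrow> c * (norm y)\<^sup>2 \<le> A y \<bullet> y"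
  shows "\<exists>y\<in>V. \<forall>w\<in>V. A y \<bullet> w = g \<bullet> w"
proof -
  interpret A: bounded_linear A by fact
  obtain P where P: "\<And>x. P x \<in> V" "\<And>x w. w \<in> V \<Longrightarrow> (x - P x) \<bullet> w = 0"
    using orthogonal_projection_exists[OF V] by metis
  obtain K where K: "0 < K" "\<And>x. norm (A x) \<le> norm x * K" using A.pos_bounded by blast
  \<comment> \<open>Taking the maximum with \<open>c\<close> ensures \<open>c \<le> L\<close>, so
    that the square root defining \<open>k\<close> below has a nonnegative argument.\<close>
  define L where "L = max K c"
  have L: "0 < L" "c \<le> L" "\<And>x. norm (A x) \<le> L * norm x"
  proof -
    show "0 < L" "c \<le> L" using K c by (auto simp: L_def)
    show "norm (A x) \<le> L * norm x" for x
      using K(2)[of x] mult_right_mono[of K L "norm x"] by (simp add: L_def mult.commute)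
  qed
  have Pn: "norm (P x - P y) \<le> norm (x - y)" for x y
  proof -
    let ?d = "P x - P y"
    have dV: "?d \<in> V" using P V by (simp add: subspace_diff)
    have "?d \<bullet> ?d = (x - y) \<bullet> ?d" using P(2)[OF dV, of x] P(2)[OF dV, of y] by (simp add: algebra_simps inner_diff_left)
    also have "\<dots> \<le> norm (x - y) * norm ?d" by (rule norm_cauchy_schwarz)
    finally have "norm ?d * norm ?d \<le> norm (x - y) * norm ?d"
      by (simp add: power2_norm_eq_inner[symmetric] power2_eq_square)
    then show ?thesis by (metis mult_right_le_imp_le norm_ge_zero norm_le_zero_iff order_le_less)
  qed
  \<comment> \<open>This step length minimizes \<open>1 - 2 * r * c + r\<^sup>2 * L\<^sup>2\<close>,
    the bound for the squared contraction factor; the minimum is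
    \<open>1 - c\<^sup>2 / L\<^sup>2\<close>.\<close>
  define r where "r = c / L\<^sup>2"
  define T where "T y = y - r *\<^sub>R P (A y - g)" for y
  define k where "k = sqrt (1 - c\<^sup>2 / L\<^sup>2)"
  have cL: "0 < c\<^sup>2 / L\<^sup>2" "c\<^sup>2 / L\<^sup>2 \<le> 1" using c L by (auto simp: power_mono)
  have k: "0 \<le> k" "k < 1" using cL by (auto simp: k_def)
  have "\<exists>!y\<in>V. T y = y"
  proof (rule Banach_fix[OF _ _ k])
    show "complete V" using V(2) by (simp add: complete_eq_closed)
    show "V \<noteq> {}" using subspace_0[OF V(1)] by auto
    show "T ` V \<subseteq> V" using V P by (auto simp: T_def subspace_diff subspace_scale)
    show "dist (T y) (T y') \<le> k * dist y y'" if yV: "y \<in> V" "y' \<in> V" for y y'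
    proof -
      let ?d = "y - y'" and ?q = "P (A y - g) - P (A y' - g)"
      have dV: "?d \<in> V" using yV V by (simp add: subspace_diff)
      have q: "norm ?q \<le> L * norm ?d"
        using Pn[of "A y - g" "A y' - g"] L(3)[of ?d] by (simp add: A.diff)
      have qd: "?q \<bullet> ?d = A ?d \<bullet> ?d"
        using P(2)[OF dV, of "A y - g"] P(2)[OF dV, of "A y' - g"] by (simp add: A.diff algebra_simps inner_diff_left)
      have q2: "(norm ?q)\<^sup>2 \<le> L\<^sup>2 * (norm ?d)\<^sup>2" using power_mono[OF q, of 2] by (simp add: power_mult_distrib)
      have "(norm (T y - T y'))\<^sup>2 = (norm (?d - r *\<^sub>R ?q))\<^sup>2" by (simp add: T_def algebra_simps)
      also have "\<dots> = (norm ?d)\<^sup>2 - 2 * r * (?q \<bullet> ?d) + r\<^sup>2 * (norm ?q)\<^sup>2"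
        by (simp only: power2_norm_eq_inner) (simp add: inner_diff_left inner_diff_right inner_commute algebra_simps power2_eq_square)
      also have "\<dots> \<le> (norm ?d)\<^sup>2 - 2 * r * (c * (norm ?d)\<^sup>2) + r\<^sup>2 * (L\<^sup>2 * (norm ?d)\<^sup>2)"
      proof -
        have "0 \<le> 2 * r" using c L by (simp add: r_def)
        then have "2 * r * (c * (norm ?d)\<^sup>2) \<le> 2 * r * (?q \<bullet> ?d)"
          unfolding qd by (rule mult_left_mono[OF coercive[OF dV]])
        moreover have "r\<^sup>2 * (norm ?q)\<^sup>2 \<le> r\<^sup>2 * (L\<^sup>2 * (norm ?d)\<^sup>2)" by (rule mult_left_mono[OF q2]) simp
        ultimately show ?thesis by linarith
      qed
      also have "\<dots> = (1 - c\<^sup>2 / L\<^sup>2) * (norm ?d)\<^sup>2"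
        using L(1) by (simp add: r_def field_simps power2_eq_square)
      also have "\<dots> = (k * norm ?d)\<^sup>2" using cL by (simp add: k_def power_mult_distrib)
      finally have "norm (T y - T y') \<le> k * norm ?d" by (rule power2_le_imp_le) (use k in simp)
      then show ?thesis by (simp only: dist_norm)
    qed
  qed
  then obtain y where y: "y \<in> V" "T y = y" by blast
  have "r \<noteq> 0" using c L by (simp add: r_def)
  then have P0: "P (A y - g) = 0" using y(2) by (simp add: T_def)
  have "A y \<bullet> w = g \<bullet> w" if "w \<in> V" for w
    using P(2)[OF that, of "A y - g"] P0 by (simp add: inner_diff_left)
  then show ?thesis using y(1) by blast
qed


section \<open>Affinely parametrized variational problems\<close>

text \<open>Coercivity is only available after testing with \<open>M y\<close>; in the application
  \<open>M\<close> multiplies by a complex number and \<open>Mt\<close> by its conjugate. It is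
  stated on one large space \<open>W\<close>, so that all closed subspaces, in particular all finite
  element spaces, inherit it with the same constant \<open>c\<close>.\<close>

locale affine_family =
  fixes A0 :: "'h::{real_inner,complete_space} \<Rightarrow> 'h" and A :: "'l::finite \<Rightarrow> 'h \<Rightarrow> 'h"
    and M Mt :: "'h \<Rightarrow> 'h" and W :: "'h set" and Z :: "(real^'l) set" and c KM KA :: real
  assumes A0: "bounded_linear A0" and A: "\<And>k. bounded_linear (A k)"
    and M: "bounded_linear M" and Mt: "bounded_linear Mt" and adj: "\<And>x y. x \<bullet> M y = Mt x \<bullet> y"
    and KM: "0 < KM" "\<And>x. norm (M x) \<le> KM * norm x"
    and KA: "0 < KA" "\<And>k x. norm (A k x) \<le> KA * norm x"
    and c: "0 < c"
    and coercive: "\<And>z y. z \<in> Z \<Longrightarrow> y \<in> W \<Longrightarrow>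
          c * (norm y)\<^sup>2 \<le> (A0 y + (\<Sum>k\<in>UNIV. (z $ k) *\<^sub>R A k y)) \<bullet> M y"
begin

definition pert :: "real^'l \<Rightarrow> 'h \<Rightarrow> 'h" where
  "pert z y = (\<Sum>k\<in>UNIV. (z $ k) *\<^sub>R A k y)"

definition opr :: "real^'l \<Rightarrow> 'h \<Rightarrow> 'h" where
  "opr z y = A0 y + pert z y"

text \<open>Invariance under \<open>M\<close> is demanded with equality: surjectivity turns the test
  functions \<open>M w\<close> that coercivity can handle into arbitrary ones.\<close>

definition trial :: "'h set \<Rightarrow> bool" where
  "trial V \<longleftrightarrow> subspace V \<and> closed V \<and> V \<subseteq> W \<and> M ` V = V"

definition sol :: "'h set \<Rightarrow> real^'l \<Rightarrow> 'h \<Rightarrow> 'h \<Rightarrow> bool" where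
  "sol V z g y \<longleftrightarrow> y \<in> V \<and> (\<forall>w\<in>V. opr z y \<bullet> w = g \<bullet> w)"

lemma A_linear: "linear (A k)" "linear A0"
  using A A0 by (auto intro: bounded_linear.linear)

lemmas A_simps = linear_add[OF A_linear(1)] linear_diff[OF A_linear(1)] linear_scale[OF A_linear(1)]
  linear_add[OF A_linear(2)] linear_diff[OF A_linear(2)] linear_scale[OF A_linear(2)]

lemma pert_diff: "pert z (x - y) = pert z x - pert z y"
  and pert_add: "pert z (x + y) = pert z x + pert z y"
  and pert_scale: "pert z (r *\<^sub>R x) = r *\<^sub>R pert z x"
  and pert_scale_left: "pert (r *\<^sub>R z) x = r *\<^sub>R pert z x"
  and pert_diff_left: "pert (z - z') x = pert z x - pert z' x"
  and pert_add_left: "pert (z + z') x = pert z x + pert z' x"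
  by (simp_all add: pert_def A_simps algebra_simps sum.distrib sum_subtractf scaleR_sum_right)

lemma bounded_linear_opr: "bounded_linear (opr z)"
  unfolding opr_def[abs_def] pert_def
  by (intro bounded_linear_add A0 bounded_linear_sum bounded_linear_compose[OF bounded_linear_scaleR_right A])

lemmas opr_diff = bounded_linear.linear[OF bounded_linear_opr, THEN linear_diff]
lemmas opr_add = bounded_linear.linear[OF bounded_linear_opr, THEN linear_add]
lemmas opr_scale = bounded_linear.linear[OF bounded_linear_opr, THEN linear_scale]

definition KP :: real where "KP = real CARD('l) * KA"

lemma KP_pos: "0 < KP" by (simp add: KP_def KA)

lemma norm_pert: "norm (pert z x) \<le> KP * norm z * norm x"
proof -
  have "norm (pert z x) \<le> (\<Sum>k\<in>(UNIV::'l set). norm z * (KA * norm x))"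
    unfolding pert_def
  proof (rule sum_norm_le)
    fix k
    have "\<bar>z $ k\<bar> * norm (A k x) \<le> norm z * (KA * norm x)"
      by (intro mult_mono component_le_norm_cart KA) auto
    then show "norm ((z $ k) *\<^sub>R A k x) \<le> norm z * (KA * norm x)" by simp
  qed
  then show ?thesis by (simp add: KP_def algebra_simps)
qed

text \<open>Lax--Milgram is applied to \<open>Mt\<close> composed with \<open>opr z\<close>, which
  is coercive in the plain sense. Moving \<open>Mt\<close> to the other side tests with
  \<open>M w\<close>, and these exhaust \<open>V\<close>.\<close>

lemma sol_exists:
  assumes V: "trial V" and z: "z \<in> Z" shows "\<exists>y. sol V z g y"
proof -
  have "\<exists>y\<in>V. \<forall>w\<in>V. Mt (opr z y) \<bullet> w = Mt g \<bullet> w"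
  proof (rule Lax_Milgram[where c = c])
    show "bounded_linear (\<lambda>y. Mt (opr z y))" by (rule bounded_linear_compose[OF Mt bounded_linear_opr])
    show "c * (norm y)\<^sup>2 \<le> Mt (opr z y) \<bullet> y" if "y \<in> V" for y
      using coercive[OF z, of y] that V by (auto simp: trial_def opr_def pert_def adj[symmetric])
  qed (use V c in \<open>auto simp: trial_def\<close>)
  then obtain y where y: "y \<in> V" "\<And>w. w \<in> V \<Longrightarrow> opr z y \<bullet> M w = g \<bullet> M w" by (auto simp: adj)
  have "opr z y \<bullet> w = g \<bullet> w" if w: "w \<in> V" for w
  proof -
    have "w \<in> M ` V" using V w by (simp add: trial_def)
    then show ?thesis using y(2) by auto
  qed
  then show ?thesis using y(1) by (auto simp: sol_def)
qed

definition KS :: real where "KS = KM / c"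

lemma KS_pos: "0 < KS" by (simp add: KS_def KM c)

text \<open>Test with \<open>M y\<close>. The constant \<open>KS\<close> depends neither on
  \<open>V\<close> nor on \<open>z\<close>, which is what makes the later estimates uniform in the
  mesh and in the control.\<close>

lemma sol_bound:
  assumes V: "trial V" and z: "z \<in> Z" and s: "sol V z g y" shows "norm y \<le> KS * norm g"
proof (cases "y = 0")
  case True then show ?thesis using KS_pos by simp
next
  case False
  have yV: "y \<in> V" "M y \<in> V" "y \<in> W" using s V by (auto simp: sol_def trial_def)
  have "c * (norm y)\<^sup>2 \<le> opr z y \<bullet> M y"
    using coercive[OF z yV(3)] by (simp add: opr_def pert_def)
  also have "\<dots> = g \<bullet> M y" using s yV by (auto simp: sol_def)
  also have "\<dots> \<le> norm g * norm (M y)" by (rule norm_cauchy_schwarz)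
  also have "\<dots> \<le> norm g * (KM * norm y)" by (rule mult_left_mono[OF KM(2)]) simp
  finally have "(c * norm y) * norm y \<le> (KM * norm g) * norm y" by (simp add: power2_eq_square mult_ac)
  then have "c * norm y \<le> KM * norm g" using False by simp
  then show ?thesis using c by (simp add: KS_def field_simps)
qed

lemma sol_diff: "trial V \<Longrightarrow> sol V z g y \<Longrightarrow> sol V z g' y' \<Longrightarrow> sol V z (g - g') (y - y')"
  by (auto simp: sol_def trial_def subspace_diff opr_diff inner_diff_left)

lemma sol_add: "trial V \<Longrightarrow> sol V z g y \<Longrightarrow> sol V z g' y' \<Longrightarrow> sol V z (g + g') (y + y')"
  by (auto simp: sol_def trial_def subspace_add opr_add inner_add_left)

lemma sol_scale: "trial V \<Longrightarrow> sol V z g y \<Longrightarrow> sol V z (r *\<^sub>R g) (r *\<^sub>R y)"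
  by (auto simp: sol_def trial_def subspace_scale opr_scale)

lemma sol_unique:
  assumes "trial V" "z \<in> Z" "sol V z g y" "sol V z g y'" shows "y = y'"
  using sol_bound[OF assms(1,2) sol_diff[OF assms(1,3,4)]] by simp

text \<open>Freezes the operator: a change of the parameter becomes a perturbation of the right-hand
  side that is linear in \<open>z - z'\<close>.\<close>

lemma sol_shift: "sol V z' g y \<Longrightarrow> sol V z (g + pert (z - z') y) y"
  by (auto simp: sol_def opr_def pert_diff_left inner_add_left inner_diff_left)

lemma sol_perturb:
  assumes V: "trial V" and "sol V z g y" "sol V z' g' y'"
  shows "sol V z (g - g' - pert (z - z') y') (y - y')"
  using sol_diff[OF V assms(2) sol_shift[OF assms(3), of z]] by (simp add: diff_diff_eq)

lemma sol_Lipschitz: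
  assumes V: "trial V" "z \<in> Z" and "sol V z g y" "sol V z' g' y'"
  shows "norm (y - y') \<le> KS * (norm (g - g') + KP * norm (z - z') * norm y')"
proof -
  have "norm (y - y') \<le> KS * norm (g - g' - pert (z - z') y')"
    by (rule sol_bound[OF V sol_perturb[OF V(1) assms(3,4)]])
  also have "\<dots> \<le> KS * (norm (g - g') + KP * norm (z - z') * norm y')"
    using norm_triangle_ineq4[of "g - g'" "pert (z - z') y'"] norm_pert[of "z - z'" y'] KS_pos
    by (intro mult_left_mono) linarith+
  finally show ?thesis .
qed

text \<open>Formal differentiation of the equation gives a problem with the same operator at
  \<open>z0\<close> and right-hand side \<open>g' v - pert v (Y z0)\<close>; its solution is the
  derivative. The stability bound gives its boundedness in \<open>v\<close>, and uniqueness gives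
  its linearity.\<close>

lemma sol_has_derivative:
  assumes V: "trial V" and z0: "z0 \<in> interior Z"
    and g: "(g has_derivative g') (at z0)" and Y: "\<And>z. z \<in> Z \<Longrightarrow> sol V z (g z) (Y z)"
  obtains Y' where "(Y has_derivative Y') (at z0)" "\<And>v. sol V z0 (g' v - pert v (Y z0)) (Y' v)"
proof -
  have z0Z: "z0 \<in> Z" using z0 interior_subset by blast
  interpret g': bounded_linear g' using g by (rule has_derivative_bounded_linear)
  obtain Y' where Y': "\<And>v. sol V z0 (g' v - pert v (Y z0)) (Y' v)"
  proof -
    have "\<forall>v. \<exists>y. sol V z0 (g' v - pert v (Y z0)) y" using sol_exists[OF V z0Z] by blast
    then show ?thesis using that by metis
  qed
  obtain Kg where Kg: "\<And>v. norm (g' v) \<le> norm v * Kg" using g'.bounded by blast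
  have lin: "bounded_linear Y'"
  proof (rule bounded_linear_intro[where K = "KS * (Kg + KP * norm (Y z0))"])
    fix x y r
    show "Y' (x + y) = Y' x + Y' y"
      using sol_unique[OF V z0Z Y'[of "x + y"]] sol_add[OF V Y'[of x] Y'[of y]]
      by (simp add: g'.add pert_add_left algebra_simps)
    show "Y' (r *\<^sub>R x) = r *\<^sub>R Y' x"
      using sol_unique[OF V z0Z Y'[of "r *\<^sub>R x"]] sol_scale[OF V Y'[of x], of r]
      by (simp add: g'.scaleR pert_scale_left algebra_simps)
    have "norm (Y' x) \<le> KS * norm (g' x - pert x (Y z0))" by (rule sol_bound[OF V z0Z Y'])
    also have "\<dots> \<le> KS * (norm x * Kg + KP * norm x * norm (Y z0))"
      using norm_triangle_ineq4[of "g' x" "pert x (Y z0)"] norm_pert[of x "Y z0"] KS_pos Kg[of x]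
      by (intro mult_left_mono) linarith+
    finally show "norm (Y' x) \<le> norm x * (KS * (Kg + KP * norm (Y z0)))" by (simp add: algebra_simps)
  qed
  have gcont: "(g \<longlongrightarrow> g z0) (at z0)" using has_derivative_continuous[OF g] by (simp add: continuous_within)
  have ev: "\<forall>\<^sub>F z in at z0. z \<in> Z"
    using z0 by (metis (no_types, lifting) eventually_at_topological interior_subset open_interior subsetD)
  have tendsYd: "((\<lambda>z. KS * (norm (g z - g z0) + KP * norm (z - z0) * norm (Y z0))) \<longlongrightarrow>
      KS * (norm (g z0 - g z0) + KP * norm (z0 - z0) * norm (Y z0))) (at z0)"
    by (intro tendsto_intros gcont)
  have Ycont: "((\<lambda>z. norm (Y z - Y z0)) \<longlongrightarrow> 0) (at z0)"
  proof (rule tendsto_sandwich[OF _ _ tendsto_const])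
    show "\<forall>\<^sub>F z in at z0. norm (Y z - Y z0) \<le> KS * (norm (g z - g z0) + KP * norm (z - z0) * norm (Y z0))"
      using ev by eventually_elim (rule sol_Lipschitz[OF V _ Y Y[OF z0Z]])
    show "((\<lambda>z. KS * (norm (g z - g z0) + KP * norm (z - z0) * norm (Y z0))) \<longlongrightarrow> 0) (at z0)"
      using tendsYd by simp
  qed auto
  \<comment> \<open>With the operator frozen at \<open>z0\<close>, the remainder of \<open>Y\<close>
    solves a problem whose right-hand side is the remainder of \<open>g\<close> minus
    \<open>pert (z - z0) (Y z - Y z0)\<close>. The latter is a product of two small factors by the
    continuity of \<open>Y\<close> just shown.\<close>
  have rem: "norm (Y z - Y z0 - Y' (z - z0)) / norm (z - z0)
      \<le> KS * (norm (g z - g z0 - g' (z - z0)) / norm (z - z0) + KP * norm (Y z - Y z0))"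
    if z: "z \<in> Z" "z \<noteq> z0" for z
  proof -
    let ?G = "g z - g z0 - g' (z - z0)"
    have "sol V z0 (g z + pert (z0 - z) (Y z) - g z0 - (g' (z - z0) - pert (z - z0) (Y z0))) (Y z - Y z0 - Y' (z - z0))"
      by (intro sol_diff[OF V] sol_shift Y Y' z z0Z)
    moreover have "g z + pert (z0 - z) (Y z) - g z0 - (g' (z - z0) - pert (z - z0) (Y z0))
       = ?G - pert (z - z0) (Y z - Y z0)"
      by (simp add: pert_diff_left pert_diff algebra_simps)
    ultimately have "sol V z0 (?G - pert (z - z0) (Y z - Y z0)) (Y z - Y z0 - Y' (z - z0))" by simp
    then have "norm (Y z - Y z0 - Y' (z - z0)) \<le> KS * norm (?G - pert (z - z0) (Y z - Y z0))"
      by (rule sol_bound[OF V z0Z])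
    also have "\<dots> \<le> KS * (norm ?G + KP * norm (z - z0) * norm (Y z - Y z0))"
      using norm_triangle_ineq4[of ?G "pert (z - z0) (Y z - Y z0)"] norm_pert[of "z - z0" "Y z - Y z0"] KS_pos
      by (intro mult_left_mono) linarith+
    finally show ?thesis using z by (simp add: field_simps)
  qed
  have "((\<lambda>z. norm (Y z - Y z0 - Y' (z - z0)) / norm (z - z0)) \<longlongrightarrow> 0) (at z0)"
  proof (rule tendsto_sandwich[OF _ _ tendsto_const])
    show "\<forall>\<^sub>F z in at z0. norm (Y z - Y z0 - Y' (z - z0)) / norm (z - z0)
       \<le> KS * (norm (g z - g z0 - g' (z - z0)) / norm (z - z0) + KP * norm (Y z - Y z0))"
      using ev eventually_neq_at_within[of z0] by eventually_elim (rule rem)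
    have "((\<lambda>z. norm (g z - g z0 - g' (z - z0)) / norm (z - z0)) \<longlongrightarrow> 0) (at z0)"
      using g by (simp only: has_derivative_iff_norm)
    then have "((\<lambda>z. KS * (norm (g z - g z0 - g' (z - z0)) / norm (z - z0) + KP * norm (Y z - Y z0)))
        \<longlongrightarrow> KS * (0 + KP * 0)) (at z0)" by (intro tendsto_intros Ycont)
    then show "((\<lambda>z. KS * (norm (g z - g z0 - g' (z - z0)) / norm (z - z0) + KP * norm (Y z - Y z0)))
        \<longlongrightarrow> 0) (at z0)" by simp
  qed auto
  then have "(Y has_derivative Y') (at z0)" using lin by (simp add: has_derivative_iff_norm)
  then show ?thesis using Y' that by blast
qed

end

text \<open>\<open>J\<close> is complex conjugation in the application. The operators are symmetric
  only up to \<open>J\<close>, which reflects a bilinear form that is symmetric without conjugates;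
  the adjoint problem then has the same operator as the state equation.\<close>

locale tracking_family = affine_family A0 A M Mt W Z c KM KA
  for A0 :: "'h::{real_inner,complete_space} \<Rightarrow> 'h" and A :: "'l::finite \<Rightarrow> 'h \<Rightarrow> 'h"
    and M Mt W Z c KM KA +
  fixes J :: "'h \<Rightarrow> 'h" and d g :: 'h and \<alpha> :: real
  assumes J: "bounded_linear J" and J_iso: "\<And>x y. J x \<bullet> J y = x \<bullet> y"
    and A0_sym: "\<And>x y. A0 x \<bullet> J y = A0 y \<bullet> J x" and A_sym: "\<And>k x y. A k x \<bullet> J y = A k y \<bullet> J x"
begin

lemma opr_sym: "opr z x \<bullet> J y = opr z y \<bullet> J x"
  by (simp add: opr_def pert_def inner_add_left inner_sum_left A0_sym A_sym)

lemma J_diff: "J (x - y) = J x - J y" using J by (simp add: bounded_linear.linear linear_diff)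

lemma norm_J: "norm (J x) = norm x" by (simp add: norm_eq_sqrt_inner J_iso)

text \<open>The vector representing the derivative of the reduced cost when \<open>y\<close> and
  \<open>p\<close> are the state and the adjoint state at \<open>z\<close>; its components become
  the multipliers \<open>dfrak\<close> in the application.\<close>

definition gradient :: "real^'l \<Rightarrow> 'h \<Rightarrow> 'h \<Rightarrow> real^'l" where
  "gradient z y p = \<alpha> *\<^sub>R z - (\<Sum>k\<in>UNIV. (A k y \<bullet> J p) *\<^sub>R axis k 1)"

lemma gradient_nth: "gradient z y p $ k = \<alpha> * z $ k - A k y \<bullet> J p"
  by (simp add: gradient_def axis_def if_distrib sum.delta cong: if_cong)

lemma inner_gradient: "gradient z y p \<bullet> v = \<alpha> * (z \<bullet> v) - pert v y \<bullet> J p"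
  by (simp add: gradient_def pert_def inner_diff_left inner_sum_left inner_axis' mult.commute)

text \<open>Adjoint calculus: the adjoint equation is tested with \<open>J (Y' v)\<close> and the
  linearized state equation with \<open>J p\<close>. By symmetry the two left-hand sides agree,
  which eliminates \<open>Y'\<close>. Both test functions are admissible because \<open>V\<close> is
  invariant under \<open>J\<close>.\<close>

lemma tracking_has_derivative:
  assumes V: "trial V" "J ` V \<subseteq> V" and z0: "z0 \<in> interior Z"
    and Y: "\<And>z. z \<in> Z \<Longrightarrow> sol V z g (Y z)" and p: "sol V z0 (J (Y z0 - d)) p"
  shows "((\<lambda>z. 1/2 * (norm (Y z - d))\<^sup>2 + \<alpha> / 2 * (norm z)\<^sup>2) has_derivative
           (\<lambda>v. gradient z0 (Y z0) p \<bullet> v)) (at z0)"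
proof -
  obtain Y' where Y': "(Y has_derivative Y') (at z0)" "\<And>v. sol V z0 (0 - pert v (Y z0)) (Y' v)"
    using sol_has_derivative[OF V(1) z0 has_derivative_const[of g] Y] by blast
  have eq: "(Y z0 - d) \<bullet> Y' v = - (pert v (Y z0) \<bullet> J p)" for v
  proof -
    have v: "Y' v \<in> V" using Y'(2) by (simp add: sol_def)
    have "(Y z0 - d) \<bullet> Y' v = J (Y z0 - d) \<bullet> J (Y' v)" by (simp add: J_iso)
    also have "\<dots> = opr z0 p \<bullet> J (Y' v)" using p V v by (auto simp: sol_def)
    also have "\<dots> = opr z0 (Y' v) \<bullet> J p" by (rule opr_sym)
    also have "\<dots> = - (pert v (Y z0) \<bullet> J p)"
      using Y'(2)[of v] V p by (auto simp: sol_def image_subset_iff)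
    finally show ?thesis .
  qed
  have "((\<lambda>z. 1/2 * ((Y z - d) \<bullet> (Y z - d)) + \<alpha> / 2 * (z \<bullet> z)) has_derivative
      (\<lambda>v. 1/2 * ((Y z0 - d) \<bullet> (Y' v - 0) + (Y' v - 0) \<bullet> (Y z0 - d)) + \<alpha> / 2 * (z0 \<bullet> v + v \<bullet> z0))) (at z0)"
    by (intro derivative_intros Y'(1))
  moreover have "(\<lambda>v. 1/2 * ((Y z0 - d) \<bullet> (Y' v - 0) + (Y' v - 0) \<bullet> (Y z0 - d)) + \<alpha> / 2 * (z0 \<bullet> v + v \<bullet> z0))
     = (\<lambda>v. gradient z0 (Y z0) p \<bullet> v)"
  proof
    fix v show "1/2 * ((Y z0 - d) \<bullet> (Y' v - 0) + (Y' v - 0) \<bullet> (Y z0 - d)) + \<alpha> / 2 * (z0 \<bullet> v + v \<bullet> z0)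
        = gradient z0 (Y z0) p \<bullet> v"
      using eq[of v] inner_commute[of "Y' v" "Y z0 - d"] inner_commute[of v z0] by (simp add: inner_gradient)
  qed
  ultimately show ?thesis by (simp add: power2_norm_eq_inner)
qed

text \<open>The adjoint state solves a problem whose data \<open>J (Y z - d)\<close> vary with the
  parameter, so \<open>sol_has_derivative\<close> applies twice: with constant data for
  \<open>Y\<close>, then with these data for \<open>P\<close>.\<close>

lemma gradient_differentiable:
  assumes V: "trial V" and z0: "z0 \<in> interior Z"
    and Y: "\<And>z. z \<in> Z \<Longrightarrow> sol V z g (Y z)" and P: "\<And>z. z \<in> Z \<Longrightarrow> sol V z (J (Y z - d)) (P z)"
  shows "(\<lambda>z. gradient z (Y z) (P z)) differentiable (at z0)"
proof -
  obtain Y' where Y': "(Y has_derivative Y') (at z0)"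
    using sol_has_derivative[OF V z0 has_derivative_const[of g] Y] by blast
  have "((\<lambda>z. J (Y z - d)) has_derivative (\<lambda>v. J (Y' v - 0))) (at z0)"
    by (intro bounded_linear.has_derivative[OF J] derivative_intros Y')
  then obtain P' where P': "(P has_derivative P') (at z0)"
    using sol_has_derivative[OF V z0 _ P] by blast
  have "((\<lambda>z. \<alpha> *\<^sub>R z - (\<Sum>k\<in>UNIV. (A k (Y z) \<bullet> J (P z)) *\<^sub>R (axis k 1 :: real^'l))) has_derivative
     (\<lambda>v. \<alpha> *\<^sub>R v - (\<Sum>k\<in>UNIV. (A k (Y z0) \<bullet> J (P' v) + A k (Y' v) \<bullet> J (P z0)) *\<^sub>R axis k 1))) (at z0)"
    by (intro derivative_intros bounded_linear.has_derivative[OF A Y'] bounded_linear.has_derivative[OF J P'])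
  then show ?thesis unfolding gradient_def by (rule differentiableI)
qed

text \<open>Both gradients are taken at the same control, so the Tikhonov terms cancel and only the
  difference of two bilinear expressions remains.\<close>

lemma norm_gradient_diff:
  "norm (gradient z y p - gradient z y' p')
     \<le> KP * (norm (y - y') * norm p + norm y' * norm (p - p'))"
proof -
  have comp: "\<bar>(gradient z y p - gradient z y' p') $ k\<bar> \<le> KA * (norm (y - y') * norm p + norm y' * norm (p - p'))" for k
  proof -
    have "(gradient z y p - gradient z y' p') $ k = - (A k (y - y') \<bullet> J p + A k y' \<bullet> J (p - p'))"
      by (simp add: gradient_nth A_simps J_diff inner_diff_left inner_diff_right)
    also have "\<bar>\<dots>\<bar> \<le> norm (A k (y - y')) * norm (J p) + norm (A k y') * norm (J (p - p'))"
      using Cauchy_Schwarz_ineq2[of "A k (y - y')" "J p"] Cauchy_Schwarz_ineq2[of "A k y'" "J (p - p')"] by linarith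
    also have "\<dots> \<le> (KA * norm (y - y')) * norm p + (KA * norm y') * norm (p - p')"
      unfolding norm_J by (intro add_mono mult_right_mono KA) auto
    finally show ?thesis by (simp add: algebra_simps)
  qed
  have "norm (gradient z y p - gradient z y' p') \<le> (\<Sum>k\<in>UNIV. \<bar>(gradient z y p - gradient z y' p') $ k\<bar>)"
    by (rule norm_le_l1_cart)
  also have "\<dots> \<le> (\<Sum>k\<in>(UNIV::'l set). KA * (norm (y - y') * norm p + norm y' * norm (p - p')))"
    by (intro sum_mono comp)
  finally show ?thesis by (simp add: KP_def)
qed

end


section \<open>Error of local minimizers\<close>

text \<open>\<open>second_deriv\<close> differentiates the map sending \<open>z\<close> to the first
  derivative in the fixed direction \<open>v\<close>. Near \<open>u\<close> this map is
  \<open>G z \<bullet> v\<close>, and agreement on an open neighbourhood is enough for the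
  derivative.\<close>

lemma second_deriv_eq:
  fixes j :: "'a::real_inner \<Rightarrow> real"
  assumes S: "open S" "u \<in> S" and j: "\<And>z. z \<in> S \<Longrightarrow> (j has_derivative (\<lambda>v. G z \<bullet> v)) (at z)"
    and G: "(G has_derivative G') (at u)"
  shows "second_deriv j u v w = G' w \<bullet> v"
proof -
  have "((\<lambda>z. G z \<bullet> v) has_derivative (\<lambda>w. G' w \<bullet> v)) (at u)"
    using has_derivative_inner_left[OF G] .
  then have "((\<lambda>z. frechet_derivative j (at z) v) has_derivative (\<lambda>w. G' w \<bullet> v)) (at u)"
    by (rule has_derivative_transform_within_open[OF _ S]) (simp add: frechet_derivative_at[OF j, symmetric])
  then show ?thesis by (simp add: second_deriv_def frechet_derivative_at[symmetric])
qed

lemma variational_inequality: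
  fixes j :: "'a::real_inner \<Rightarrow> real"
  assumes U: "convex U" and loc: "local_min_on U j u" and j: "(j has_derivative j') (at u)" and v: "v \<in> U"
  shows "0 \<le> j' (v - u)"
proof -
  obtain \<delta> where u: "u \<in> U" and \<delta>: "0 < \<delta>" "\<And>x. x \<in> U \<Longrightarrow> dist x u < \<delta> \<Longrightarrow> j u \<le> j x"
    using loc by (auto simp: local_min_on_def)
  define \<phi> where "\<phi> t = j (u + t *\<^sub>R (v - u))" for t
  have "((\<lambda>t. u + t *\<^sub>R (v - u)) has_derivative (\<lambda>t. t *\<^sub>R (v - u))) (at 0)"
    by (auto intro!: derivative_eq_intros)
  moreover have "(j has_derivative j') (at (u + 0 *\<^sub>R (v - u)))" using j by simp
  ultimately have "(\<phi> has_derivative (\<lambda>t. j' (t *\<^sub>R (v - u)))) (at 0)"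
    unfolding \<phi>_def by (rule has_derivative_compose)
  moreover have "(\<lambda>t. j' (t *\<^sub>R (v - u))) = (\<lambda>t. j' (v - u) * t)"
    using linear_scale[OF has_derivative_linear[OF j]] by (auto simp: mult.commute)
  ultimately have der: "(\<phi> has_real_derivative j' (v - u)) (at 0)"
    by (simp add: has_field_derivative_def)
  show ?thesis
  proof (rule ccontr)
    assume "\<not> 0 \<le> j' (v - u)"
    then obtain e where e: "0 < e" "\<And>t. 0 < t \<Longrightarrow> t < e \<Longrightarrow> \<phi> t < \<phi> 0"
      using DERIV_neg_dec_right[OF der] by auto
    \<comment> \<open>Small enough to lie in the interval of decrease, to stay on the segment from
      \<open>u\<close> to \<open>v\<close>, and to remain in the ball of local minimality; the
      \<open>+ 1\<close> keeps the denominator positive.\<close>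
    define t where "t = min (e / 2) (min (1 / 2) (\<delta> / (2 * (norm (v - u) + 1))))"
    have t: "0 < t" "t < e" "t \<le> 1" "t \<le> \<delta> / (2 * (norm (v - u) + 1))"
      using e(1) \<delta>(1) by (auto simp: t_def add_nonneg_pos)
    have eqt: "u + t *\<^sub>R (v - u) = (1 - t) *\<^sub>R u + t *\<^sub>R v" by (simp add: algebra_simps)
    have "u + t *\<^sub>R (v - u) \<in> U"
      unfolding eqt using t by (intro convexD[OF U u v]) auto
    moreover have "dist (u + t *\<^sub>R (v - u)) u < \<delta>"
    proof -
      have "t * norm (v - u) \<le> t * (2 * (norm (v - u) + 1)) - t"
        using t(1) by (simp add: algebra_simps add_nonneg_nonneg)
      also have "\<dots> < \<delta>" using t by (simp add: pos_le_divide_eq add_nonneg_pos)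
      finally show ?thesis using t(1) by (simp add: dist_norm)
    qed
    ultimately have "\<phi> 0 \<le> \<phi> t" using \<delta>(2) by (simp add: \<phi>_def)
    then show False using e(2)[OF t(1,2)] by simp
  qed
qed

lemma strict_local_min_imp_local_min:
  "strict_local_min_on U j u \<Longrightarrow> local_min_on U j u"
  unfolding strict_local_min_on_def local_min_on_def by (metis less_imp_le order_refl)

section \<open>Optimality conditions on boxes\<close>

definition order_box :: "real^'l::finite \<Rightarrow> real^'l \<Rightarrow> (real^'l) set" where
  "order_box a b = {v. \<forall>k. a $ k \<le> v $ k \<and> v $ k \<le> b $ k}"

lemma convex_order_box: "convex (order_box (a :: real^'l::finite) b)"
proof (rule convexI)
  fix x y :: "real^'l" and s t :: real
  assume x: "x \<in> order_box a b" and y: "y \<in> order_box a b" and st: "0 \<le> s" "0 \<le> t" "s + t = 1"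
  have "a $ k \<le> s * x $ k + t * y $ k \<and> s * x $ k + t * y $ k \<le> b $ k" for k
  proof -
    have "s * a $ k + t * a $ k \<le> s * x $ k + t * y $ k" "s * x $ k + t * y $ k \<le> s * b $ k + t * b $ k"
      using x y st by (auto simp: order_box_def intro!: add_mono mult_left_mono)
    then show ?thesis using st(3) by (simp add: distrib_right[symmetric])
  qed
  then show "s *\<^sub>R x + t *\<^sub>R y \<in> order_box a b" by (simp add: order_box_def)
qed

text \<open>Moving a single component of \<open>w\<close> within its bounds stays in the box, so the
  variational inequality decouples into scalar ones; evaluate the scalar one at the bound
  itself.\<close>

lemma order_box_bound_attained:
  fixes a b w :: "real^'l::finite"
  assumes w: "w \<in> order_box a b" and ab: "a $ k \<le> b $ k"
    and vi: "\<And>v. v \<in> order_box a b \<Longrightarrow> 0 \<le> q \<bullet> (v - w)"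
  shows "0 < q $ k \<Longrightarrow> w $ k = a $ k" "q $ k < 0 \<Longrightarrow> w $ k = b $ k"
proof -
  have *: "0 \<le> q $ k * (t - w $ k)" if "a $ k \<le> t" "t \<le> b $ k" for t
  proof -
    have "w + (t - w $ k) *\<^sub>R axis k 1 \<in> order_box a b"
      using w that by (auto simp: order_box_def axis_def)
    from vi[OF this] show ?thesis by (simp add: inner_axis mult.commute)
  qed
  show "0 < q $ k \<Longrightarrow> w $ k = a $ k" using *[of "a $ k"] ab w
    by (auto simp: order_box_def zero_le_mult_iff intro: antisym)
  show "q $ k < 0 \<Longrightarrow> w $ k = b $ k" using *[of "b $ k"] ab w
    by (auto simp: order_box_def zero_le_mult_iff intro: antisym)
qed

context tracking_family begin

text \<open>The set of directions in which coercivity of the second derivative is required contains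
  \<open>uh - u\<close> as soon as the discrete gradient at \<open>uh\<close> is close to the gradient at \<open>u\<close>: the
  components with a large multiplier are then fixed at the same bound.\<close>

theorem local_minimizer_error:
  fixes a b u :: "real^'l" and uh :: "real \<Rightarrow> real^'l" and \<rho> :: "real \<Rightarrow> real" and Vh :: "real \<Rightarrow> 'h set"
  assumes W: "trial W" "J ` W \<subseteq> W" and Vh: "\<And>h. h \<in> H \<Longrightarrow> trial (Vh h)" "\<And>h. h \<in> H \<Longrightarrow> J ` Vh h \<subseteq> Vh h"
    and ab: "\<And>k. a $ k \<le> b $ k" and UZ: "order_box a b \<subseteq> interior Z"
    and Y: "\<And>z. z \<in> Z \<Longrightarrow> sol W z g (Y z)"
    and P: "\<And>z. z \<in> Z \<Longrightarrow> sol W z (J (Y z - d)) (P z)"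
    and Yh: "\<And>h z. h \<in> H \<Longrightarrow> z \<in> Z \<Longrightarrow> sol (Vh h) z g (Yh h z)"
    and Ph: "\<And>h z. h \<in> H \<Longrightarrow> z \<in> Z \<Longrightarrow> sol (Vh h) z (J (Yh h z - d)) (Ph h z)"
    and Pf: "\<And>h z. h \<in> H \<Longrightarrow> z \<in> Z \<Longrightarrow> sol (Vh h) z (J (Y z - d)) (Pf h z)"
    and j: "\<And>z. z \<in> Z \<Longrightarrow> j z = 1/2 * (norm (Y z - d))\<^sup>2 + \<alpha> / 2 * (norm z)\<^sup>2"
    and jh: "\<And>h z. h \<in> H \<Longrightarrow> z \<in> Z \<Longrightarrow> jh h z = 1/2 * (norm (Yh h z - d))\<^sup>2 + \<alpha> / 2 * (norm z)\<^sup>2"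
    and u: "local_min_on (order_box a b) j u"
    and uh: "\<And>h. h \<in> H \<Longrightarrow> local_min_on (order_box a b) (jh h) (uh h)"
    and lim: "(uh \<longlongrightarrow> u) (at 0 within H)"
    and \<rho>: "(\<rho> \<longlongrightarrow> 0) (at 0 within H)"
    and rate: "\<And>h z. h \<in> H \<Longrightarrow> z \<in> order_box a b \<Longrightarrow> norm (Y z - Yh h z) \<le> C * \<rho> h"
      "\<And>h z. h \<in> H \<Longrightarrow> z \<in> order_box a b \<Longrightarrow> norm (P z - Pf h z) \<le> C * \<rho> h"
    and second: "0 < \<tau>" "0 < \<nu>" "\<And>v. (\<And>k. (u $ k = a $ k \<longrightarrow> 0 \<le> v $ k) \<and> (u $ k = b $ k \<longrightarrow> v $ k \<le> 0) \<and>
          (\<tau> < \<bar>gradient u (Y u) (P u) $ k\<bar> \<longrightarrow> v $ k = 0)) \<Longrightarrow> \<nu> * (norm v)\<^sup>2 \<le> second_deriv j u v v"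
  shows "\<exists>C'. \<forall>\<^sub>F h in at 0 within H.
    norm (u - uh h) + norm (Y u - Yh h (uh h)) + norm (P u - Ph h (uh h)) \<le> C' * \<rho> h"
proof -
  let ?U = "order_box a b"
  define G where "G z = gradient z (Y z) (P z)" for z
  define Gh where "Gh h z = gradient z (Yh h z) (Ph h z)" for h z
  have U: "z \<in> Z" "z \<in> interior Z" if "z \<in> ?U" for z using that UZ interior_subset by auto
  have uU: "u \<in> ?U" and uhU: "\<And>h. h \<in> H \<Longrightarrow> uh h \<in> ?U"
    using u uh by (auto simp: local_min_on_def)
  have dj: "(j has_derivative (\<lambda>v. G z \<bullet> v)) (at z)" if z: "z \<in> interior Z" for z
    unfolding G_def
    by (rule has_derivative_transform_within_open[OF tracking_has_derivative[OF W z Y P] open_interior z])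
      (use z j interior_subset[of Z] in auto)
  have djh: "(jh h has_derivative (\<lambda>v. Gh h z \<bullet> v)) (at z)" if h: "h \<in> H" and z: "z \<in> interior Z" for h z
    unfolding Gh_def
    by (rule has_derivative_transform_within_open[OF tracking_has_derivative[OF Vh[OF h] z Yh[OF h] Ph[OF h]] open_interior z])
      (use z jh[OF h] interior_subset[of Z] in auto)
  have "G differentiable (at u)"
    unfolding G_def by (rule gradient_differentiable[OF W(1) U(2)[OF uU] Y P])
  then obtain G' where G': "(G has_derivative G') (at u)" by (auto simp: differentiable_def)
  have sd: "second_deriv j u v v = G' v \<bullet> v" for v
    by (rule second_deriv_eq[OF open_interior U(2)[OF uU] dj G'])
  have vi: "0 \<le> G u \<bullet> (v - u)" if "v \<in> ?U" for v
    by (rule variational_inequality[OF convex_order_box u dj[OF U(2)[OF uU]] that])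
  have vih: "0 \<le> Gh h (uh h) \<bullet> (v - uh h)" if "h \<in> H" "v \<in> ?U" for h v
    by (rule variational_inequality[OF convex_order_box uh[OF that(1)] djh[OF that(1) U(2)[OF uhU[OF that(1)]]] that(2)])

  \<comment> \<open>A priori bounds for states and adjoint states, valid for all parameters in
    \<open>Z\<close> and all trial spaces at once.\<close>
  define BY where "BY = KS * norm g"
  define BP where "BP = KS * (BY + norm d)"
  have B0: "0 \<le> BY" "0 \<le> BP" using KS_pos by (auto simp: BY_def BP_def)
  have bY: "norm y \<le> BY" if "trial V" "z \<in> Z" "sol V z g y" for V z y
    using sol_bound[OF that] by (simp add: BY_def)
  have bP: "norm p \<le> BP" if "trial V" "z \<in> Z" "sol V z (J (y - d)) p" "norm y \<le> BY" for V z y p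
  proof -
    have "norm p \<le> KS * norm (y - d)" using sol_bound[OF that(1-3)] by (simp add: norm_J)
    also have "\<dots> \<le> BP" using that(4) norm_triangle_ineq4[of y d] KS_pos by (simp add: BP_def)
    finally show ?thesis .
  qed
  have stabP: "norm (p - p') \<le> KS * norm (y - y')"
    if "trial V" "z \<in> Z" "sol V z (J (y - d)) p" "sol V z (J (y' - d)) p'" for V z y y' p p'
    using sol_bound[OF that(1,2) sol_diff[OF that(1,3,4)]] by (simp add: J_diff[symmetric] norm_J)

  \<comment> \<open>\<open>Pf\<close> is driven by the exact state and \<open>Ph\<close> by the
    discrete one. Their difference solves the adjoint problem with the state error as datum, which
    contributes the term \<open>KS * C\<close>.\<close>
  define C1 where "C1 = C + KS * C"
  have errP: "norm (P z - Ph h z) \<le> C1 * \<rho> h" if h: "h \<in> H" "z \<in> ?U" for h z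
  proof -
    have "norm (Pf h z - Ph h z) \<le> KS * norm (Y z - Yh h z)"
      by (rule stabP[OF Vh(1)[OF h(1)] U(1)[OF h(2)] Pf[OF h(1) U(1)[OF h(2)]] Ph[OF h(1) U(1)[OF h(2)]]])
    also have "\<dots> \<le> KS * (C * \<rho> h)" using rate(1)[OF h] KS_pos by simp
    finally show ?thesis
      using rate(2)[OF h] norm_triangle_ineq[of "P z - Pf h z" "Pf h z - Ph h z"] by (simp add: C1_def algebra_simps)
  qed
  define C2 where "C2 = KP * (C * BP + BY * C1)"
  have errG: "norm (G z - Gh h z) \<le> C2 * \<rho> h" if h: "h \<in> H" "z \<in> ?U" for h z
  proof -
    note z = U(1)[OF h(2)]
    have "norm (G z - Gh h z) \<le> KP * (norm (Y z - Yh h z) * norm (P z) + norm (Yh h z) * norm (P z - Ph h z))"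
      unfolding G_def Gh_def by (rule norm_gradient_diff)
    also have "\<dots> \<le> KP * (C * \<rho> h * BP + BY * (C1 * \<rho> h))"
    proof (intro mult_left_mono add_mono mult_mono)
      show "norm (P z) \<le> BP" by (rule bP[OF W(1) z P[OF z] bY[OF W(1) z Y[OF z]]])
      show "norm (Yh h z) \<le> BY" by (rule bY[OF Vh(1)[OF h(1)] z Yh[OF h(1) z]])
      show "0 \<le> C * \<rho> h" using rate(1)[OF h] norm_ge_zero order_trans by blast
    qed (use rate(1)[OF h] errP[OF h] B0 KP_pos in auto)
    finally show ?thesis by (simp add: C2_def algebra_simps)
  qed

  have near: "\<forall>\<^sub>F h in at 0 within H. norm (u - uh h) \<le> 2 * C2 / \<nu> * \<rho> h"
  proof -
    have inH: "\<forall>\<^sub>F h in at 0 within H. h \<in> H" by (auto simp: eventually_at_filter)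
    \<comment> \<open>Differentiability of the gradient at the single point \<open>u\<close> is
      used: the tolerance is chosen so that the linearization error consumes half of
      \<open>\<nu>\<close>.\<close>
    have "\<exists>e>0. \<forall>z. norm (z - u) < e \<longrightarrow> norm (G z - G u - G' (z - u)) \<le> \<nu> / 2 * norm (z - u)"
      using G' second(2) unfolding has_derivative_at_alt by (metis half_gt_zero)
    then obtain e where e: "0 < e" "\<And>z. norm (z - u) < e \<Longrightarrow> norm (G z - G u - G' (z - u)) \<le> \<nu> / 2 * norm (z - u)"
      by blast
    have ev1: "\<forall>\<^sub>F h in at 0 within H. norm (uh h - u) < e"
      using tendstoD[OF lim e(1)] by (simp add: dist_norm)
    have contG: "((\<lambda>h. G (uh h)) \<longlongrightarrow> G u) (at 0 within H)"
      using has_derivative_continuous[OF G'] lim by (rule isCont_tendsto_compose)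
    \<comment> \<open>Brings the discrete gradient at \<open>uh h\<close> within
      \<open>\<tau>\<close> of the gradient at \<open>u\<close>; a component of modulus above
      \<open>\<tau>\<close> then has the same strict sign in both.\<close>
    have ev2: "\<forall>\<^sub>F h in at 0 within H. C2 * \<rho> h + norm (G (uh h) - G u) < \<tau>"
    proof (rule order_tendstoD)
      show "((\<lambda>h. C2 * \<rho> h + norm (G (uh h) - G u)) \<longlongrightarrow> C2 * 0 + norm (G u - G u)) (at 0 within H)"
        by (intro tendsto_intros \<rho> contG)
    qed (use second(1) in simp)
    from inH ev1 ev2 show ?thesis
    proof eventually_elim
      case (elim h)
      note h = elim(1)
      let ?e = "uh h - u"
      have close: "norm (Gh h (uh h) - G u) < \<tau>"
      proof -
        have "norm (Gh h (uh h) - G u) \<le> norm (G (uh h) - Gh h (uh h)) + norm (G (uh h) - G u)"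
          using norm_triangle_ineq[of "Gh h (uh h) - G (uh h)" "G (uh h) - G u"] by (simp add: norm_minus_commute)
        then show ?thesis using errG[OF h uhU[OF h]] elim(3) by linarith
      qed
      have "\<nu> * (norm ?e)\<^sup>2 \<le> second_deriv j u ?e ?e"
      proof (rule second(3), intro conjI impI)
        fix k
        show "u $ k = a $ k \<Longrightarrow> 0 \<le> ?e $ k" "u $ k = b $ k \<Longrightarrow> ?e $ k \<le> 0"
          using uhU[OF h] by (auto simp: order_box_def)
        assume "\<tau> < \<bar>gradient u (Y u) (P u) $ k\<bar>"
        then have big: "\<tau> < \<bar>G u $ k\<bar>" by (simp add: G_def)
        have ck: "\<bar>Gh h (uh h) $ k - G u $ k\<bar> < \<tau>"
          using component_le_norm_cart[of "Gh h (uh h) - G u" k] close by simp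
        note bu = order_box_bound_attained[OF uU ab vi]
        note bh = order_box_bound_attained[OF uhU[OF h] ab vih[OF h]]
        show "?e $ k = 0"
        proof (cases "0 < G u $ k")
          case True
          then have "0 < Gh h (uh h) $ k" using big ck by linarith
          then show ?thesis using bu(1)[OF _ True] bh(1) by simp
        next
          case False
          then have "G u $ k < 0" "Gh h (uh h) $ k < 0" using big ck second(1) by linarith+
          then show ?thesis using bu(2) bh(2) by simp
        qed
      qed
      then have 1: "\<nu> * (norm ?e)\<^sup>2 \<le> G' ?e \<bullet> ?e" by (simp add: sd)
      have "\<bar>(G (uh h) - G u - G' ?e) \<bullet> ?e\<bar> \<le> norm (G (uh h) - G u - G' ?e) * norm ?e"
        by (rule Cauchy_Schwarz_ineq2)
      also have "\<dots> \<le> (\<nu> / 2 * norm ?e) * norm ?e"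
        by (rule mult_right_mono[OF e(2)[OF elim(2)]]) simp
      finally have 2: "\<bar>(G (uh h) - G u - G' ?e) \<bullet> ?e\<bar> \<le> \<nu> / 2 * (norm ?e)\<^sup>2"
        by (simp add: power2_eq_square mult.assoc)
      have "(G (uh h) - Gh h (uh h)) \<bullet> ?e \<le> norm (G (uh h) - Gh h (uh h)) * norm ?e" by (rule norm_cauchy_schwarz)
      also have "\<dots> \<le> (C2 * \<rho> h) * norm ?e" by (rule mult_right_mono[OF errG[OF h uhU[OF h]]]) simp
      finally have 3: "(G (uh h) - Gh h (uh h)) \<bullet> ?e \<le> (C2 * \<rho> h) * norm ?e" .
      have 4: "0 \<le> G u \<bullet> ?e" "Gh h (uh h) \<bullet> ?e \<le> 0"
        using vi[OF uhU[OF h]] vih[OF h uU] by (simp_all add: inner_diff_right)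
      have "\<nu> / 2 * (norm ?e)\<^sup>2 \<le> (C2 * \<rho> h) * norm ?e"
        using 1 2 3 4 unfolding inner_diff_left abs_le_iff by linarith
      then have "(\<nu> / 2 * norm ?e) * norm ?e \<le> (C2 * \<rho> h) * norm ?e" by (simp add: power2_eq_square mult.assoc)
      \<comment> \<open>Covers the case \<open>uh h = u\<close>, where the factor
        \<open>norm ?e\<close> cannot be cancelled.\<close>
      moreover have "0 \<le> C2 * \<rho> h" using errG[OF h uhU[OF h]] norm_ge_zero order_trans by blast
      ultimately have "\<nu> / 2 * norm ?e \<le> C2 * \<rho> h" by (cases "norm ?e = 0") auto
      then show ?case using second(2) by (simp add: field_simps norm_minus_commute)
    qed
  qed

  \<comment> \<open>Lipschitz constants of state and adjoint state with respect to the control: the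
    finite element errors are estimated at the control \<open>uh h\<close>, and these constants
    carry the estimate over to \<open>u\<close>.\<close>
  define LY where "LY = KS * (KP * BY)"
  define LP where "LP = KS * (LY + KP * BP)"
  have LY: "norm (Y z - Y z') \<le> LY * norm (z - z')" if z: "z \<in> Z" "z' \<in> Z" for z z'
  proof -
    have "norm (Y z - Y z') \<le> KS * (norm (g - g) + KP * norm (z - z') * norm (Y z'))"
      by (rule sol_Lipschitz[OF W(1) z(1) Y[OF z(1)] Y[OF z(2)]])
    also have "\<dots> \<le> KS * (0 + KP * norm (z - z') * BY)"
      using KS_pos KP_pos bY[OF W(1) z(2) Y[OF z(2)]] by (intro mult_left_mono add_mono) auto
    finally show ?thesis by (simp add: LY_def mult_ac)
  qed
  have LP: "norm (P z - P z') \<le> LP * norm (z - z')" if z: "z \<in> Z" "z' \<in> Z" for z z'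
  proof -
    have "norm (P z - P z') \<le> KS * (norm (J (Y z - d) - J (Y z' - d)) + KP * norm (z - z') * norm (P z'))"
      by (rule sol_Lipschitz[OF W(1) z(1) P[OF z(1)] P[OF z(2)]])
    also have "\<dots> \<le> KS * (LY * norm (z - z') + KP * norm (z - z') * BP)"
    proof (intro mult_left_mono add_mono)
      show "norm (J (Y z - d) - J (Y z' - d)) \<le> LY * norm (z - z')"
        using LY[OF z] by (simp add: J_diff[symmetric] norm_J)
      show "norm (P z') \<le> BP" by (rule bP[OF W(1) z(2) P[OF z(2)] bY[OF W(1) z(2) Y[OF z(2)]]])
    qed (use KS_pos KP_pos in auto)
    finally show ?thesis by (simp add: LP_def algebra_simps)
  qed
  have L0: "0 \<le> LY" "0 \<le> LP" using KS_pos KP_pos B0 by (auto simp: LY_def LP_def)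
  define K where "K = 2 * C2 / \<nu>"
  have inH: "\<forall>\<^sub>F h in at 0 within H. h \<in> H" by (auto simp: eventually_at_filter)
  have "\<forall>\<^sub>F h in at 0 within H. norm (u - uh h) + norm (Y u - Yh h (uh h)) + norm (P u - Ph h (uh h))
      \<le> (K + (LY * K + C) + (LP * K + C1)) * \<rho> h"
    using inH near
  proof eventually_elim
    case (elim h)
    note h = elim(1) and hU = uhU[OF elim(1)]
    have n: "norm (u - uh h) \<le> K * \<rho> h" using elim(2) by (simp add: K_def)
    have "norm (Y u - Yh h (uh h)) \<le> norm (Y u - Y (uh h)) + norm (Y (uh h) - Yh h (uh h))"
      using norm_triangle_ineq[of "Y u - Y (uh h)" "Y (uh h) - Yh h (uh h)"] by simp
    also have "\<dots> \<le> LY * (K * \<rho> h) + C * \<rho> h"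
      using LY[OF U(1)[OF uU] U(1)[OF hU]] mult_left_mono[OF n L0(1)] rate(1)[OF h hU] by linarith
    finally have 1: "norm (Y u - Yh h (uh h)) \<le> LY * (K * \<rho> h) + C * \<rho> h" .
    have "norm (P u - Ph h (uh h)) \<le> norm (P u - P (uh h)) + norm (P (uh h) - Ph h (uh h))"
      using norm_triangle_ineq[of "P u - P (uh h)" "P (uh h) - Ph h (uh h)"] by simp
    also have "\<dots> \<le> LP * (K * \<rho> h) + C1 * \<rho> h"
      using LP[OF U(1)[OF uU] U(1)[OF hU]] mult_left_mono[OF n L0(2)] errP[OF h hU] by linarith
    finally show ?case using n 1 by (simp add: algebra_simps)
  qed
  then show ?thesis by blast
qed

end


section \<open>The Hilbert space of square integrable fields\<close>

lemma borel_measurable_vec_nth[measurable (raw)]: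
  fixes v :: "'a \<Rightarrow> ('b::euclidean_space)^'n::finite"
  assumes v: "v \<in> borel_measurable M" shows "(\<lambda>x. v x $ i) \<in> borel_measurable M"
  by (rule borel_measurable_continuous_on[OF _ v]) (intro continuous_intros)

lemma borel_measurable_vec_lambda[measurable (raw)]:
  fixes v :: "'a \<Rightarrow> 'n::finite \<Rightarrow> 'b::euclidean_space"
  assumes v: "\<And>i. (\<lambda>x. v x i) \<in> borel_measurable M" shows "(\<lambda>x. \<chi> i. v x i) \<in> borel_measurable M"
proof -
  have "(\<lambda>x. (\<chi> i. v x i) \<bullet> b) \<in> borel_measurable M" if "b \<in> Basis" for b :: "'b^'n"
    unfolding inner_vec_def using v by simp
  then show ?thesis by (subst borel_measurable_euclidean_space) blast
qed

lemma norm_smult: fixes v :: "complex^'n::finite" shows "norm (c *s v) = cmod c * norm v"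
  by (simp add: norm_vec_def L2_set_def norm_mult power_mult_distrib sum_distrib_left[symmetric] real_sqrt_mult)

lemma vcnj_simps [simp]: "vcnj (v + w) = vcnj v + vcnj w" "vcnj (r *\<^sub>R v) = r *\<^sub>R vcnj v" "vcnj 0 = 0"
  "vcnj (vcnj v) = v" "vcnj (- v) = - vcnj v" "vcnj (v - w) = vcnj v - vcnj w" "vcnj (c *s v) = cnj c *s vcnj v"
  by (auto simp: vcnj_def vec_eq_iff)

lemma norm_vcnj [simp]: "norm (vcnj v) = norm v"
  by (simp add: vcnj_def norm_vec_def)

lemma inner_vcnj [simp]: "vcnj v \<bullet> vcnj w = v \<bullet> w"
  by (simp add: vcnj_def inner_vec_def inner_complex_def)

lemma inner_eq_Re_cdot: "v \<bullet> w = Re (cdot v (vcnj w))"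
  by (simp add: inner_vec_def cdot_def vcnj_def inner_complex_def)

lemma inner_smult_left: "(c *s v) \<bullet> w = (v :: complex^3) \<bullet> (cnj c *s w)"
  by (simp add: inner_vec_def inner_complex_def algebra_simps)

lemma smult_linear [simp]: "(c::complex) *s (v + w) = c *s v + c *s w" "c *s (v - w) = c *s v - c *s w"
  "c *s (r *\<^sub>R v) = r *\<^sub>R (c *s v)" "c *s 0 = 0"
  by (auto simp: vec_eq_iff algebra_simps)

lemma borel_measurable_smult[measurable (raw)]:
  fixes v :: "'a \<Rightarrow> complex^3"
  assumes [measurable]: "m \<in> borel_measurable M" "v \<in> borel_measurable M"
  shows "(\<lambda>x. m x *s v x) \<in> borel_measurable M"
  unfolding vector_scalar_mult_def by measurable

lemma borel_measurable_vcnj[measurable (raw)]: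
  assumes [measurable]: "v \<in> borel_measurable M" shows "(\<lambda>x. vcnj (v x)) \<in> borel_measurable M"
proof -
  have "continuous_on UNIV cnj" by (intro continuous_intros)
  then have [measurable]: "cnj \<in> borel_measurable borel" by (rule borel_measurable_continuous_onI)
  show ?thesis unfolding vcnj_def by measurable
qed

section \<open>Square integrable functions before passing to classes\<close>

definition sqint :: "vfield \<Rightarrow> bool" where
  "sqint w \<longleftrightarrow> w \<in> borel_measurable lebesgue \<and> integrable lebesgue (\<lambda>x. (norm (w x))\<^sup>2)"

lemma sqint_measurable [measurable_dest]: "sqint w \<Longrightarrow> w \<in> borel_measurable lebesgue"
  by (simp add: sqint_def)

lemma sqint_zero [simp]: "sqint (\<lambda>x. 0)" by (simp add: sqint_def)

lemma sqint_bound: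
  assumes w: "sqint w" and [measurable]: "v \<in> borel_measurable lebesgue"
    and le: "AE x in lebesgue. norm (v x) \<le> B * norm (w x)"
  shows "sqint v"
proof -
  have "integrable lebesgue (\<lambda>x. (norm (v x))\<^sup>2)"
  proof (rule Bochner_Integration.integrable_bound)
    show "integrable lebesgue (\<lambda>x. B\<^sup>2 * (norm (w x))\<^sup>2)" using w by (simp add: sqint_def)
    show "AE x in lebesgue. norm ((norm (v x))\<^sup>2) \<le> norm (B\<^sup>2 * (norm (w x))\<^sup>2)"
      using le by eventually_elim (simp add: power_mult_distrib[symmetric] power_mono)
  qed measurable
  then show ?thesis by (simp add: sqint_def)
qed

lemma sqint_add: assumes "sqint v" "sqint w" shows "sqint (\<lambda>x. v x + w x)"
proof -
  note [measurable] = sqint_measurable[OF assms(1)] sqint_measurable[OF assms(2)]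
  have "integrable lebesgue (\<lambda>x. (norm (v x + w x))\<^sup>2)"
  proof (rule Bochner_Integration.integrable_bound)
    show "integrable lebesgue (\<lambda>x. 2 * (norm (v x))\<^sup>2 + 2 * (norm (w x))\<^sup>2)" using assms by (simp add: sqint_def)
    have "(norm (v x + w x))\<^sup>2 \<le> 2 * (norm (v x))\<^sup>2 + 2 * (norm (w x))\<^sup>2" for x
    proof -
      have "(norm (v x + w x))\<^sup>2 \<le> (norm (v x) + norm (w x))\<^sup>2" by (intro power_mono norm_triangle_ineq) simp
      also have "\<dots> \<le> 2 * (norm (v x))\<^sup>2 + 2 * (norm (w x))\<^sup>2"
        using sum_squares_bound[of "norm (v x)" "norm (w x)"] by (simp add: power2_sum)
      finally show ?thesis .
    qed
    then show "AE x in lebesgue. norm ((norm (v x + w x))\<^sup>2) \<le> norm (2 * (norm (v x))\<^sup>2 + 2 * (norm (w x))\<^sup>2)"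
      by auto
  qed measurable
  then show ?thesis by (simp add: sqint_def)
qed

lemma sqint_scaleR: "sqint v \<Longrightarrow> sqint (\<lambda>x. r *\<^sub>R v x)"
  by (rule sqint_bound[where w = v and B = "\<bar>r\<bar>"]) (auto simp: sqint_def)

lemma sqint_uminus: "sqint v \<Longrightarrow> sqint (\<lambda>x. - v x)"
  using sqint_scaleR[of v "-1"] by simp

lemma sqint_diff: "sqint v \<Longrightarrow> sqint w \<Longrightarrow> sqint (\<lambda>x. v x - w x)"
  using sqint_add[OF _ sqint_uminus, of v w] by simp

lemma sqint_vcnj: "sqint v \<Longrightarrow> sqint (\<lambda>x. vcnj (v x))"
  by (rule sqint_bound[where w = v and B = 1]) (auto simp: sqint_def)

lemma sqint_inner: assumes "sqint v" "sqint w" shows "integrable lebesgue (\<lambda>x. v x \<bullet> w x)"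
proof (rule Bochner_Integration.integrable_bound)
  note [measurable] = sqint_measurable[OF assms(1)] sqint_measurable[OF assms(2)]
  show "integrable lebesgue (\<lambda>x. (norm (v x))\<^sup>2 + (norm (w x))\<^sup>2)" using assms by (simp add: sqint_def)
  show "(\<lambda>x. v x \<bullet> w x) \<in> borel_measurable lebesgue" by measurable
  have "\<bar>v x \<bullet> w x\<bar> \<le> (norm (v x))\<^sup>2 + (norm (w x))\<^sup>2" for x
    using Cauchy_Schwarz_ineq2[of "v x" "w x"] sum_squares_bound[of "norm (v x)" "norm (w x)", unfolded mult.assoc]
      mult_nonneg_nonneg[OF norm_ge_zero[of "v x"] norm_ge_zero[of "w x"]] by linarith
  then show "AE x in lebesgue. norm (v x \<bullet> w x) \<le> norm ((norm (v x))\<^sup>2 + (norm (w x))\<^sup>2)" by simp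
qed

definition essbdd :: "(real^3 \<Rightarrow> complex) \<Rightarrow> bool" where
  "essbdd m \<longleftrightarrow> m \<in> borel_measurable lebesgue \<and> (\<exists>B. AE x in lebesgue. cmod (m x) \<le> B)"

lemma sqint_smult: assumes m: "essbdd m" and v: "sqint v" shows "sqint (\<lambda>x. m x *s v x)"
proof -
  obtain B where B: "AE x in lebesgue. cmod (m x) \<le> B" using m by (auto simp: essbdd_def)
  have [measurable]: "m \<in> borel_measurable lebesgue" "v \<in> borel_measurable lebesgue"
    using m v by (auto simp: essbdd_def sqint_def)
  show ?thesis
  proof (rule sqint_bound[OF v])
    show "AE x in lebesgue. norm (m x *s v x) \<le> B * norm (v x)"
      using B by eventually_elim (simp add: norm_smult mult_right_mono)
  qed measurable
qed

text \<open>Square integrable fields on the whole space modulo null sets; fields on a domain are extended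
  by zero.\<close>

quotient_type l2 = "vfield" / partial: "\<lambda>v w. sqint v \<and> sqint w \<and> (AE x in lebesgue. v x = w x)"
  morphisms rep_l2 abs_l2
proof (rule part_equivpI)
  show "\<exists>v. sqint v \<and> sqint v \<and> (AE x in lebesgue. v x = v x)" by (rule exI[of _ "\<lambda>x. 0"]) simp
  show "symp (\<lambda>v w. sqint v \<and> sqint w \<and> (AE x in lebesgue. v x = w x))"
    by (auto intro!: sympI elim: eventually_mono)
  show "transp (\<lambda>v w. sqint v \<and> sqint w \<and> (AE x in lebesgue. v x = w x))"
    by (auto intro!: transpI elim: eventually_elim2)
qed

instantiation l2 :: real_vector
begin
lift_definition zero_l2 :: l2 is "\<lambda>x. 0" by simp
lift_definition plus_l2 :: "l2 \<Rightarrow> l2 \<Rightarrow> l2" is "\<lambda>v w x. v x + w x"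
  by (auto intro!: sqint_add elim: eventually_elim2)
lift_definition minus_l2 :: "l2 \<Rightarrow> l2 \<Rightarrow> l2" is "\<lambda>v w x. v x - w x"
  by (auto intro!: sqint_diff elim: eventually_elim2)
lift_definition uminus_l2 :: "l2 \<Rightarrow> l2" is "\<lambda>v x. - v x"
  by (auto intro!: sqint_uminus elim: eventually_mono)
lift_definition scaleR_l2 :: "real \<Rightarrow> l2 \<Rightarrow> l2" is "\<lambda>r v x. r *\<^sub>R v x"
  by (auto intro!: sqint_scaleR elim: eventually_mono)
instance
proof
  fix x y z :: l2 and r t :: real
  show "x + y + z = x + (y + z)" by transfer (auto intro!: sqint_add simp: add.assoc)
  show "x + y = y + x" by transfer (auto intro!: sqint_add simp: add.commute)
  show "0 + x = x" by transfer auto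
  show "- x + x = 0" by transfer auto
  show "x - y = x + - y" by transfer (auto intro!: sqint_diff)
  show "r *\<^sub>R (x + y) = r *\<^sub>R x + r *\<^sub>R y" by transfer (auto intro!: sqint_add sqint_scaleR simp: scaleR_add_right)
  show "(r + t) *\<^sub>R x = r *\<^sub>R x + t *\<^sub>R x" by transfer (auto intro!: sqint_add sqint_scaleR simp: scaleR_add_left)
  show "r *\<^sub>R t *\<^sub>R x = (r * t) *\<^sub>R x" by transfer (auto intro!: sqint_scaleR)
  show "1 *\<^sub>R x = x" by transfer auto
qed
end

instantiation l2 :: real_inner
begin
lift_definition inner_l2 :: "l2 \<Rightarrow> l2 \<Rightarrow> real" is "\<lambda>v w. integral\<^sup>L lebesgue (\<lambda>x. v x \<bullet> w x)"
  by (intro integral_cong_AE) (auto intro: borel_measurable_inner simp: sqint_def elim: eventually_elim2)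
definition norm_l2 :: "l2 \<Rightarrow> real" where "norm_l2 v = sqrt (v \<bullet> v)"
definition dist_l2 :: "l2 \<Rightarrow> l2 \<Rightarrow> real" where "dist_l2 v w = norm (v - w)"
definition sgn_l2 :: "l2 \<Rightarrow> l2" where "sgn_l2 v = v /\<^sub>R norm v"
definition uniformity_l2 :: "(l2 \<times> l2) filter" where
  "uniformity_l2 = (INF e\<in>{0 <..}. principal {(x, y). dist x y < e})"
definition open_l2 :: "l2 set \<Rightarrow> bool" where
  "open_l2 U \<longleftrightarrow> (\<forall>x\<in>U. \<forall>\<^sub>F (x', y) in uniformity. x' = x \<longrightarrow> y \<in> U)"
instance
proof
  fix x y z :: l2 and r :: real
  show "x \<bullet> y = y \<bullet> x" by transfer (simp add: inner_commute)
  show "(x + y) \<bullet> z = x \<bullet> z + y \<bullet> z" by transfer (simp add: inner_add_left sqint_inner)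
  show "(r *\<^sub>R x) \<bullet> y = r * (x \<bullet> y)" by transfer simp
  show "0 \<le> x \<bullet> x" by transfer simp
  show "x \<bullet> x = 0 \<longleftrightarrow> x = 0"
  proof transfer
    fix v assume v: "sqint v \<and> sqint v \<and> (AE x in lebesgue. v x = v x)"
    then have "(LINT x|lebesgue. v x \<bullet> v x) = 0 \<longleftrightarrow> (AE x in lebesgue. v x \<bullet> v x = 0)"
      by (intro integral_nonneg_eq_0_iff_AE sqint_inner) auto
    then show "((LINT x|lebesgue. v x \<bullet> v x) = 0) = (sqint v \<and> sqint (\<lambda>x. 0) \<and> (AE x in lebesgue. v x = 0))"
      using v by simp
  qed
qed (simp_all add: norm_l2_def dist_l2_def sgn_l2_def uniformity_l2_def open_l2_def)
end

lemma sqint_rep [simp]: "sqint (rep_l2 y)"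
  using Quotient3_rep_reflp[OF Quotient3_l2, of y] by simp

lemma abs_rep_l2 [simp]: "abs_l2 (rep_l2 y) = y"
  by (rule Quotient3_abs_rep[OF Quotient3_l2])

lemma rep_abs_l2: "sqint v \<Longrightarrow> AE x in lebesgue. rep_l2 (abs_l2 v) x = v x"
  using rep_abs_rsp_left[OF Quotient3_l2, of v v] by auto

lemma abs_l2_eq_iff: "sqint v \<Longrightarrow> sqint w \<Longrightarrow> abs_l2 v = abs_l2 w \<longleftrightarrow> (AE x in lebesgue. v x = w x)"
  using Quotient3_rel[OF Quotient3_l2, of v w] by auto

lemma abs_l2_simps:
  "sqint v \<Longrightarrow> sqint w \<Longrightarrow> abs_l2 v + abs_l2 w = abs_l2 (\<lambda>x. v x + w x)"
  "sqint v \<Longrightarrow> sqint w \<Longrightarrow> abs_l2 v - abs_l2 w = abs_l2 (\<lambda>x. v x - w x)"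
  "sqint v \<Longrightarrow> r *\<^sub>R abs_l2 v = abs_l2 (\<lambda>x. r *\<^sub>R v x)"
  "sqint v \<Longrightarrow> sqint w \<Longrightarrow> abs_l2 v \<bullet> abs_l2 w = (LINT x|lebesgue. v x \<bullet> w x)"
  by (simp_all add: plus_l2.abs_eq minus_l2.abs_eq scaleR_l2.abs_eq inner_l2.abs_eq)

lemma norm_abs_l2: "sqint v \<Longrightarrow> (norm (abs_l2 v))\<^sup>2 = (LINT x|lebesgue. (norm (v x))\<^sup>2)"
  by (simp add: power2_norm_eq_inner abs_l2_simps)

text \<open>The value zero for a multiplier that is not essentially bounded keeps the operation well
  defined on classes, and makes \<open>mulop m\<close> bounded and linear for every
  \<open>m\<close>.\<close>

lift_definition mulop :: "(real^3 \<Rightarrow> complex) \<Rightarrow> l2 \<Rightarrow> l2" is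
  "\<lambda>m v. if essbdd m then (\<lambda>x. m x *s v x) else (\<lambda>x. 0)"
  by (auto intro!: sqint_smult elim: eventually_mono)

lift_definition conj_l2 :: "l2 \<Rightarrow> l2" is "\<lambda>v x. vcnj (v x)"
  by (auto intro!: sqint_vcnj elim: eventually_mono)

lemma mulop_abs: "essbdd m \<Longrightarrow> sqint v \<Longrightarrow> mulop m (abs_l2 v) = abs_l2 (\<lambda>x. m x *s v x)"
  by (simp add: mulop.abs_eq)

lemma conj_abs: "sqint v \<Longrightarrow> conj_l2 (abs_l2 v) = abs_l2 (\<lambda>x. vcnj (v x))"
  by (simp add: conj_l2.abs_eq)

lemma abs_l2_cases: obtains v where "sqint v" "y = abs_l2 v"
  by (metis sqint_rep abs_rep_l2)

lemma essbdd_simps [simp, intro]: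
  "essbdd (\<lambda>_. c)" "essbdd m \<Longrightarrow> essbdd m' \<Longrightarrow> essbdd (\<lambda>x. m x * m' x)" "essbdd m \<Longrightarrow> essbdd (\<lambda>x. cnj (m x))"
proof -
  show "essbdd (\<lambda>_. c)" by (auto simp: essbdd_def)
  show "essbdd (\<lambda>x. m x * m' x)" if m: "essbdd m" "essbdd m'"
  proof -
    obtain B B' where "AE x in lebesgue. cmod (m x) \<le> B" "AE x in lebesgue. cmod (m' x) \<le> B'"
      using m by (auto simp: essbdd_def)
    then have "AE x in lebesgue. cmod (m x * m' x) \<le> B * B'"
    proof eventually_elim
      case (elim x)
      have "0 \<le> B" using elim(1) norm_ge_zero order_trans by blast
      then show ?case using elim by (simp add: norm_mult mult_mono)
    qed
    then show ?thesis using m by (auto simp: essbdd_def)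
  qed
  show "essbdd (\<lambda>x. cnj (m x))" if "essbdd m"
    using that borel_measurable_continuous_on[OF continuous_on_cnj[OF continuous_on_id], of m lebesgue]
    by (auto simp: essbdd_def)
qed

lemma mulop_mulop:
  assumes "essbdd m" "essbdd m'" shows "mulop m (mulop m' y) = mulop (\<lambda>x. m x * m' x) y"
  using assms by (cases y rule: abs_l2_cases) (simp add: mulop_abs sqint_smult vector_smult_assoc)

lemma mulop_adjoint:
  assumes "essbdd m" shows "mulop m y \<bullet> w = y \<bullet> mulop (\<lambda>x. cnj (m x)) w"
  using assms
  by (cases y rule: abs_l2_cases, cases w rule: abs_l2_cases)
     (simp add: mulop_abs sqint_smult abs_l2_simps inner_smult_left)

lemma conj_mulop: assumes "essbdd m" shows "conj_l2 (mulop m y) = mulop (\<lambda>x. cnj (m x)) (conj_l2 y)"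
  using assms by (cases y rule: abs_l2_cases) (simp add: mulop_abs sqint_smult conj_abs sqint_vcnj)

lemma conj_conj [simp]: "conj_l2 (conj_l2 y) = y"
  by (cases y rule: abs_l2_cases) (simp add: conj_abs sqint_vcnj)

lemma conj_inner [simp]: "conj_l2 x \<bullet> conj_l2 y = x \<bullet> y"
  by (cases x rule: abs_l2_cases, cases y rule: abs_l2_cases) (simp add: conj_abs sqint_vcnj abs_l2_simps)

lemma linear_conj: "linear conj_l2"
proof (rule linearI)
  fix x y show "conj_l2 (x + y) = conj_l2 x + conj_l2 y"
    by (cases x rule: abs_l2_cases, cases y rule: abs_l2_cases) (simp add: conj_abs sqint_vcnj abs_l2_simps sqint_add)
next
  fix r x show "conj_l2 (r *\<^sub>R x) = r *\<^sub>R conj_l2 x"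
    by (cases x rule: abs_l2_cases) (simp add: conj_abs sqint_vcnj abs_l2_simps sqint_scaleR)
qed

lemma bounded_linear_conj: "bounded_linear conj_l2"
  by (rule bounded_linear_intro[OF linear_add[OF linear_conj] linear_scale[OF linear_conj], of 1]) (simp add: norm_l2_def)

lemma linear_mulop: "linear (mulop m)"
proof (rule linearI)
  show "mulop m (x + y) = mulop m x + mulop m y" for x y
    by (cases "essbdd m"; transfer) (auto intro!: sqint_smult sqint_add)
  show "mulop m (r *\<^sub>R x) = r *\<^sub>R mulop m x" for r x
    by (cases "essbdd m"; transfer) (auto intro!: sqint_smult sqint_scaleR)
qed

lemma norm_mulop_le:
  assumes m: "essbdd m" and B: "AE x in lebesgue. cmod (m x) \<le> B" "0 \<le> B"
  shows "norm (mulop m y) \<le> B * norm y"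
proof (cases y rule: abs_l2_cases)
  case (1 v)
  have "(norm (mulop m y))\<^sup>2 = (LINT x|lebesgue. (norm (m x *s v x))\<^sup>2)"
    using 1 m by (simp add: mulop_abs sqint_smult norm_abs_l2)
  also have "\<dots> \<le> (LINT x|lebesgue. B\<^sup>2 * (norm (v x))\<^sup>2)"
  proof (rule integral_mono_AE)
    show "integrable lebesgue (\<lambda>x. (norm (m x *s v x))\<^sup>2)" using sqint_smult[OF m 1(1)] by (simp add: sqint_def)
    show "integrable lebesgue (\<lambda>x. B\<^sup>2 * (norm (v x))\<^sup>2)" using 1 by (simp add: sqint_def)
    show "AE x in lebesgue. (norm (m x *s v x))\<^sup>2 \<le> B\<^sup>2 * (norm (v x))\<^sup>2"
      using B(1) by eventually_elim (simp add: norm_smult power_mult_distrib mult_right_mono power_mono)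
  qed
  also have "\<dots> = (B * norm y)\<^sup>2" using 1 by (simp add: power_mult_distrib norm_abs_l2)
  finally show ?thesis by (rule power2_le_imp_le) (simp add: B)
qed

lemma bounded_linear_mulop: "bounded_linear (mulop m)"
proof (cases "essbdd m")
  case True
  then obtain B where "AE x in lebesgue. cmod (m x) \<le> B" by (auto simp: essbdd_def)
  then have "AE x in lebesgue. cmod (m x) \<le> max B 0" by eventually_elim simp
  then have "norm (mulop m y) \<le> norm y * max B 0" for y
    using norm_mulop_le[OF True, of "max B 0" y] by (simp add: mult.commute)
  then show ?thesis
    by (rule bounded_linear_intro[OF linear_add[OF linear_mulop] linear_scale[OF linear_mulop]])
next
  case False
  have "mulop m y = 0" for y
    by (cases y rule: abs_l2_cases) (simp add: mulop.abs_eq False zero_l2.abs_eq)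
  then have "mulop m = (\<lambda>y. 0)" by (rule ext)
  then show ?thesis by (metis bounded_linear_zero)
qed

lemma nn_integral_norm_rep_diff:
  "(\<integral>\<^sup>+x. ennreal ((norm (rep_l2 y x - rep_l2 z x))\<^sup>2) \<partial>lebesgue) = ennreal ((norm (y - z))\<^sup>2)"
proof -
  have sq: "sqint (\<lambda>x. rep_l2 y x - rep_l2 z x)" by (intro sqint_diff sqint_rep)
  have "y - z = abs_l2 (\<lambda>x. rep_l2 y x - rep_l2 z x)"
    using abs_l2_simps(2)[of "rep_l2 y" "rep_l2 z"] by simp
  then have "(norm (y - z))\<^sup>2 = (LINT x|lebesgue. (norm (rep_l2 y x - rep_l2 z x))\<^sup>2)"
    using norm_abs_l2[OF sq] by simp
  then show ?thesis using sq by (subst nn_integral_eq_integral) (auto simp: sqint_def)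
qed

text \<open>Riesz--Fischer. A subsequence with increments below \<open>2\<^sup>-\<^sup>n\<close> converges almost everywhere,
  since the increments weighted by \<open>2\<^sup>n\<close> are square summable almost everywhere.\<close>

instance l2 :: complete_space
proof
  fix X :: "nat \<Rightarrow> l2" assume X: "Cauchy X"
  have "\<exists>N. \<forall>m\<ge>N. \<forall>n\<ge>N. norm (X m - X n) < (1/2)^k" for k using CauchyD[OF X, of "(1/2)^k"] by simp
  then obtain N where N: "\<And>k m n. N k \<le> m \<Longrightarrow> N k \<le> n \<Longrightarrow> norm (X m - X n) < (1/2)^k" by metis
  \<comment> \<open>The summand \<open>n\<close> makes \<open>r\<close> strictly increasing, and the
    sum dominates each \<open>N k\<close> with \<open>k \<le> n\<close>.\<close>
  define r where "r n = n + (\<Sum>k\<le>n. N k)" for n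
  have r: "strict_mono r" by (auto simp: strict_mono_Suc_iff r_def)
  have Nr: "N n \<le> r m" if "n \<le> m" for n m
    using member_le_sum[of n "{..m}" N] that by (simp add: r_def)
  define w where "w n = rep_l2 (X (r n))" for n
  have [measurable]: "w n \<in> borel_measurable lebesgue" for n
    unfolding w_def by (rule sqint_measurable[OF sqint_rep])
  have "(\<integral>\<^sup>+x. (\<Sum>n. ennreal (2^n * (norm (w (Suc n) x - w n x))\<^sup>2)) \<partial>lebesgue)
      = (\<Sum>n. \<integral>\<^sup>+x. ennreal (2^n * (norm (w (Suc n) x - w n x))\<^sup>2) \<partial>lebesgue)"
    by (rule nn_integral_suminf) measurable
  also have "\<dots> \<le> (\<Sum>n. ennreal ((1/2)^n))"
  proof (rule suminf_le)
    fix n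
    have "(\<integral>\<^sup>+x. ennreal (2^n * (norm (w (Suc n) x - w n x))\<^sup>2) \<partial>lebesgue)
       = ennreal (2^n) * (\<integral>\<^sup>+x. ennreal ((norm (w (Suc n) x - w n x))\<^sup>2) \<partial>lebesgue)"
      by (simp add: ennreal_mult' nn_integral_cmult)
    also have "\<dots> = ennreal (2^n * (norm (X (r (Suc n)) - X (r n)))\<^sup>2)"
      unfolding w_def nn_integral_norm_rep_diff by (simp add: ennreal_mult')
    also have "\<dots> \<le> ennreal (2^n * ((1/2)^n)\<^sup>2)"
    proof (intro ennreal_leI mult_left_mono power_mono)
      show "norm (X (r (Suc n)) - X (r n)) \<le> (1/2)^n" using N[OF Nr Nr, of n "Suc n" n] by simp
    qed auto
    also have "2^n * ((1/2)^n)\<^sup>2 = (1/2 :: real)^n"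
      by (simp add: power2_eq_square power_mult_distrib[symmetric])
    finally show "(\<integral>\<^sup>+x. ennreal (2^n * (norm (w (Suc n) x - w n x))\<^sup>2) \<partial>lebesgue) \<le> ennreal ((1/2)^n)" .
  qed auto
  also have "\<dots> < \<infinity>" by (subst suminf_ennreal2) (auto simp: summable_geometric)
  finally have "AE x in lebesgue. (\<Sum>n. ennreal (2^n * (norm (w (Suc n) x - w n x))\<^sup>2)) \<noteq> \<infinity>"
    by (intro nn_integral_PInf_AE) auto
  then have conv: "AE x in lebesgue. (\<lambda>n. w n x) \<longlonglongrightarrow> lim (\<lambda>n. w n x)"
  proof eventually_elim
    case (elim x)
    define B where "B = enn2real (\<Sum>n. ennreal (2^n * (norm (w (Suc n) x - w n x))\<^sup>2))"
    have B0: "0 \<le> B" by (simp add: B_def)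
    have B: "2^n * (norm (w (Suc n) x - w n x))\<^sup>2 \<le> B" for n
    proof -
      have "ennreal (2^n * (norm (w (Suc n) x - w n x))\<^sup>2) \<le> (\<Sum>n. ennreal (2^n * (norm (w (Suc n) x - w n x))\<^sup>2))"
        (is "?a n \<le> _")
      proof -
        have "sum ?a {n} \<le> suminf ?a" by (rule sum_le_suminf) auto
        then show ?thesis by (simp only: sum.insert_remove sum.empty finite.emptyI Diff_empty Diff_insert0 empty_iff not_False_eq_True add_0_right)
      qed
      also have "\<dots> = ennreal B" using elim by (simp only: B_def ennreal_enn2real_if infinity_ennreal_def if_False)
      finally show ?thesis by (simp add: B0)
    qed
    \<comment> \<open>The squared increments are at most \<open>B * (1/2)^n\<close>, so the
      increments themselves are bounded by a geometric sequence whose ratio is the square root of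
      one half.\<close>
    obtain q :: real where q: "0 \<le> q" "q < 1" "q\<^sup>2 = 1/2"
      using that[of "sqrt (1/2)"] by (simp only: real_sqrt_ge_0_iff real_sqrt_lt_1_iff real_sqrt_pow2_iff)
    have "summable (\<lambda>n. w (Suc n) x - w n x)"
    proof (rule summable_comparison_test')
      show "summable (\<lambda>n. sqrt B * q^n)"
        by (intro summable_mult summable_geometric) (simp add: q)
      fix n :: nat assume "0 \<le> n"
      show "norm (w (Suc n) x - w n x) \<le> sqrt B * q^n"
      proof (rule power2_le_imp_le)
        have "(norm (w (Suc n) x - w n x))\<^sup>2 \<le> B * (1/2)^n" using B[of n] by (simp add: field_simps)
        also have "\<dots> = (sqrt B * q^n)\<^sup>2"
        proof -
          have "(q^n)\<^sup>2 = (1/2)^n" using q(3) by (metis power_mult mult.commute)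
          then show ?thesis using B0 by (simp add: power_mult_distrib)
        qed
        finally show "(norm (w (Suc n) x - w n x))\<^sup>2 \<le> (sqrt B * q^n)\<^sup>2" .
      qed (simp add: B0 q)
    qed
    then have "convergent (\<lambda>n. \<Sum>k<n. w (Suc k) x - w k x)" by (simp add: summable_iff_convergent)
    then have "convergent (\<lambda>n. w n x - w 0 x)" by (simp add: sum_lessThan_telescope[of "\<lambda>n. w n x"])
    then have "convergent (\<lambda>n. w n x)" using convergent_add[OF _ convergent_const[of "w 0 x"], of "\<lambda>n. w n x - w 0 x"] by simp
    then show ?case by (simp add: convergent_LIMSEQ_iff)
  qed
  define L where "L x = lim (\<lambda>n. w n x)" for x
  have [measurable]: "L \<in> borel_measurable lebesgue" unfolding L_def[abs_def] by measurable
  \<comment> \<open>Fatou's lemma passes the Cauchy estimate to the pointwise limit. The case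
    \<open>k = 0\<close> yields square integrability, the case \<open>k = n\<close> the convergence
    of the subsequence in norm.\<close>
  have Fatou: "(\<integral>\<^sup>+x. ennreal ((norm (L x - w n x))\<^sup>2) \<partial>lebesgue) \<le> ennreal (((1/2)^k)\<^sup>2)" if n: "k \<le> n" for k n
  proof -
    have "AE x in lebesgue. ennreal ((norm (L x - w n x))\<^sup>2) = liminf (\<lambda>m. ennreal ((norm (w m x - w n x))\<^sup>2))"
      using conv
    proof eventually_elim
      case (elim x)
      have "(\<lambda>m. ennreal ((norm (w m x - w n x))\<^sup>2)) \<longlonglongrightarrow> ennreal ((norm (L x - w n x))\<^sup>2)"
        unfolding L_def by (intro tendsto_intros elim tendsto_ennrealI)
      then show ?case by (rule lim_imp_Liminf[OF sequentially_bot, symmetric])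
    qed
    then have "(\<integral>\<^sup>+x. ennreal ((norm (L x - w n x))\<^sup>2) \<partial>lebesgue)
        = (\<integral>\<^sup>+x. liminf (\<lambda>m. ennreal ((norm (w m x - w n x))\<^sup>2)) \<partial>lebesgue)" by (rule nn_integral_cong_AE)
    also have "\<dots> \<le> liminf (\<lambda>m. \<integral>\<^sup>+x. ennreal ((norm (w m x - w n x))\<^sup>2) \<partial>lebesgue)"
      by (rule nn_integral_liminf) measurable
    also have "\<dots> = liminf (\<lambda>m. ennreal ((norm (X (r m) - X (r n)))\<^sup>2))"
      unfolding w_def nn_integral_norm_rep_diff ..
    also have "\<dots> \<le> limsup (\<lambda>m. ennreal ((norm (X (r m) - X (r n)))\<^sup>2))" by (rule Liminf_le_Limsup) simp
    also have "\<dots> \<le> ennreal (((1/2)^k)\<^sup>2)"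
    proof (rule Limsup_bounded)
      show "\<forall>\<^sub>F m in sequentially. ennreal ((norm (X (r m) - X (r n)))\<^sup>2) \<le> ennreal (((1/2)^k)\<^sup>2)"
        using eventually_ge_at_top[of k]
      proof eventually_elim
        case (elim m)
        have "norm (X (r m) - X (r n)) \<le> (1/2)^k" using N[OF Nr[OF elim] Nr[OF n]] by simp
        then show ?case by (intro ennreal_leI power_mono) auto
      qed
    qed
    finally show ?thesis .
  qed
  have sqd: "sqint (\<lambda>x. L x - w n x)" for n
  proof -
    have "integrable lebesgue (\<lambda>x. (norm (L x - w n x))\<^sup>2)"
    proof (rule integrableI_bounded)
      show "(\<integral>\<^sup>+x. ennreal (norm ((norm (L x - w n x))\<^sup>2)) \<partial>lebesgue) < \<infinity>"
        using le_less_trans[OF Fatou[of 0 n]] by simp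
    qed measurable
    then show ?thesis by (simp add: sqint_def)
  qed
  have sqw: "sqint (w n)" for n by (simp add: w_def)
  have sqL: "sqint L" using sqint_add[OF sqd[of 0] sqw[of 0]] by simp
  have nd: "norm (abs_l2 L - X (r n)) \<le> (1/2)^n" for n
  proof -
    have "abs_l2 L - X (r n) = abs_l2 (\<lambda>x. L x - w n x)"
      using abs_l2_simps(2)[OF sqL sqw[of n]] by (simp add: w_def)
    then have "ennreal ((norm (abs_l2 L - X (r n)))\<^sup>2) = (\<integral>\<^sup>+x. ennreal ((norm (L x - w n x))\<^sup>2) \<partial>lebesgue)"
      using norm_abs_l2[OF sqd[of n]] sqd[of n] by (subst nn_integral_eq_integral) (auto simp: sqint_def)
    also have "\<dots> \<le> ennreal (((1/2)^n)\<^sup>2)" by (rule Fatou) simp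
    finally have "(norm (abs_l2 L - X (r n)))\<^sup>2 \<le> ((1/2)^n)\<^sup>2" by simp
    then show ?thesis by (rule power2_le_imp_le) simp
  qed
  have "(X \<circ> r) \<longlonglongrightarrow> abs_l2 L"
  proof (rule LIM_zero_cancel, rule tendsto_norm_zero_cancel, rule tendsto_sandwich[OF _ _ tendsto_const])
    show "\<forall>\<^sub>F n in sequentially. norm ((X \<circ> r) n - abs_l2 L) \<le> (1/2)^n"
      using nd by (auto simp: norm_minus_commute)
    show "(\<lambda>n. (1/2 :: real)^n) \<longlonglongrightarrow> 0" by (rule LIMSEQ_realpow_zero) auto
  qed auto
  then show "convergent X" using Cauchy_converges_subseq[OF X r] by (auto simp: convergent_def)
qed


section \<open>Bump functions\<close>

lemma pderiv_at_eq: "(\<phi> has_derivative D) (at x) \<Longrightarrow> pderiv_at i \<phi> x = D (axis i 1)"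
  unfolding pderiv_at_def by (simp add: frechet_derivative_at[symmetric])

lemma Ck_Suc_imp_Ck: "Ck (Suc k) \<phi> \<Longrightarrow> Ck k \<phi>"
proof (induction k arbitrary: \<phi>)
  case 0 then show ?case
    by (auto intro!: continuous_at_imp_continuous_on differentiable_imp_continuous_within)
next
  case (Suc k)
  then have "Ck k (pderiv_at i \<phi>)" for i using Suc.IH[of "pderiv_at i \<phi>"] by simp
  with Suc.prems show ?case by simp
qed

lemma Ck_const: "Ck k (\<lambda>x. c)"
proof (induction k arbitrary: c)
  case (Suc k)
  have "pderiv_at i (\<lambda>x. c) = (\<lambda>x. 0)" for i by (rule ext) (simp add: pderiv_at_eq[OF has_derivative_const])
  then show ?case using Suc by simp
qed simp

lemma Ck_bounded_linear:
  assumes L: "bounded_linear L" shows "Ck k \<phi> \<Longrightarrow> Ck k (\<lambda>x. L (\<phi> x))"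
proof (induction k arbitrary: \<phi>)
  case 0 then show ?case by (simp add: bounded_linear.continuous_on[OF L])
next
  case (Suc k)
  have d: "(\<phi> has_derivative frechet_derivative \<phi> (at x)) (at x)" for x
    using Suc.prems by (simp add: frechet_derivative_works)
  have "pderiv_at i (\<lambda>x. L (\<phi> x)) = (\<lambda>x. L (pderiv_at i \<phi> x))" for i
    by (rule ext) (simp add: pderiv_at_eq[OF bounded_linear.has_derivative[OF L d]] pderiv_at_def)
  moreover have "(\<lambda>x. L (\<phi> x)) differentiable at x" for x
    using bounded_linear.has_derivative[OF L d] by (rule differentiableI)
  ultimately show ?case using Suc by simp
qed

lemma Ck_add: "Ck k \<phi> \<Longrightarrow> Ck k \<psi> \<Longrightarrow> Ck k (\<lambda>x. \<phi> x + \<psi> x)"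
proof (induction k arbitrary: \<phi> \<psi>)
  case 0 then show ?case by (simp add: continuous_on_add)
next
  case (Suc k)
  have d: "(\<phi> has_derivative frechet_derivative \<phi> (at x)) (at x)" "(\<psi> has_derivative frechet_derivative \<psi> (at x)) (at x)" for x
    using Suc.prems by (simp_all add: frechet_derivative_works)
  have "pderiv_at i (\<lambda>x. \<phi> x + \<psi> x) = (\<lambda>x. pderiv_at i \<phi> x + pderiv_at i \<psi> x)" for i
    by (rule ext) (simp add: pderiv_at_eq[OF has_derivative_add[OF d]] pderiv_at_def)
  then show ?case using Suc by simp
qed

text \<open>The product rule leaves undifferentiated factors, whose regularity of order
  \<open>k\<close> comes from \<open>Ck_Suc_imp_Ck\<close>.\<close>

lemma Ck_mult:
  fixes \<phi> \<psi> :: "real^3 \<Rightarrow> real" shows "Ck k \<phi> \<Longrightarrow> Ck k \<psi> \<Longrightarrow> Ck k (\<lambda>x. \<phi> x * \<psi> x)"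
proof (induction k arbitrary: \<phi> \<psi>)
  case 0 then show ?case by (simp add: continuous_on_mult)
next
  case (Suc k)
  have d: "(\<phi> has_derivative frechet_derivative \<phi> (at x)) (at x)" "(\<psi> has_derivative frechet_derivative \<psi> (at x)) (at x)" for x
    using Suc.prems by (simp_all add: frechet_derivative_works)
  have "pderiv_at i (\<lambda>x. \<phi> x * \<psi> x) = (\<lambda>x. \<phi> x * pderiv_at i \<psi> x + pderiv_at i \<phi> x * \<psi> x)" for i
    by (rule ext) (simp add: pderiv_at_eq[OF has_derivative_mult[OF d]] pderiv_at_def)
  moreover have "Ck k (\<lambda>x. \<phi> x * pderiv_at i \<psi> x + pderiv_at i \<phi> x * \<psi> x)" for i
    using Suc.prems Ck_Suc_imp_Ck[OF Suc.prems(1)] Ck_Suc_imp_Ck[OF Suc.prems(2)] by (intro Ck_add Suc.IH) auto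
  ultimately show ?case using Suc.prems by simp
qed

lemma Ck_prod:
  fixes \<phi> :: "'i \<Rightarrow> real^3 \<Rightarrow> real"
  assumes "finite I" "\<And>i. i \<in> I \<Longrightarrow> Ck k (\<phi> i)" shows "Ck k (\<lambda>x. \<Prod>i\<in>I. \<phi> i x)"
  using assms by (induction I rule: finite_induct) (auto intro: Ck_const Ck_mult)

text \<open>A sequence in which each function is the derivative of its predecessor encodes
  smoothness. The induction runs over all indices \<open>n\<close> and all factors \<open>c\<close>,
  since a partial derivative raises the index and multiplies the factor by a constant.\<close>

lemma Ck_coordinate:
  assumes g: "\<And>n t. (g n has_real_derivative g (Suc n) t) (at t)"
  shows "Ck k (\<lambda>x. c * g n (a * (x $ j) + b))"
proof (induction k arbitrary: c n)
  case 0
  have "continuous_on UNIV (g n)" using g DERIV_continuous_on[of UNIV "g n" "g (Suc n)"] by auto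
  then show ?case by (auto intro!: continuous_intros continuous_on_compose2[of UNIV "g n"])
next
  case (Suc k)
  have d: "((\<lambda>x. c * g n (a * (x $ j) + b)) has_derivative (\<lambda>v. c * (a * (v $ j) * g (Suc n) (a * (x $ j) + b)))) (at x)" for x
  proof -
    have "((\<lambda>x. a * (x $ j) + b) has_derivative (\<lambda>v. a * (v $ j))) (at x)"
      by (auto intro!: derivative_eq_intros bounded_linear.has_derivative[OF bounded_linear_vec_nth])
    from has_derivative_compose[OF this, of "g n" "(*) (g (Suc n) (a * (x $ j) + b))"] g
    have "((\<lambda>x. g n (a * (x $ j) + b)) has_derivative (\<lambda>v. g (Suc n) (a * (x $ j) + b) * (a * (v $ j)))) (at x)"
      by (simp add: has_field_derivative_def)
    from has_derivative_mult_right[OF this, of c] show ?thesis by (simp add: mult.commute mult.left_commute)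
  qed
  have "pderiv_at i (\<lambda>x. c * g n (a * (x $ j) + b)) = (\<lambda>x. (c * a * (axis i 1 $ j)) * g (Suc n) (a * (x $ j) + b))" for i
    by (rule ext) (simp add: pderiv_at_eq[OF d])
  then show ?case using Suc differentiableI[OF d] by simp
qed

text \<open>The classical flat function \<open>exp (- 1 / t)\<close> extended by zero, with a
  polynomial in \<open>1 / t\<close> as a factor: this family is closed under
  differentiation.\<close>

definition exp_neg_inv :: "real poly \<Rightarrow> real \<Rightarrow> real" where
  "exp_neg_inv p t = (if 0 < t then poly p (1 / t) * exp (- 1 / t) else 0)"

lemma poly_div_exp_tendsto_0: "((\<lambda>x. poly p x / exp x) \<longlongrightarrow> (0::real)) at_top"
proof -
  have "((\<lambda>x. \<Sum>i\<le>degree p. coeff p i * (x ^ i / exp x)) \<longlongrightarrow> (\<Sum>i\<le>degree p. coeff p i * 0)) at_top"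
    by (intro tendsto_intros tendsto_power_div_exp_0)
  then show ?thesis by (simp add: poly_altdef sum_divide_distrib)
qed

lemma exp_neg_inv_tendsto_0: "((\<lambda>t. poly p (1 / t) * exp (- 1 / t)) \<longlongrightarrow> (0::real)) (at_right 0)"
proof -
  have "((\<lambda>t. poly p (inverse t) / exp (inverse t)) \<longlongrightarrow> (0::real)) (at_right 0)"
    by (rule filterlim_compose[OF poly_div_exp_tendsto_0 filterlim_inverse_at_top_right])
  then show ?thesis by (simp add: inverse_eq_divide exp_minus field_simps)
qed

text \<open>With \<open>s = 1 / t\<close> the derivative in \<open>t\<close> is
  \<open>- s\<^sup>2\<close> times the derivative in \<open>s\<close>; applied to
  \<open>poly p s * exp (- s)\<close> it produces the polynomial
  \<open>[:0, 0, 1:] * (p - pderiv p)\<close>.\<close>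

lemma exp_neg_inv_has_derivative:
  "(exp_neg_inv p has_real_derivative exp_neg_inv ([:0, 0, 1:] * (p - pderiv p)) t) (at t)"
proof -
  consider "t < 0" | "0 < t" | "t = 0" by linarith
  then show ?thesis
  proof cases
    case 1
    have "((\<lambda>x. 0) has_real_derivative 0) (at t)" by simp
    then have "(exp_neg_inv p has_real_derivative 0) (at t)"
      by (rule has_field_derivative_transform_within_open[of _ _ _ "{..<0}"]) (use 1 in \<open>auto simp: exp_neg_inv_def\<close>)
    then show ?thesis using 1 by (simp add: exp_neg_inv_def)
  next
    case 2
    have "((\<lambda>x. poly p (1 / x) * exp (- 1 / x)) has_real_derivative
        poly (pderiv p) (1 / t) * (- 1 / t\<^sup>2) * exp (- 1 / t) + poly p (1 / t) * (exp (- 1 / t) * (1 / t\<^sup>2))) (at t)"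
      using 2 by (auto intro!: derivative_eq_intros DERIV_chain2[OF poly_DERIV] simp: power2_eq_square field_simps)
    then have "(exp_neg_inv p has_real_derivative
        poly (pderiv p) (1 / t) * (- 1 / t\<^sup>2) * exp (- 1 / t) + poly p (1 / t) * (exp (- 1 / t) * (1 / t\<^sup>2))) (at t)"
      by (rule has_field_derivative_transform_within_open[of _ _ _ "{0<..}"]) (use 2 in \<open>auto simp: exp_neg_inv_def\<close>)
    then show ?thesis using 2 by (simp add: exp_neg_inv_def power2_eq_square field_simps)
  next
    \<comment> \<open>At the origin the difference quotient from the right is again of the form
      \<open>poly (pCons 0 p) (1 / h) * exp (- 1 / h)\<close>, because dividing by \<open>h\<close>
      multiplies the polynomial by its variable.\<close>
    case 3
    have "((\<lambda>h. (exp_neg_inv p (0 + h) - exp_neg_inv p 0) / h) \<longlongrightarrow> 0) (at 0)"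
      unfolding filterlim_at_split
    proof
      have "\<forall>\<^sub>F h in at_left 0. (exp_neg_inv p (0 + h) - exp_neg_inv p 0) / h = (0::real)"
        using eventually_at_left[of "-1" "0::real"] by (auto intro!: exI[of _ "-1"] simp: exp_neg_inv_def)
      then show "((\<lambda>h. (exp_neg_inv p (0 + h) - exp_neg_inv p 0) / h) \<longlongrightarrow> 0) (at_left 0)"
        by (rule tendsto_eventually)
      have "\<forall>\<^sub>F h in at_right 0. poly (pCons 0 p) (1 / h) * exp (- 1 / h) = (exp_neg_inv p (0 + h) - exp_neg_inv p 0) / (h::real)"
        using eventually_at_right_less[of "0::real"] by eventually_elim (simp add: exp_neg_inv_def)
      then show "((\<lambda>h. (exp_neg_inv p (0 + h) - exp_neg_inv p 0) / h) \<longlongrightarrow> 0) (at_right 0)"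
        by (rule Lim_transform_eventually[OF exp_neg_inv_tendsto_0])
    qed
    then show ?thesis using 3 by (simp add: DERIV_def exp_neg_inv_def)
  qed
qed

text \<open>The arguments are \<open>n\<close> times the signed distances of \<open>x\<close> to the
  faces of the box. For every \<open>n > 0\<close> the function is therefore nonzero exactly on the
  open box, and it tends to \<open>1\<close> there as \<open>n\<close> grows. The affine form of the
  arguments matches \<open>Ck_coordinate\<close>.\<close>

definition bump :: "real^3 \<Rightarrow> real^3 \<Rightarrow> real \<Rightarrow> real^3 \<Rightarrow> real" where
  "bump a b n x = (\<Prod>i\<in>UNIV. exp_neg_inv 1 (n * (x $ i) + - n * a $ i) * exp_neg_inv 1 (- n * (x $ i) + n * b $ i))"

lemma Ck_bump: "Ck k (bump a b n)"
proof -
  define g where "g m = exp_neg_inv (((\<lambda>p. [:0, 0, 1:] * (p - pderiv p)) ^^ m) 1)" for m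
  have "(g m has_real_derivative g (Suc m) t) (at t)" for m t
    by (simp add: g_def exp_neg_inv_has_derivative del: mult_pCons_left)
  from Ck_coordinate[of g, OF this, of k 1 0]
  have "Ck k (\<lambda>x. exp_neg_inv 1 (p * (x $ i) + q))" for p q i by (simp add: g_def)
  then show ?thesis unfolding bump_def[abs_def] by (intro Ck_prod Ck_mult) (rule finite | assumption)+
qed

lemma exp_neg_inv_1_bounds: "0 \<le> exp_neg_inv 1 t" "exp_neg_inv 1 t \<le> 1" "exp_neg_inv 1 t \<noteq> 0 \<longleftrightarrow> 0 < t"
  by (auto simp: exp_neg_inv_def)

lemma bump_bounds: "0 \<le> bump a b n x" "bump a b n x \<le> 1"
  unfolding bump_def by (auto intro!: prod_nonneg prod_le_1 mult_nonneg_nonneg mult_le_one simp: exp_neg_inv_1_bounds)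

lemma bump_nonzero_iff: "0 < n \<Longrightarrow> bump a b n x \<noteq> 0 \<longleftrightarrow> x \<in> box a b"
proof -
  assume n: "0 < n"
  have "0 < n * s + - n * t \<longleftrightarrow> t < s" "0 < - n * s + n * t \<longleftrightarrow> s < t" for s t
    using n mult_less_cancel_left_pos[of n t s] mult_less_cancel_left_pos[of n s t] by linarith+
  then show ?thesis by (auto simp: bump_def mem_box_cart exp_neg_inv_1_bounds)
qed

lemma bump_tendsto: "(\<lambda>n. bump a b (real n) x) \<longlonglongrightarrow> indicator (box a b) x"
proof (cases "x \<in> box a b")
  case True
  have 1: "(\<lambda>n. exp_neg_inv 1 (real n * s)) \<longlonglongrightarrow> 1" if "0 < s" for s
  proof (rule Lim_transform_eventually)
    have "(\<lambda>n. exp (- (1 / s) * (1 / real n))) \<longlonglongrightarrow> exp (- (1 / s) * 0)" by (intro tendsto_intros lim_1_over_n)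
    then show "(\<lambda>n. exp (- (1 / s) * (1 / real n))) \<longlonglongrightarrow> 1" by simp
    show "\<forall>\<^sub>F n in sequentially. exp (- (1 / s) * (1 / real n)) = exp_neg_inv 1 (real n * s)"
      using eventually_gt_at_top[of "0::nat"] by eventually_elim (use that in \<open>simp add: exp_neg_inv_def mult.commute\<close>)
  qed
  have "(\<lambda>n. bump a b (real n) x) \<longlonglongrightarrow> (\<Prod>i\<in>(UNIV::3 set). 1 * 1)"
    unfolding bump_def
  proof (intro tendsto_prod tendsto_mult)
    fix i
    show "(\<lambda>n. exp_neg_inv 1 (real n * (x $ i) + - real n * a $ i)) \<longlonglongrightarrow> 1"
      "(\<lambda>n. exp_neg_inv 1 (- real n * (x $ i) + real n * b $ i)) \<longlonglongrightarrow> 1"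
      using 1[of "x $ i - a $ i"] 1[of "b $ i - x $ i"] True by (simp_all add: mem_box_cart algebra_simps)
  qed
  then show ?thesis using True by simp
next
  case False
  have "\<forall>\<^sub>F n in sequentially. bump a b (real n) x = 0"
    using eventually_gt_at_top[of "0::nat"] by eventually_elim (use False bump_nonzero_iff[of "real _" a b x] in fastforce)
  then show ?thesis using False by (simp add: tendsto_eventually)
qed

text \<open>\<open>L\<close> turns the scalar bump into a field with the fixed direction
  \<open>L 1\<close>, so that vector valued test functions are covered as well.\<close>

lemma test_function_bump:
  assumes G: "cbox a b \<subseteq> G" and n: "0 < n" and L: "bounded_linear L"
  shows "test_function G (\<lambda>x. L (bump a b n x))"
proof -
  have sub: "closure {x. L (bump a b n x) \<noteq> 0} \<subseteq> cbox a b"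
  proof (rule closure_minimal)
    show "{x. L (bump a b n x) \<noteq> 0} \<subseteq> cbox a b"
      using bump_nonzero_iff[OF n] box_subset_cbox[of a b] linear_0[OF bounded_linear.linear[OF L]] by fastforce
  qed (rule closed_cbox)
  moreover have "compact (closure {x. L (bump a b n x) \<noteq> 0})"
    using sub compact_cbox by (metis closed_closure compact_Int_closed inf.absorb_iff2)
  ultimately show ?thesis using G Ck_bounded_linear[OF L Ck_bump] by (auto simp: test_function_def smooth_def)
qed

lemma borel_measurable_bump [measurable]: "bump a b n \<in> borel_measurable borel"
  using Ck_bump[of 0] by (auto intro: borel_measurable_continuous_onI)

text \<open>The integrals over all boxes vanish, as limits of integrals against bump functions; hence so do
  the integrals over all Borel sets.\<close>

lemma sigma_finite_lebesgue: "sigma_finite_measure (lebesgue :: 'a::euclidean_space measure)"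
proof
  obtain A :: "'a set set" where A: "countable A" "A \<subseteq> sets lborel" "\<Union>A = space lborel" "\<And>a. a \<in> A \<Longrightarrow> emeasure lborel a \<noteq> \<infinity>"
    using sigma_finite_measure.sigma_finite_countable[OF sigma_finite_lborel] by metis
  show "\<exists>A :: 'a set set. countable A \<and> A \<subseteq> sets lebesgue \<and> \<Union>A = space lebesgue \<and> (\<forall>a\<in>A. emeasure lebesgue a \<noteq> \<infinity>)"
  proof (intro exI conjI ballI)
    show "A \<subseteq> sets lebesgue" using A(2) sets_completionI_sets by blast
    show "\<Union>A = space lebesgue" using A(3) by simp
    fix a assume a: "a \<in> A"
    then have aS: "a \<in> sets lborel" using A(2) by blast
    have "emeasure lebesgue a = emeasure lborel a"
      using emeasure_completion[OF sets_completionI_sets[OF aS]] main_part[OF aS] by simp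
    then show "emeasure lebesgue a \<noteq> \<infinity>" using A(4)[OF a] by simp
  qed (rule A(1))
qed

text \<open>The fundamental lemma of the calculus of variations, localized to closed boxes;
  countably many of them cover the open set \<open>G\<close>.\<close>

lemma zero_of_bump_integrals:
  fixes g :: "real^3 \<Rightarrow> complex"
  assumes G: "open G" and g: "\<And>a b. cbox a b \<subseteq> G \<Longrightarrow> set_integrable lebesgue (cbox a b) g"
    and zero: "\<And>a b n. cbox a b \<subseteq> G \<Longrightarrow> 0 < n \<Longrightarrow> (LINT x|lebesgue. bump a b n x *\<^sub>R g x) = 0"
  shows "AE x in lebesgue. x \<in> G \<longrightarrow> g x = 0"
proof -
  have box0: "(LINT x:box a b|lebesgue. g x) = 0" if ab: "cbox a b \<subseteq> G" for a b
  proof -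
    \<comment> \<open>Cutting off to the closed box leaves the integrands unchanged, since each bump
      vanishes outside, and supplies an integrable majorant.\<close>
    define h where "h x = indicator (cbox a b) x *\<^sub>R g x" for x
    have int: "integrable lebesgue h" using g[OF ab] by (simp add: set_integrable_def h_def[abs_def])
    have eq: "bump a b n x *\<^sub>R (h x) = bump a b n x *\<^sub>R g x" if "0 < n" for n x
      using bump_nonzero_iff[OF that, of a b x] box_subset_cbox[of a b] by (auto simp: indicator_def h_def)
    have hm: "h \<in> borel_measurable lebesgue" using int by auto
    have m: "bump a b n \<in> borel_measurable lebesgue" for n by (simp add: borel_measurable_bump measurable_completion)
    have "(\<lambda>n. LINT x|lebesgue. bump a b (real (Suc n)) x *\<^sub>R (h x))
        \<longlonglongrightarrow> (LINT x|lebesgue. indicator (box a b) x *\<^sub>R (h x))"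
    proof (rule integral_dominated_convergence[where w = "\<lambda>x. norm (h x)"])
      show "integrable lebesgue (\<lambda>x. norm (h x))" using int by (rule integrable_norm)
      show "AE x in lebesgue. (\<lambda>n. bump a b (real (Suc n)) x *\<^sub>R (h x))
          \<longlonglongrightarrow> indicator (box a b) x *\<^sub>R (h x)"
        by (intro AE_I2 tendsto_intros LIMSEQ_Suc[OF bump_tendsto])
      show "AE x in lebesgue. norm (bump a b (real (Suc n)) x *\<^sub>R (h x))
          \<le> norm (h x)" for n
        using bump_bounds[of a b] by (auto simp: mult_left_le_one_le)
    qed (auto intro!: borel_measurable_scaleR borel_measurable_indicator hm m simp del: of_nat_Suc)
    moreover have "(LINT x|lebesgue. bump a b (real (Suc n)) x *\<^sub>R (h x)) = 0" for n
      using zero[OF ab, of "real (Suc n)"] by (subst Bochner_Integration.integral_cong[OF refl eq]) auto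
    ultimately have "(LINT x|lebesgue. indicator (box a b) x *\<^sub>R (h x)) = 0"
      by (simp add: LIMSEQ_const_iff)
    moreover have "(\<lambda>x. indicator (box a b) x *\<^sub>R (indicator (cbox a b) x *\<^sub>R g x)) = (\<lambda>x. indicator (box a b) x *\<^sub>R g x)"
      by (rule ext) (auto simp: indicator_def dest: set_mp[OF box_subset_cbox])
    ultimately show ?thesis by (simp only: set_lebesgue_integral_def h_def)
  qed
  have ae: "AE x in lebesgue. x \<in> cbox a b \<longrightarrow> g x = 0" if ab: "cbox a b \<subseteq> G" for a b
  proof -
    define F where "F x = indicator (box a b) x *\<^sub>R g x" for x
    have F: "integrable lebesgue F"
      using set_integrable_subset[OF g[OF ab], of "box a b"] box_subset_cbox[of a b] by (simp add: F_def[abs_def] set_integrable_def)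
    have Fs: "set_integrable lebesgue A F" if "A \<in> sets lebesgue" for A
      using integrable_mult_indicator[OF that F] by (simp add: set_integrable_def)
    have Fbox: "(LINT x|lebesgue. F x) = 0" using box0[OF ab] by (simp add: F_def set_lebesgue_integral_def)
    have borel: "(LINT x:A|lebesgue. F x) = 0" if "A \<in> sets borel" for A
    proof -
      \<comment> \<open>Dynkin's argument with open boxes as a generator stable under intersection.
        As \<open>F\<close> lives on \<open>box a b\<close>, integrating it over a generating box
        means integrating \<open>g\<close> over a smaller box inside \<open>G\<close>.\<close>
      have "Int_stable (range (\<lambda>(a, b :: real^3). box a b))" by (auto simp: Int_stable_def box_Int_box)
      moreover have "range (\<lambda>(a, b :: real^3). box a b) \<subseteq> Pow UNIV" by auto
      moreover have "A \<in> sigma_sets UNIV (range (\<lambda>(a, b). box a b))" using that unfolding borel_eq_box by simp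
      ultimately show ?thesis
      proof (induction rule: sigma_sets_induct_disjoint)
        case (basic A)
        then obtain c d where A: "A = box c d" by auto
        define c' where "c' = (\<Sum>i\<in>Basis. max (a \<bullet> i) (c \<bullet> i) *\<^sub>R i)"
        define d' where "d' = (\<Sum>i\<in>Basis. min (b \<bullet> i) (d \<bullet> i) *\<^sub>R i)"
        have I: "box a b \<inter> A = box c' d'" by (simp add: A box_Int_box c'_def d'_def)
        have "cbox c' d' \<subseteq> cbox a b" by (auto simp: mem_box c'_def d'_def)
        then have "(LINT x:box c' d'|lebesgue. g x) = 0" using ab box0[of c' d'] by auto
        moreover have "indicator A x *\<^sub>R F x = indicator (box c' d') x *\<^sub>R g x" for x
          by (simp add: F_def I[symmetric] indicator_inter_arith mult.commute)
        ultimately show ?case by (simp add: set_lebesgue_integral_def)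
      next
        case empty then show ?case by (simp add: set_lebesgue_integral_def)
      next
        case (compl A)
        then have A: "A \<in> sets lebesgue" by (simp add: borel_eq_box)
        have "(LINT x:UNIV - A|lebesgue. F x) = (LINT x|lebesgue. F x - indicator A x *\<^sub>R F x)"
          unfolding set_lebesgue_integral_def
          by (rule Bochner_Integration.integral_cong) (auto simp: indicator_def)
        also have "\<dots> = 0"
          using Fs[OF A] F Fbox compl.IH by (simp add: set_integrable_def set_lebesgue_integral_def)
        finally show ?case .
      next
        case (union A)
        have A: "A i \<in> sets lebesgue" for i using union.hyps by (simp add: borel_eq_box subset_eq)
        have "(LINT x:(\<Union>i. A i)|lebesgue. F x) = (\<Sum>i. (LINT x:A i|lebesgue. F x))"
        proof (rule lebesgue_integral_countable_add)
          show "A i \<inter> A j = {}" if "i \<noteq> j" for i j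
            using union.hyps(1) that by (simp add: disjoint_family_on_def)
          show "set_integrable lebesgue (\<Union>i. A i) F" by (rule Fs) (use A in blast)
        qed (rule A)
        then show ?case using union.IH by simp
      qed
    qed
    have "AE x in lebesgue. F x = 0"
    proof (rule sigma_finite_measure.density_zero[OF sigma_finite_lebesgue F])
      fix A :: "(real^3) set" assume A: "A \<in> sets lebesgue"
      \<comment> \<open>A Lebesgue measurable set differs from its Borel main part by a null set,
        which carries the result over from Borel sets.\<close>
      have mp: "main_part lborel A \<in> sets borel" using main_part_sets[OF A] by simp
      have "AE x in lebesgue. x \<notin> null_part lborel A"
      proof -
        obtain N where N: "N \<in> null_sets lborel" "null_part lborel A \<subseteq> N" using null_part[OF A] by blast
        have "AE x in lebesgue. x \<notin> N" by (rule AE_completion[OF AE_not_in[OF N(1)]])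
        then show ?thesis by eventually_elim (use N(2) in blast)
      qed
      then have "AE x in lebesgue. x \<in> A \<longleftrightarrow> x \<in> main_part lborel A"
        by eventually_elim (use main_part_null_part_Un[OF A] in blast)
      then show "(LINT x:A|lebesgue. F x) = 0"
        using borel[OF mp] set_integral_cong_set[of lebesgue A F "main_part lborel A"]
          Fs[OF A] Fs[OF sets_completionI_sets[OF mp[folded sets_lborel]]]
        by (auto simp: set_borel_measurable_def set_integrable_def)
    qed
    moreover have "AE x in lebesgue. x \<notin> cbox a b - box a b"
      using AE_not_in[OF negligible_frontier_interval[of a b, unfolded negligible_iff_null_sets]] .
    ultimately show ?thesis by eventually_elim (auto simp: F_def)
  qed
  obtain \<D> where D: "countable \<D>" "\<D> \<subseteq> Pow G" "\<And>X. X \<in> \<D> \<Longrightarrow> \<exists>a b. X = cbox a b" "\<Union>\<D> = G"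
    using open_countable_Union_open_cbox[OF G] by blast
  have "AE x in lebesgue. \<forall>X\<in>\<D>. x \<in> X \<longrightarrow> g x = 0"
  proof (subst AE_ball_countable[OF D(1)], rule ballI)
    fix X assume "X \<in> \<D>"
    then show "AE x in lebesgue. x \<in> X \<longrightarrow> g x = 0" using D(2,3) ae by blast
  qed
  then show ?thesis by eventually_elim (use D(4) in blast)
qed


section \<open>The graph of the weak curl\<close>

text \<open>The imaginary part is a real part after multiplying \<open>v\<close> by
  \<open>-\<i>\<close>. The loss of a factor two against Cauchy--Schwarz is harmless, as the bound
  only serves integrability.\<close>

lemma norm_cdot_le: "cmod (cdot v w) \<le> (norm v)\<^sup>2 + (norm w)\<^sup>2"
proof -
  have Re: "\<bar>Re (cdot a b)\<bar> \<le> norm a * norm b" for a b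
    using Cauchy_Schwarz_ineq2[of a "vcnj b"] by (simp add: inner_eq_Re_cdot)
  have "Im (cdot v w) = Re (cdot ((-\<i>) *s v) w)" by (simp add: cdot_def sum_distrib_left Re_sum Im_sum)
  then have "\<bar>Im (cdot v w)\<bar> \<le> norm v * norm w" using Re[of "(-\<i>) *s v" w] by (simp add: norm_smult)
  then have "cmod (cdot v w) \<le> 2 * norm v * norm w" using Re[of v w] cmod_le[of "cdot v w"] by linarith
  then show ?thesis using sum_squares_bound[of "norm v" "norm w"] by linarith
qed

lemma cdot_simps: "cdot (v + v') w = cdot v w + cdot v' w" "cdot (v - v') w = cdot v w - cdot v' w"
  "cdot v (w + w') = cdot v w + cdot v w'" "cdot (c *s v) w = c * cdot v w" "cdot v (c *s w) = c * cdot v w"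
  "cdot 0 w = 0" "cdot v 0 = 0"
  by (simp_all add: cdot_def algebra_simps sum.distrib sum_subtractf sum_distrib_left)

lemma borel_measurable_cdot [measurable (raw)]:
  assumes [measurable]: "v \<in> borel_measurable M" "w \<in> borel_measurable M"
  shows "(\<lambda>x. cdot (v x) (w x)) \<in> borel_measurable M"
  unfolding cdot_def by measurable

lemma integrable_cdot:
  assumes v: "L2 G v" and w: "L2 G w" shows "integrable (lebesgue_on G) (\<lambda>x. cdot (v x) (w x))"
proof (rule Bochner_Integration.integrable_bound)
  have [measurable]: "v \<in> borel_measurable (lebesgue_on G)" "w \<in> borel_measurable (lebesgue_on G)"
    using v w by (auto simp: L2_def)
  show "integrable (lebesgue_on G) (\<lambda>x. (norm (v x))\<^sup>2 + (norm (w x))\<^sup>2)" using v w by (simp add: L2_def)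
  show "(\<lambda>x. cdot (v x) (w x)) \<in> borel_measurable (lebesgue_on G)" by measurable
  show "AE x in lebesgue_on G. norm (cdot (v x) (w x)) \<le> norm ((norm (v x))\<^sup>2 + (norm (w x))\<^sup>2)"
    using norm_cdot_le by auto
qed

definition ext0 :: "'a set \<Rightarrow> ('a \<Rightarrow> 'b::zero) \<Rightarrow> 'a \<Rightarrow> 'b" where
  "ext0 G w x = (if x \<in> G then w x else 0)"

lemma integral_lebesgue_on:
  fixes f :: "'a::euclidean_space \<Rightarrow> 'b::{banach, second_countable_topology}"
  assumes "G \<in> sets lebesgue"
  shows "integral\<^sup>L (lebesgue_on G) f = integral\<^sup>L lebesgue (ext0 G f)"
proof -
  have "ext0 G f = (\<lambda>x. indicator G x *\<^sub>R f x)" by (auto simp: ext0_def)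
  then show ?thesis using assms by (simp add: integral_restrict_space)
qed

lemma integrable_lebesgue_on:
  fixes f :: "'a::euclidean_space \<Rightarrow> 'b::{banach, second_countable_topology}"
  assumes "G \<in> sets lebesgue"
  shows "integrable (lebesgue_on G) f \<longleftrightarrow> integrable lebesgue (ext0 G f)"
proof -
  have "ext0 G f = (\<lambda>x. indicator G x *\<^sub>R f x)" by (auto simp: ext0_def)
  then show ?thesis using assms by (simp add: integrable_restrict_space)
qed

lemma AE_lebesgue_on: "G \<in> sets lebesgue \<Longrightarrow> (AE x in lebesgue_on G. P x) \<longleftrightarrow> (AE x in lebesgue. x \<in> G \<longrightarrow> P x)"
  by (simp add: AE_restrict_space_iff)

lemma borel_measurable_ext0_iff:
  fixes f :: "'a::euclidean_space \<Rightarrow> 'b::euclidean_space"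
  assumes "G \<in> sets lebesgue"
  shows "ext0 G f \<in> borel_measurable lebesgue \<longleftrightarrow> f \<in> borel_measurable (lebesgue_on G)"
  unfolding ext0_def[abs_def] using borel_measurable_if[OF assms, of f] by simp

lemma L2_iff_sqint: "G \<in> sets lebesgue \<Longrightarrow> L2 G w \<longleftrightarrow> sqint (ext0 G w)"
proof -
  have "ext0 G (\<lambda>x. (norm (w x))\<^sup>2) = (\<lambda>x. (norm (ext0 G w x))\<^sup>2)" by (auto simp: ext0_def)
  then show "G \<in> sets lebesgue \<Longrightarrow> ?thesis"
    by (simp add: L2_def sqint_def borel_measurable_ext0_iff integrable_lebesgue_on)
qed

definition cls :: "(real^3) set \<Rightarrow> vfield \<Rightarrow> l2" where "cls G w = abs_l2 (ext0 G w)"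

lemma ext0_diff:
  "ext0 G (\<lambda>x. v x - w x) = (\<lambda>x. ext0 G v x - ext0 G w x)"
  for v w :: "'a \<Rightarrow> 'b::group_add"
  by (auto simp: ext0_def)

lemma ext0_vcnj: "ext0 G (\<lambda>x. vcnj (v x)) = (\<lambda>x. vcnj (ext0 G v x))" by (auto simp: ext0_def)

lemma ext0_smult: "ext0 G (\<lambda>x. m x *s v x) = (\<lambda>x. ext0 G m x *s ext0 G v x)" for v :: vfield
  by (auto simp: ext0_def)

context
  fixes G :: "(real^3) set" assumes G: "G \<in> sets lebesgue"
begin

lemma L2_diff: "L2 G v \<Longrightarrow> L2 G w \<Longrightarrow> L2 G (\<lambda>x. v x - w x)" for v w :: vfield
  by (simp add: L2_iff_sqint[OF G] ext0_diff sqint_diff)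

lemma L2_vcnj: "L2 G v \<Longrightarrow> L2 G (\<lambda>x. vcnj (v x))"
  by (simp add: L2_iff_sqint[OF G] ext0_vcnj sqint_vcnj)

lemma L2_smult: "essbdd (ext0 G m) \<Longrightarrow> L2 G v \<Longrightarrow> L2 G (\<lambda>x. m x *s v x)" for v :: vfield
  by (simp add: L2_iff_sqint[OF G] ext0_smult sqint_smult)

lemma cls_diff: "L2 G v \<Longrightarrow> L2 G w \<Longrightarrow> cls G (\<lambda>x. v x - w x) = cls G v - cls G w"
  by (simp add: cls_def ext0_diff L2_iff_sqint[OF G] abs_l2_simps)

lemma cls_vcnj: "L2 G v \<Longrightarrow> cls G (\<lambda>x. vcnj (v x)) = conj_l2 (cls G v)"
  by (simp add: cls_def ext0_vcnj L2_iff_sqint[OF G] conj_abs)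

lemma cls_smult: "essbdd (ext0 G m) \<Longrightarrow> L2 G v \<Longrightarrow> cls G (\<lambda>x. m x *s v x) = mulop (ext0 G m) (cls G v)"
  by (simp add: cls_def ext0_smult L2_iff_sqint[OF G] mulop_abs)

lemma cls_eq_iff: "L2 G v \<Longrightarrow> L2 G w \<Longrightarrow> cls G v = cls G w \<longleftrightarrow> (AE x in lebesgue_on G. v x = w x)"
proof -
  have "ext0 G v x = ext0 G w x \<longleftrightarrow> (x \<in> G \<longrightarrow> v x = w x)" for x by (simp add: ext0_def)
  then show "L2 G v \<Longrightarrow> L2 G w \<Longrightarrow> ?thesis"
    by (simp add: cls_def L2_iff_sqint[OF G] abs_l2_eq_iff AE_lebesgue_on[OF G])
qed

lemma L2norm_cls: "L2 G v \<Longrightarrow> L2norm G v = norm (cls G v)"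
proof -
  assume v: "L2 G v"
  have "ext0 G (\<lambda>x. (norm (v x))\<^sup>2) = (\<lambda>x. (norm (ext0 G v x))\<^sup>2)" by (auto simp: ext0_def)
  then have "L2norm G v = sqrt ((norm (cls G v))\<^sup>2)"
    using v by (simp add: L2norm_def cls_def integral_lebesgue_on[OF G] norm_abs_l2 L2_iff_sqint[OF G])
  then show ?thesis by simp
qed

lemma Re_integral_cdot:
  assumes v: "L2 G v" and w: "L2 G w"
  shows "Re (LINT x|lebesgue_on G. cdot (v x) (w x)) = cls G v \<bullet> cls G (\<lambda>x. vcnj (w x))"
proof -
  have "Re (LINT x|lebesgue_on G. cdot (v x) (w x)) = (LINT x|lebesgue_on G. v x \<bullet> vcnj (w x))"
    using integral_Re[OF integrable_cdot[OF v w]] by (simp add: inner_eq_Re_cdot)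
  also have "\<dots> = (LINT x|lebesgue. ext0 G v x \<bullet> vcnj (ext0 G w x))"
    unfolding integral_lebesgue_on[OF G] by (rule Bochner_Integration.integral_cong) (auto simp: ext0_def)
  finally show ?thesis
    using v w by (simp add: cls_def ext0_vcnj abs_l2_simps L2_iff_sqint[OF G] sqint_vcnj)
qed

lemma Re_L2inner: "L2 G v \<Longrightarrow> L2 G w \<Longrightarrow> Re (L2inner G v w) = cls G v \<bullet> cls G w"
  using Re_integral_cdot[of v "\<lambda>x. vcnj (w x)"] L2_vcnj[of w] by (simp add: L2inner_def)

lemma cls_rep: "sqint (ext0 G (rep_l2 y))" "L2 G (rep_l2 y)"
  and cls_rep_eq: "cls G (rep_l2 y) = mulop (ext0 G (\<lambda>_. 1)) y"
proof -
  have b: "essbdd (ext0 G (\<lambda>_. 1))"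
  proof -
    have "ext0 G (\<lambda>_. 1 :: complex) \<in> borel_measurable lebesgue" using G by (subst borel_measurable_ext0_iff) auto
    then show ?thesis unfolding essbdd_def by (auto intro!: exI[of _ 1] simp: ext0_def)
  qed
  have eq: "ext0 G (rep_l2 y) = (\<lambda>x. ext0 G (\<lambda>_. 1) x *s rep_l2 y x)" by (auto simp: ext0_def)
  show "sqint (ext0 G (rep_l2 y))" unfolding eq by (rule sqint_smult[OF b]) simp
  then show "L2 G (rep_l2 y)" by (simp add: L2_iff_sqint[OF G])
  show "cls G (rep_l2 y) = mulop (ext0 G (\<lambda>_. 1)) y"
    using mulop_abs[OF b sqint_rep[of y]] by (simp add: cls_def eq)
qed

lemma essbdd_ext0:
  assumes "Linf G m" shows "essbdd (ext0 G m)"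
proof -
  obtain B where B: "AE x in lebesgue_on G. norm (m x) \<le> B" using assms by (auto simp: Linf_def)
  have "AE x in lebesgue. cmod (ext0 G m x) \<le> max B 0"
    using B unfolding AE_lebesgue_on[OF G] by eventually_elim (auto simp: ext0_def)
  then show ?thesis using assms borel_measurable_ext0_iff[OF G] unfolding essbdd_def Linf_def by blast
qed

lemma mulop_restrict_cls: "L2 G v \<Longrightarrow> mulop (ext0 G (\<lambda>_. 1)) (cls G v) = cls G v"
proof -
  have "Linf G (\<lambda>_. 1 :: complex)" by (auto simp: Linf_def intro!: exI[of _ 1])
  then show "L2 G v \<Longrightarrow> ?thesis" using cls_smult[OF essbdd_ext0, of "\<lambda>_. 1" v] by simp
qed

end

section \<open>Smooth fields and their curls\<close>

lemma L2_bounded: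
  assumes G: "open G" "bounded G" and c: "continuous_on UNIV \<phi>"
  shows "L2 G (\<phi> :: vfield)"
proof -
  have cp: "compact (closure G)" using G(2) by simp
  have "bounded (\<phi> ` closure G)"
    by (intro compact_imp_bounded compact_continuous_image continuous_on_subset[OF c] cp) auto
  then obtain B where B: "\<And>x. x \<in> closure G \<Longrightarrow> norm (\<phi> x) \<le> B" unfolding bounded_iff by blast
  have fin: "G \<in> lmeasurable" using G by (simp add: lmeasurable_open)
  have m: "\<phi> \<in> borel_measurable (lebesgue_on G)"
    using c continuous_imp_measurable_on_sets_lebesgue[of G \<phi>] G(1) continuous_on_subset[OF c] by (simp add: fmeasurableD fin)
  have "integrable (lebesgue_on G) (\<lambda>x. (norm (\<phi> x))\<^sup>2)"
  proof (rule Bochner_Integration.integrable_bound)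
    show "integrable (lebesgue_on G) (\<lambda>x. B\<^sup>2 :: real)"
      using fin finite_measure_lebesgue_on[OF fin] by (simp add: finite_measure.integrable_const)
    have "(norm (\<phi> x))\<^sup>2 \<le> B\<^sup>2" if "x \<in> G" for x
      using B[of x] that closure_subset by (intro power_mono) auto
    then show "AE x in lebesgue_on G. norm ((norm (\<phi> x))\<^sup>2) \<le> norm (B\<^sup>2)"
      by (intro AE_I2) auto
  qed (use m in auto)
  then show ?thesis using m by (simp add: L2_def)
qed

lemma smooth_continuous: "smooth \<phi> \<Longrightarrow> continuous_on UNIV \<phi>"
  unfolding smooth_def using Ck.simps(1) by blast

lemma smooth_differentiable: "smooth \<phi> \<Longrightarrow> \<phi> differentiable (at x)"
  unfolding smooth_def using Ck.simps(2) by blast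

lemma smooth_curl_continuous: assumes "smooth \<phi>" shows "continuous_on UNIV (curl \<phi>)"
proof -
  have c: "continuous_on UNIV (\<lambda>x. pderiv_at i \<phi> x $ j)" for i j
  proof -
    have "Ck 0 (pderiv_at i \<phi>)" using assms unfolding smooth_def using Ck.simps(2)[of 0 \<phi>] by blast
    then show ?thesis by (auto intro!: continuous_intros)
  qed
  have "\<forall>i. continuous_on UNIV (\<lambda>x. curl \<phi> x $ i)"
    unfolding forall_3 curl_def vector_3 by (intro conjI continuous_on_diff c)
  then have "continuous_on UNIV (\<lambda>x. \<chi> i. curl \<phi> x $ i)" by (intro continuous_on_vec_lambda) blast
  then show ?thesis by simp
qed

lemma smooth_linear: "bounded_linear L \<Longrightarrow> smooth \<phi> \<Longrightarrow> smooth (\<lambda>x. L (\<phi> x))"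
  by (simp add: smooth_def Ck_bounded_linear)

lemma pderiv_at_linear:
  assumes "bounded_linear L" "smooth \<phi>" shows "pderiv_at i (\<lambda>x. L (\<phi> x)) x = L (pderiv_at i \<phi> x)"
  using bounded_linear.has_derivative[OF assms(1) smooth_differentiable[OF assms(2), unfolded frechet_derivative_works]]
  by (subst pderiv_at_eq) (auto simp: pderiv_at_def)

lemma bounded_linear_smult: "bounded_linear (\<lambda>v. c *s v :: complex^3)"
  by (rule bounded_linear_intro[where K = "cmod c"]) (auto simp: norm_smult mult.commute)

lemma bounded_linear_vcnj: "bounded_linear vcnj"
  by (rule bounded_linear_intro[where K = 1]) auto

lemma curl_smult: "smooth \<phi> \<Longrightarrow> curl (\<lambda>x. c *s \<phi> x) x = c *s curl \<phi> x"
  unfolding curl_def pderiv_at_linear[OF bounded_linear_smult]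
  by (simp add: vec_eq_iff forall_3 algebra_simps)

lemma curl_vcnj: "smooth \<phi> \<Longrightarrow> curl (\<lambda>x. vcnj (\<phi> x)) x = vcnj (curl \<phi> x)"
  unfolding curl_def pderiv_at_linear[OF bounded_linear_vcnj]
  by (simp add: vec_eq_iff forall_3 vcnj_def)

text \<open>The first two equations say that both components vanish almost everywhere outside
  \<open>G\<close>. The last one expresses at once that the second component is a weak curl of the
  first, compactly supported test functions being among the \<open>\<phi>\<close>, and that the
  tangential trace vanishes. Conjugating the test fields converts the bilinear product into the real
  inner product.\<close>

definition weak_graph :: "(real^3) set \<Rightarrow> (l2 \<times> l2) set" where
  "weak_graph G = {p. mulop (ext0 G (\<lambda>_. 1)) (fst p) = fst p \<and> mulop (ext0 G (\<lambda>_. 1)) (snd p) = snd p \<and>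
     (\<forall>\<phi>. smooth \<phi> \<longrightarrow> fst p \<bullet> cls G (\<lambda>x. vcnj (curl \<phi> x)) = snd p \<bullet> cls G (\<lambda>x. vcnj (\<phi> x)))}"

definition graph_emb :: "(real^3) set \<Rightarrow> vfield \<Rightarrow> l2 \<times> l2" where
  "graph_emb G w = (cls G w, cls G (weak_curl G w))"

lemma Hcurl_weak_curl:
  assumes "w \<in> Hcurl G" shows "L2 G (weak_curl G w) \<and> has_weak_curl G w (weak_curl G w)"
proof -
  have "\<exists>g. L2 G g \<and> has_weak_curl G w g" using assms by (simp add: Hcurl_def)
  then show ?thesis unfolding weak_curl_def by (rule someI_ex)
qed

lemma H0curl_L2:
  assumes "w \<in> H0curl G" shows "L2 G w" "L2 G (weak_curl G w)"
  using assms Hcurl_weak_curl by (auto simp: H0curl_def Hcurl_def)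

text \<open>Testing with a scalar bump times a unit vector isolates one component of the difference
  of the two curls.\<close>

lemma weak_curl_unique:
  assumes G: "open G" and L: "L2 G g" "L2 G g'" and c: "has_weak_curl G w g" "has_weak_curl G w g'"
    and w: "\<And>\<phi> :: vfield. test_function G \<phi> \<Longrightarrow> L2 G \<phi>"
  shows "cls G g = cls G g'"
proof -
  have Gm: "G \<in> sets lebesgue" using G by simp
  define e where "e x = g x - g' x" for x
  have e: "L2 G e" unfolding e_def by (rule L2_diff[OF Gm L])
  then have se: "sqint (ext0 G e)" by (simp add: L2_iff_sqint[OF Gm])
  have "AE x in lebesgue. x \<in> G \<longrightarrow> ext0 G e x $ i = 0" for i
  proof (rule zero_of_bump_integrals[OF G])
    fix a b :: "real^3" assume ab: "cbox a b \<subseteq> G"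
    show "set_integrable lebesgue (cbox a b) (\<lambda>x. ext0 G e x $ i)"
      unfolding set_integrable_def
    proof (rule Bochner_Integration.integrable_bound)
      have "integrable lebesgue (indicator (cbox a b) :: real^3 \<Rightarrow> real)" using emeasure_lborel_cbox_finite[of a b] by (simp add: integrable_indicator_iff)
      then show "integrable lebesgue (\<lambda>x. indicator (cbox a b) x + (norm (ext0 G e x))\<^sup>2)" using se by (simp add: sqint_def)
      show "(\<lambda>x. indicator (cbox a b) x *\<^sub>R ext0 G e x $ i) \<in> borel_measurable lebesgue"
        using sqint_measurable[OF se] by (auto intro!: borel_measurable_scaleR borel_measurable_indicator borel_measurable_vec_nth)
      have *: "norm (indicator (cbox a b) x *\<^sub>R ext0 G e x $ i) \<le> indicator (cbox a b) x + (norm (ext0 G e x))\<^sup>2" for x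
      proof (cases "x \<in> cbox a b")
        case True
        have "norm (ext0 G e x $ i) \<le> norm (ext0 G e x)" by (rule Finite_Cartesian_Product.norm_nth_le)
        also have "\<dots> \<le> 1 + (norm (ext0 G e x))\<^sup>2"
          using sum_squares_bound[of 1 "norm (ext0 G e x)", simplified] norm_ge_zero[of "ext0 G e x"] by linarith
        finally show ?thesis using True by simp
      qed simp
      show "AE x in lebesgue. norm (indicator (cbox a b) x *\<^sub>R ext0 G e x $ i) \<le> norm (indicator (cbox a b) x + (norm (ext0 G e x))\<^sup>2)"
        by (rule AE_I2) (rule order_trans[OF *], simp)
    qed
    fix n :: real assume n: "0 < n"
    let ?\<phi> = "\<lambda>x. bump a b n x *\<^sub>R (axis i 1 :: complex^3)"
    have t: "test_function G ?\<phi>" by (rule test_function_bump[OF ab n bounded_linear_scaleR_left])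
    have "(LINT x|lebesgue_on G. cdot (e x) (?\<phi> x)) = (LINT x|lebesgue_on G. cdot (g x) (?\<phi> x)) - (LINT x|lebesgue_on G. cdot (g' x) (?\<phi> x))"
      unfolding e_def cdot_simps
      by (rule Bochner_Integration.integral_diff[OF integrable_cdot[OF L(1) w[OF t]] integrable_cdot[OF L(2) w[OF t]]])
    also have "\<dots> = 0"
      using c(1)[unfolded has_weak_curl_def, rule_format, OF t] c(2)[unfolded has_weak_curl_def, rule_format, OF t] by simp
    finally have "(LINT x|lebesgue. ext0 G (\<lambda>x. cdot (e x) (?\<phi> x)) x) = 0" by (simp add: integral_lebesgue_on[OF Gm])
    moreover have "ext0 G (\<lambda>x. cdot (e x) (?\<phi> x)) x = bump a b n x *\<^sub>R ext0 G e x $ i" for x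
    proof -
      have "cdot v (r *\<^sub>R axis i 1) = (\<Sum>j\<in>UNIV. if j = i then r *\<^sub>R (v $ j) else 0)" for v r
        unfolding cdot_def by (rule sum.cong) (auto simp: axis_def)
      then have "cdot v (r *\<^sub>R axis i 1) = r *\<^sub>R (v $ i)" for v r by simp
      then show ?thesis by (simp add: ext0_def)
    qed
    ultimately show "(LINT x|lebesgue. bump a b n x *\<^sub>R ext0 G e x $ i) = 0" by simp
  qed
  then have "AE x in lebesgue. \<forall>i\<in>UNIV. x \<in> G \<longrightarrow> ext0 G e x $ i = 0"
    by (subst AE_ball_countable) auto
  then have "AE x in lebesgue. x \<in> G \<longrightarrow> g x = g' x"
    by eventually_elim (auto simp: ext0_def e_def vec_eq_iff)
  then show ?thesis by (simp add: cls_eq_iff[OF Gm L] AE_lebesgue_on[OF Gm])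
qed

context
  fixes G :: "(real^3) set" assumes G: "open G" "bounded G"
begin

lemma G_sets: "G \<in> sets lebesgue" using G by simp

lemma smooth_L2: "smooth \<phi> \<Longrightarrow> L2 G \<phi>" "smooth \<phi> \<Longrightarrow> L2 G (curl \<phi>)"
  using G smooth_continuous smooth_curl_continuous by (auto intro: L2_bounded)

text \<open>Testing with \<open>\<phi>\<close> and \<open>-\<i> \<phi>\<close> recovers the complex identity from its real part.\<close>

lemma weak_graph_complex:
  assumes v: "L2 G v" "L2 G c"
  shows "(\<forall>\<phi>. smooth \<phi> \<longrightarrow> cls G v \<bullet> cls G (\<lambda>x. vcnj (curl \<phi> x)) = cls G c \<bullet> cls G (\<lambda>x. vcnj (\<phi> x))) \<longleftrightarrow>
    (\<forall>\<phi>. smooth \<phi> \<longrightarrow> (LINT x|lebesgue_on G. cdot (v x) (curl \<phi> x)) = (LINT x|lebesgue_on G. cdot (c x) (\<phi> x)))"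
    (is "(\<forall>\<phi>. smooth \<phi> \<longrightarrow> ?R \<phi>) \<longleftrightarrow> (\<forall>\<phi>. smooth \<phi> \<longrightarrow> ?l \<phi> = ?r \<phi>)")
proof -
  have Re: "?R \<phi> \<longleftrightarrow> Re (?l \<phi>) = Re (?r \<phi>)" if "smooth \<phi>" for \<phi> :: vfield
    using smooth_L2[OF that] v by (simp add: Re_integral_cdot[OF G_sets])
  have i: "?l (\<lambda>x. (-\<i>) *s \<phi> x) = -\<i> * ?l \<phi>" "?r (\<lambda>x. (-\<i>) *s \<phi> x) = -\<i> * ?r \<phi>"
    "smooth (\<lambda>x. (-\<i>) *s \<phi> x)" if "smooth \<phi>" for \<phi> :: vfield
    using smooth_linear[OF bounded_linear_smult that]
    by (simp_all only: curl_smult[OF that] cdot_simps integral_mult_right_zero)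
  show ?thesis
  proof (intro iffI allI impI)
    fix \<phi> :: vfield assume R: "\<forall>\<phi>. smooth \<phi> \<longrightarrow> ?R \<phi>" and s: "smooth \<phi>"
    have "Re (?l \<phi>) = Re (?r \<phi>)" using R Re[OF s] s by blast
    moreover have "Re (-\<i> * ?l \<phi>) = Re (-\<i> * ?r \<phi>)"
      using R i(3)[OF s] Re[OF i(3)[OF s]] unfolding i(1,2)[OF s] by blast
    ultimately show "?l \<phi> = ?r \<phi>" by (simp add: complex_eq_iff)
  next
    fix \<phi> :: vfield assume "\<forall>\<phi>. smooth \<phi> \<longrightarrow> ?l \<phi> = ?r \<phi>" "smooth \<phi>"
    then show "?R \<phi>" using Re by simp
  qed
qed

lemma graph_emb_H0curl:
  assumes w: "w \<in> H0curl G" shows "graph_emb G w \<in> weak_graph G"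
proof -
  note L = H0curl_L2[OF w]
  have "\<forall>\<phi>. smooth \<phi> \<longrightarrow> (LINT x|lebesgue_on G. cdot (w x) (curl \<phi> x)) = (LINT x|lebesgue_on G. cdot (weak_curl G w x) (\<phi> x))"
    using w by (simp add: H0curl_def tangential_trace_def)
  then show ?thesis
    using weak_graph_complex[OF L] mulop_restrict_cls[OF G_sets] L by (simp add: weak_graph_def graph_emb_def)
qed

text \<open>A representative of \<open>c\<close> is a weak curl of \<open>w\<close>, and by
  uniqueness its class is that of the representative selected by \<open>weak_curl\<close>.
  Membership in \<open>H0curl\<close> thus becomes a condition on classes.\<close>

lemma H0curl_of_weak_graph:
  assumes w: "L2 G w" and p: "(cls G w, c) \<in> weak_graph G"
  shows "w \<in> H0curl G" "graph_emb G w = (cls G w, c)"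
proof -
  define g where "g = rep_l2 c"
  have g: "L2 G g" by (simp add: g_def cls_rep[OF G_sets])
  have cg: "cls G g = c" using p by (simp add: g_def cls_rep_eq[OF G_sets] weak_graph_def)
  have eq: "(LINT x|lebesgue_on G. cdot (w x) (curl \<phi> x)) = (LINT x|lebesgue_on G. cdot (g x) (\<phi> x))" if "smooth \<phi>" for \<phi> :: vfield
    using p weak_graph_complex[OF w g] that by (simp add: weak_graph_def cg)
  have hg: "has_weak_curl G w g" using eq by (simp add: has_weak_curl_def test_function_def)
  then have wH: "w \<in> Hcurl G" using w g by (auto simp: Hcurl_def)
  note wc = Hcurl_weak_curl[OF wH]
  have cc: "cls G (weak_curl G w) = c"
    unfolding cg[symmetric]
    by (rule weak_curl_unique[OF G(1) _ g _ hg]) (use wc smooth_L2(1) in \<open>auto simp: test_function_def\<close>)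
  show ge: "graph_emb G w = (cls G w, c)" by (simp add: graph_emb_def cc)
  have "(LINT x|lebesgue_on G. cdot (w x) (curl \<phi> x)) = (LINT x|lebesgue_on G. cdot (weak_curl G w x) (\<phi> x))" if "smooth \<phi>" for \<phi> :: vfield
    using p weak_graph_complex[OF w conjunct1[OF wc]] that by (simp add: weak_graph_def cc)
  then show "w \<in> H0curl G" using wH by (simp add: H0curl_def tangential_trace_def)
qed

lemma weak_graph_obtain:
  assumes "p \<in> weak_graph G" obtains w where "w \<in> H0curl G" "graph_emb G w = p"
proof -
  have L: "L2 G (rep_l2 (fst p))" by (rule cls_rep[OF G_sets])
  have "cls G (rep_l2 (fst p)) = fst p" using assms by (simp add: cls_rep_eq[OF G_sets] weak_graph_def)
  then show ?thesis using H0curl_of_weak_graph[OF L, of "snd p"] assms that by simp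
qed

lemma subspace_weak_graph: "subspace (weak_graph G)"
  unfolding subspace_def weak_graph_def
  by (auto simp: linear_add[OF linear_mulop] linear_scale[OF linear_mulop] linear_0[OF linear_mulop] inner_add_left)

lemma closed_weak_graph: "closed (weak_graph G)"
proof -
  have m: "continuous_on UNIV (mulop m)" for m by (intro linear_continuous_on bounded_linear_mulop)
  have "weak_graph G = {p. mulop (ext0 G (\<lambda>_. 1)) (fst p) = fst p} \<inter> {p. mulop (ext0 G (\<lambda>_. 1)) (snd p) = snd p} \<inter>
     (\<Inter>\<phi>\<in>{\<phi>. smooth \<phi>}. {p. fst p \<bullet> cls G (\<lambda>x. vcnj (curl \<phi> x)) = snd p \<bullet> cls G (\<lambda>x. vcnj (\<phi> x))})"
    by (auto simp: weak_graph_def)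
  moreover have "closed \<dots>"
    by (intro closed_Int closed_INT ballI closed_Collect_eq continuous_intros continuous_on_compose2[OF m]) auto
  ultimately show ?thesis by simp
qed

text \<open>Linearity of the curl is not immediate for a chosen representative. It follows because
  the graph is a subspace in which the first component determines the second.\<close>

lemma graph_emb_diff:
  assumes v: "v \<in> H0curl G" and w: "w \<in> H0curl G"
  shows "(\<lambda>x. v x - w x) \<in> H0curl G" "graph_emb G (\<lambda>x. v x - w x) = graph_emb G v - graph_emb G w"
proof -
  have L: "L2 G (\<lambda>x. v x - w x)" using v w by (simp add: L2_diff[OF G_sets] H0curl_L2)
  have c: "cls G (\<lambda>x. v x - w x) = cls G v - cls G w" using v w by (simp add: cls_diff[OF G_sets] H0curl_L2)
  have "graph_emb G v - graph_emb G w \<in> weak_graph G"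
    using subspace_diff[OF subspace_weak_graph] graph_emb_H0curl v w by blast
  then have "(cls G (\<lambda>x. v x - w x), cls G (weak_curl G v) - cls G (weak_curl G w)) \<in> weak_graph G"
    by (simp add: c graph_emb_def)
  from H0curl_of_weak_graph[OF L this]
  show "(\<lambda>x. v x - w x) \<in> H0curl G" "graph_emb G (\<lambda>x. v x - w x) = graph_emb G v - graph_emb G w"
    by (simp_all add: c graph_emb_def)
qed

lemma norm_graph_emb: "w \<in> H0curl G \<Longrightarrow> Hcurl_norm G w = norm (graph_emb G w)"
  by (simp add: Hcurl_norm_def graph_emb_def norm_Pair L2norm_cls[OF G_sets] H0curl_L2)

end


section \<open>Complex scaling, conjugation and Nedelec fields\<close>

lemma rep_l2_simps:
  "AE x in lebesgue. rep_l2 (y + z) x = rep_l2 y x + rep_l2 z x"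
  "AE x in lebesgue. rep_l2 (r *\<^sub>R y) x = r *\<^sub>R rep_l2 y x"
  "AE x in lebesgue. rep_l2 (conj_l2 y) x = vcnj (rep_l2 y x)"
  "essbdd m \<Longrightarrow> AE x in lebesgue. rep_l2 (mulop m y) x = m x *s rep_l2 y x"
  "AE x in lebesgue. rep_l2 0 x = 0"
  using rep_abs_l2[OF sqint_add[OF sqint_rep sqint_rep], of y z] rep_abs_l2[OF sqint_scaleR[OF sqint_rep], of r y]
    rep_abs_l2[OF sqint_vcnj[OF sqint_rep], of y] rep_abs_l2[OF sqint_smult[OF _ sqint_rep], of m y] rep_abs_l2[OF sqint_zero]
    abs_l2_simps(1)[of "rep_l2 y" "rep_l2 z"] abs_l2_simps(3)[of "rep_l2 y" r] conj_abs[of "rep_l2 y"] mulop_abs[of m "rep_l2 y"]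
  by (auto simp: zero_l2.abs_eq)

definition pscale :: "complex \<Rightarrow> l2 \<times> l2 \<Rightarrow> l2 \<times> l2" where
  "pscale c p = (mulop (\<lambda>_. c) (fst p), mulop (\<lambda>_. c) (snd p))"

definition pconj :: "l2 \<times> l2 \<Rightarrow> l2 \<times> l2" where "pconj p = (conj_l2 (fst p), conj_l2 (snd p))"

lemma cls_scale: "G \<in> sets lebesgue \<Longrightarrow> L2 G v \<Longrightarrow> cls G (\<lambda>x. c *s v x) = mulop (\<lambda>_. c) (cls G v)"
proof -
  have "ext0 G (\<lambda>x. c *s v x) = (\<lambda>x. c *s ext0 G v x)" by (auto simp: ext0_def)
  then show "G \<in> sets lebesgue \<Longrightarrow> L2 G v \<Longrightarrow> ?thesis" by (simp add: cls_def mulop_abs L2_iff_sqint)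
qed

lemma essbdd_one: "G \<in> sets lebesgue \<Longrightarrow> essbdd (ext0 G (\<lambda>_. 1))"
  by (rule essbdd_ext0) (auto simp: Linf_def intro!: exI[of _ 1])

lemma cnj_ext0_one: "cnj (ext0 G (\<lambda>_. 1) x) = ext0 G (\<lambda>_. 1) x" by (simp add: ext0_def)

text \<open>The scalar moves to the test side, where \<open>c *s \<phi>\<close> is again a smooth
  field.\<close>

lemma pscale_weak_graph:
  assumes G: "open G" "bounded G" and p: "p \<in> weak_graph G" shows "pscale c p \<in> weak_graph G"
proof -
  have Gm: "G \<in> sets lebesgue" using G by simp
  have r: "mulop (ext0 G (\<lambda>_. 1)) (mulop (\<lambda>_. c) y) = mulop (\<lambda>_. c) (mulop (ext0 G (\<lambda>_. 1)) y)" for y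
    using essbdd_one[OF Gm] by (simp add: mulop_mulop mult.commute)
  have "mulop (\<lambda>_. c) (fst p) \<bullet> cls G (\<lambda>x. vcnj (curl \<phi> x)) = mulop (\<lambda>_. c) (snd p) \<bullet> cls G (\<lambda>x. vcnj (\<phi> x))"
    if s: "smooth \<phi>" for \<phi>
  proof -
    have a: "mulop (\<lambda>_. c) y \<bullet> cls G (\<lambda>x. vcnj (v x)) = y \<bullet> cls G (\<lambda>x. vcnj (c *s v x))" if "L2 G v" for y v
      using cls_scale[OF Gm L2_vcnj[OF Gm that], of "cnj c"] by (simp add: mulop_adjoint)
    have "smooth (\<lambda>x. c *s \<phi> x)" by (rule smooth_linear[OF bounded_linear_smult s])
    then have "fst p \<bullet> cls G (\<lambda>x. vcnj (curl (\<lambda>x. c *s \<phi> x) x)) = snd p \<bullet> cls G (\<lambda>x. vcnj (c *s \<phi> x))"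
      using p unfolding weak_graph_def by blast
    then show ?thesis using smooth_L2[OF G s] by (simp only: a curl_smult[OF s])
  qed
  then show ?thesis using p by (simp add: weak_graph_def pscale_def r)
qed

lemma pconj_weak_graph:
  assumes G: "open G" "bounded G" and p: "p \<in> weak_graph G" shows "pconj p \<in> weak_graph G"
proof -
  have Gm: "G \<in> sets lebesgue" using G by simp
  have r: "mulop (ext0 G (\<lambda>_. 1)) (conj_l2 y) = conj_l2 (mulop (ext0 G (\<lambda>_. 1)) y)" for y
    by (simp add: conj_mulop essbdd_one[OF Gm] cnj_ext0_one)
  have "conj_l2 (fst p) \<bullet> cls G (\<lambda>x. vcnj (curl \<phi> x)) = conj_l2 (snd p) \<bullet> cls G (\<lambda>x. vcnj (\<phi> x))"
    if s: "smooth \<phi>" for \<phi>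
  proof -
    have a: "conj_l2 y \<bullet> cls G (\<lambda>x. vcnj (v x)) = y \<bullet> cls G (\<lambda>x. vcnj (vcnj (v x)))" if "L2 G v" for y v
      using conj_inner[of "conj_l2 y" "cls G (\<lambda>x. vcnj (v x))"] cls_vcnj[OF Gm L2_vcnj[OF Gm that]] by (simp del: vcnj_simps)
    have "smooth (\<lambda>x. vcnj (\<phi> x))" by (rule smooth_linear[OF bounded_linear_vcnj s])
    then have "fst p \<bullet> cls G (\<lambda>x. vcnj (curl (\<lambda>x. vcnj (\<phi> x)) x)) = snd p \<bullet> cls G (\<lambda>x. vcnj (vcnj (\<phi> x)))"
      using p unfolding weak_graph_def by blast
    then show ?thesis using smooth_L2[OF G s] by (simp only: a curl_vcnj[OF s])
  qed
  then show ?thesis using p by (simp add: weak_graph_def pconj_def r)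
qed

section \<open>Edge element fields\<close>

definition cvec :: "real^3 \<Rightarrow> complex^3" where "cvec x = (\<chi> i. complex_of_real (x $ i))"

lemma ccross_nth: "ccross v w $ 1 = v $ 2 * w $ 3 - v $ 3 * w $ 2" "ccross v w $ 2 = v $ 3 * w $ 1 - v $ 1 * w $ 3"
  "ccross v w $ 3 = v $ 1 * w $ 2 - v $ 2 * w $ 1"
  by (simp_all add: ccross_def)

lemma ccross_simps: "ccross v (w + w') = ccross v w + ccross v w'" "ccross v (c *s w) = c *s ccross v w"
  "ccross v 0 = 0" "ccross 0 w = 0" "ccross (v + v') w = ccross v w + ccross v' w" "ccross (c *s v) w = c *s ccross v w"
  "ccross v (r *\<^sub>R w) = r *\<^sub>R ccross v w" "ccross (r *\<^sub>R v) w = r *\<^sub>R ccross v w"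
  by (simp_all add: vec_eq_iff forall_3 ccross_nth algebra_simps)

lemma vcnj_ccross_cvec: "vcnj (ccross (cvec x) b) = ccross (cvec x) (vcnj b)"
  by (simp add: vec_eq_iff forall_3 ccross_nth vcnj_def cvec_def)

lemma cvec_simps: "cvec (x + y) = cvec x + cvec y" "cvec (r *\<^sub>R x) = r *\<^sub>R cvec x" "cvec 0 = 0"
  by (simp_all add: vec_eq_iff cvec_def scaleR_conv_of_real[where 'a = complex])

text \<open>The shape functions of the lowest-order edge element. As an almost everywhere condition
  it does not depend on the representative \<open>rep_l2 y\<close>.\<close>

definition edge_on :: "(real^3) set \<Rightarrow> l2 \<Rightarrow> bool" where
  "edge_on T y \<longleftrightarrow> (\<exists>a b. AE x in lebesgue. x \<in> T \<longrightarrow> rep_l2 y x = a + ccross (cvec x) b)"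

lemma edge_on_add: assumes "edge_on T y" "edge_on T z" shows "edge_on T (y + z)"
proof -
  obtain a b where 1: "AE x in lebesgue. x \<in> T \<longrightarrow> rep_l2 y x = a + ccross (cvec x) b"
    using assms(1) by (auto simp: edge_on_def)
  obtain a' b' where 2: "AE x in lebesgue. x \<in> T \<longrightarrow> rep_l2 z x = a' + ccross (cvec x) b'"
    using assms(2) by (auto simp: edge_on_def)
  have "AE x in lebesgue. x \<in> T \<longrightarrow> rep_l2 (y + z) x = (a + a') + ccross (cvec x) (b + b')"
    using rep_l2_simps(1)[of y z] 1 2 by eventually_elim (auto simp: ccross_simps)
  then show ?thesis unfolding edge_on_def by blast
qed

lemma edge_on_mulop: assumes "edge_on T y" shows "edge_on T (mulop (\<lambda>_. c) y)"
proof -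
  obtain a b where 1: "AE x in lebesgue. x \<in> T \<longrightarrow> rep_l2 y x = a + ccross (cvec x) b"
    using assms(1) by (auto simp: edge_on_def)
  have "AE x in lebesgue. x \<in> T \<longrightarrow> rep_l2 (mulop (\<lambda>_. c) y) x = c *s a + ccross (cvec x) (c *s b)"
    using rep_l2_simps(4)[of "\<lambda>_. c" y, OF essbdd_simps(1)] 1 by eventually_elim (auto simp: ccross_simps)
  then show ?thesis unfolding edge_on_def by blast
qed

lemma edge_on_conj: assumes "edge_on T y" shows "edge_on T (conj_l2 y)"
proof -
  obtain a b where 1: "AE x in lebesgue. x \<in> T \<longrightarrow> rep_l2 y x = a + ccross (cvec x) b"
    using assms(1) by (auto simp: edge_on_def)
  have "AE x in lebesgue. x \<in> T \<longrightarrow> rep_l2 (conj_l2 y) x = vcnj a + ccross (cvec x) (vcnj b)"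
    using rep_l2_simps(3)[of y] 1 by eventually_elim (auto simp: vcnj_ccross_cvec)
  then show ?thesis unfolding edge_on_def by blast
qed

lemma mulop_of_real: "mulop (\<lambda>_. complex_of_real r) y = r *\<^sub>R y"
proof (cases y rule: abs_l2_cases)
  case (1 v)
  have "complex_of_real r *s v x = r *\<^sub>R v x" for x
    by (simp add: vec_eq_iff scaleR_conv_of_real[where 'a = complex])
  then show ?thesis using 1 by (simp add: mulop_abs abs_l2_simps)
qed

lemma subspace_edge_on: "subspace {y. edge_on T y}"
  unfolding subspace_def
proof (intro conjI ballI allI)
  have "AE x in lebesgue. x \<in> T \<longrightarrow> rep_l2 0 x = 0 + ccross (cvec x) 0"
    using rep_l2_simps(5) by eventually_elim (simp add: ccross_simps)
  then show "0 \<in> {y. edge_on T y}" unfolding edge_on_def by blast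
next
  fix c :: real and y assume "y \<in> {y. edge_on T y}"
  then show "c *\<^sub>R y \<in> {y. edge_on T y}" using edge_on_mulop[of T y "complex_of_real c"] by (simp add: mulop_of_real)
qed (auto intro: edge_on_add)

lemma l2_tendsto_AE_subseq:
  assumes "Y \<longlonglongrightarrow> y"
  obtains r :: "nat \<Rightarrow> nat" where "strict_mono r" "AE x in lebesgue. (\<lambda>n. rep_l2 (Y (r n)) x) \<longlonglongrightarrow> rep_l2 y x"
proof -
  have sq: "sqint (\<lambda>x. rep_l2 (Y n) x - rep_l2 y x)" for n by (intro sqint_diff sqint_rep)
  have int: "integrable lebesgue (\<lambda>x. (norm (rep_l2 (Y n) x - rep_l2 y x))\<^sup>2)" for n
    using sq[of n] by (simp add: sqint_def)
  have eq: "(LINT x|lebesgue. norm ((norm (rep_l2 (Y n) x - rep_l2 y x))\<^sup>2)) = (norm (Y n - y))\<^sup>2" for n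
    using norm_abs_l2[OF sq[of n]] abs_l2_simps(2)[of "rep_l2 (Y n)" "rep_l2 y"] by simp
  have "(\<lambda>n. (norm (Y n - y))\<^sup>2) \<longlonglongrightarrow> (norm (y - y))\<^sup>2" by (intro tendsto_intros assms)
  then have "(\<lambda>n. LINT x|lebesgue. norm ((norm (rep_l2 (Y n) x - rep_l2 y x))\<^sup>2)) \<longlonglongrightarrow> 0" by (simp only: eq) simp
  from tendsto_L1_AE_subseq[OF int this]
  obtain r where r: "strict_mono r" "AE x in lebesgue. (\<lambda>n. (norm (rep_l2 (Y (r n)) x - rep_l2 y x))\<^sup>2) \<longlonglongrightarrow> 0" by blast
  have "AE x in lebesgue. (\<lambda>n. rep_l2 (Y (r n)) x) \<longlonglongrightarrow> rep_l2 y x"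
    using r(2)
  proof eventually_elim
    case (elim x)
    have "(\<lambda>n. sqrt ((norm (rep_l2 (Y (r n)) x - rep_l2 y x))\<^sup>2)) \<longlonglongrightarrow> sqrt 0" by (intro tendsto_intros elim)
    then have "(\<lambda>n. norm (rep_l2 (Y (r n)) x - rep_l2 y x)) \<longlonglongrightarrow> 0" by simp
    then show ?case by (rule LIM_zero_cancel[OF tendsto_norm_zero_cancel])
  qed
  then show ?thesis using r(1) that by blast
qed

text \<open>The points at which a sequence of fields \<open>a\<^sub>n + x \<times> b\<^sub>n\<close> converges form an affine
  set, which is the whole space as soon as it is not negligible.\<close>

lemma closed_edge_on: "closed {y. edge_on T y}"
  unfolding closed_sequential_limits
proof (intro allI impI, elim conjE)
  fix Y y assume Y: "\<forall>n. Y n \<in> {y. edge_on T y}" and lim: "Y \<longlonglongrightarrow> y"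
  obtain r :: "nat \<Rightarrow> nat" where r: "AE x in lebesgue. (\<lambda>n. rep_l2 (Y (r n)) x) \<longlonglongrightarrow> rep_l2 y x"
    using l2_tendsto_AE_subseq[OF lim] by blast
  have "\<forall>n. \<exists>a b. AE x in lebesgue. x \<in> T \<longrightarrow> rep_l2 (Y (r n)) x = a + ccross (cvec x) b"
    using Y by (simp add: edge_on_def)
  from choice[OF this]
  obtain a where "\<forall>n. \<exists>b. AE x in lebesgue. x \<in> T \<longrightarrow> rep_l2 (Y (r n)) x = a n + ccross (cvec x) b" ..
  from choice[OF this]
  obtain b where ab: "\<forall>n. AE x in lebesgue. x \<in> T \<longrightarrow> rep_l2 (Y (r n)) x = a n + ccross (cvec x) (b n)" ..
  define f where "f n x = a n + ccross (cvec x) (b n)" for n x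
  have "AE x in lebesgue. \<forall>n. x \<in> T \<longrightarrow> rep_l2 (Y (r n)) x = f n x"
    unfolding AE_all_countable f_def by (rule ab)
  then have conv: "AE x in lebesgue. x \<in> T \<longrightarrow> (\<lambda>n. f n x) \<longlonglongrightarrow> rep_l2 y x"
    using r by eventually_elim auto
  show "y \<in> {y. edge_on T y}"
  proof (cases "negligible T")
    case True
    then have "AE x in lebesgue. x \<notin> T" by (simp add: negligible_iff_null_sets AE_not_in)
    then have "AE x in lebesgue. x \<in> T \<longrightarrow> rep_l2 y x = 0 + ccross (cvec x) 0" by eventually_elim simp
    then show ?thesis unfolding edge_on_def by blast
  next
    case False
    define S where "S = {x. convergent (\<lambda>n. f n x)}"
    have aff: "affine S"
      unfolding affine_def
    proof (intro ballI allI impI)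
      fix x z :: "real^3" and s t :: real assume xz: "x \<in> S" "z \<in> S" and st: "s + t = 1"
      have e: "f n (s *\<^sub>R x + t *\<^sub>R z) = s *\<^sub>R f n x + t *\<^sub>R f n z" for n
      proof -
        have "a n = s *\<^sub>R a n + t *\<^sub>R a n" using st by (simp add: scaleR_add_left[symmetric])
        then show ?thesis by (simp add: f_def cvec_simps ccross_simps algebra_simps)
      qed
      show "s *\<^sub>R x + t *\<^sub>R z \<in> S"
      proof -
        obtain k l where "(\<lambda>n. f n x) \<longlonglongrightarrow> k" "(\<lambda>n. f n z) \<longlonglongrightarrow> l"
          using xz unfolding S_def convergent_def by blast
        then have "(\<lambda>n. f n (s *\<^sub>R x + t *\<^sub>R z)) \<longlonglongrightarrow> s *\<^sub>R k + t *\<^sub>R l"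
          unfolding e by (intro tendsto_intros)
        then show ?thesis unfolding S_def convergent_def by blast
      qed
    qed
    have "AE x in lebesgue. x \<in> T \<longrightarrow> x \<in> S"
      using conv by eventually_elim (auto simp: S_def convergent_def)
    then obtain N where N: "N \<in> null_sets lebesgue" "{x \<in> space lebesgue. \<not> (x \<in> T \<longrightarrow> x \<in> S)} \<subseteq> N"
      unfolding eventually_ae_filter by blast
    have "T \<subseteq> N \<union> S" using N(2) by auto
    moreover have "negligible N" using N(1) by (simp add: negligible_iff_null_sets)
    ultimately have "\<not> negligible S" using False negligible_subset negligible_Un by blast
    then have "interior S \<noteq> {}" using negligible_convex_interior[OF affine_imp_convex[OF aff]] by simp
    then have "S = UNIV" using affine_hull_nonempty_interior[of S] affine_hull_eq[of S] aff by simp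
    then have cv: "convergent (\<lambda>n. f n x)" for x by (auto simp: S_def)
    have "convergent a" using cv[of 0] by (simp add: f_def cvec_simps ccross_simps)
    then obtain a' where a': "a \<longlonglongrightarrow> a'" by (auto simp: convergent_def)
    have cb: "convergent (\<lambda>n. ccross (cvec x) (b n) $ i)" for x i
    proof -
      obtain l where "(\<lambda>n. f n x) \<longlonglongrightarrow> l" using cv[of x] by (auto simp: convergent_def)
      then have "(\<lambda>n. (f n x - a n) $ i) \<longlonglongrightarrow> (l - a') $ i" by (intro tendsto_intros a')
      then show ?thesis by (auto simp: f_def convergent_def)
    qed
    have ax: "cvec (axis k 1) $ i = (if i = k then 1 else 0)" for i k by (simp add: cvec_def axis_def)
    \<comment> \<open>Each component of \<open>b n\<close> is a component of the cross product of a
      unit vector with \<open>b n\<close>, and these have just been shown to converge.\<close>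
    have "convergent (\<lambda>n. b n $ 1)" "convergent (\<lambda>n. b n $ 2)" "convergent (\<lambda>n. b n $ 3)"
      using cb[of "axis 3 1" 2] cb[of "axis 1 1" 3] cb[of "axis 2 1" 1] by (simp_all add: ccross_nth ax)
    then have "\<forall>i. convergent (\<lambda>n. b n $ i)" by (simp add: forall_3)
    then obtain b' where b'': "\<And>i. (\<lambda>n. b n $ i) \<longlonglongrightarrow> b' i" unfolding convergent_def by metis
    then have b': "b \<longlonglongrightarrow> (\<chi> i. b' i)" by (intro vec_tendstoI) simp
    have L: "(\<lambda>n. f n x) \<longlonglongrightarrow> a' + ccross (cvec x) (\<chi> i. b' i)" for x
    proof (rule vec_tendstoI)
      have "\<forall>i. (\<lambda>n. f n x $ i) \<longlonglongrightarrow> (a' + ccross (cvec x) (\<chi> i. b' i)) $ i"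
        unfolding forall_3 f_def by (simp add: ccross_nth) (intro conjI tendsto_intros a' b'')
      then show "(\<lambda>n. f n x $ i) \<longlonglongrightarrow> (a' + ccross (cvec x) (\<chi> i. b' i)) $ i" for i by blast
    qed
    have "AE x in lebesgue. x \<in> T \<longrightarrow> rep_l2 y x = a' + ccross (cvec x) (\<chi> i. b' i)"
      using conv by eventually_elim (use L LIMSEQ_unique in blast)
    then show ?thesis unfolding edge_on_def by blast
  qed
qed

definition nedelec_graph :: "(real^3) set \<Rightarrow> (real^3) set set \<Rightarrow> (l2 \<times> l2) set" where
  "nedelec_graph G M = weak_graph G \<inter> {p. \<forall>T\<in>M. edge_on T (fst p)}"

text \<open>An element may touch the boundary of \<open>G\<close>, where extension by zero alters
  the field; there the negligible frontier comes in. Elsewhere on \<open>T\<close> the class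
  represents \<open>w\<close> itself.\<close>

lemma edge_on_cls_iff:
  assumes G: "open G" "negligible (frontier G)" and T: "compact T" "T \<subseteq> closure G" and w: "L2 G w"
  shows "edge_on T (cls G w) \<longleftrightarrow>
    (\<exists>a b. AE x in lebesgue_on T. w x = a + ccross (\<chi> i. complex_of_real (x $ i)) b)"
proof -
  have Gm: "G \<in> sets lebesgue" using G by simp
  have Tm: "T \<in> sets lebesgue" using T(1) by (simp add: lmeasurable_compact fmeasurableD)
  have "AE x in lebesgue. x \<notin> frontier G" using G(2) by (simp add: negligible_iff_null_sets AE_not_in)
  moreover have "AE x in lebesgue. rep_l2 (cls G w) x = ext0 G w x"
    unfolding cls_def using w by (intro rep_abs_l2) (simp add: L2_iff_sqint[OF Gm])
  ultimately have eq: "AE x in lebesgue. x \<in> T \<longrightarrow> rep_l2 (cls G w) x = w x"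
    by eventually_elim (use T(2) G(1) in \<open>auto simp: ext0_def frontier_def interior_open\<close>)
  have "(AE x in lebesgue. x \<in> T \<longrightarrow> rep_l2 (cls G w) x = a + ccross (cvec x) b)
      \<longleftrightarrow> (AE x in lebesgue. x \<in> T \<longrightarrow> w x = a + ccross (cvec x) b)" for a b
    by (rule eventually_cong[OF eq]) auto
  then show ?thesis by (simp add: edge_on_def AE_lebesgue_on[OF Tm] cvec_def)
qed

lemma nedelec_iff_graph:
  assumes G: "open G" "bounded G" "negligible (frontier G)" and M: "\<And>T. T \<in> M \<Longrightarrow> compact T \<and> T \<subseteq> closure G"
    and w: "w \<in> H0curl G"
  shows "w \<in> nedelec G M \<longleftrightarrow> graph_emb G w \<in> nedelec_graph G M"
proof -
  have "edge_on T (cls G w) \<longleftrightarrow> (\<exists>a b. AE x in lebesgue_on T. w x = a + ccross (\<chi> i. complex_of_real (x $ i)) b)"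
    if "T \<in> M" for T
    using M[OF that] by (intro edge_on_cls_iff[OF G(1,3) _ _ H0curl_L2(1)[OF w]]) auto
  then show ?thesis using graph_emb_H0curl[OF G(1,2) w] w by (simp add: nedelec_def nedelec_graph_def graph_emb_def)
qed

lemma nedelec_graph_closed_subspace:
  assumes G: "open G" "bounded G" shows "subspace (nedelec_graph G M)" "closed (nedelec_graph G M)"
proof -
  have s: "subspace {p :: l2 \<times> l2. \<forall>T\<in>M. edge_on T (fst p)}"
    using subspace_edge_on unfolding subspace_def by auto
  show "subspace (nedelec_graph G M)"
    unfolding nedelec_graph_def by (rule subspace_inter[OF subspace_weak_graph[OF G] s])
  have "{p :: l2 \<times> l2. \<forall>T\<in>M. edge_on T (fst p)} = (\<Inter>T\<in>M. fst -` {y. edge_on T y})" by auto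
  moreover have "closed (\<Inter>T\<in>M. fst -` {y. edge_on T y} :: (l2 \<times> l2) set)"
    by (intro closed_INT ballI closed_vimage_fst closed_edge_on)
  ultimately have "closed {p :: l2 \<times> l2. \<forall>T\<in>M. edge_on T (fst p)}" by (simp only:)
  then show "closed (nedelec_graph G M)"
    unfolding nedelec_graph_def by (rule closed_Int[OF closed_weak_graph[OF G]])
qed

lemma nedelec_graph_invariant:
  assumes G: "open G" "bounded G" and p: "p \<in> nedelec_graph G M"
  shows "pscale c p \<in> nedelec_graph G M" "pconj p \<in> nedelec_graph G M"
  using p pscale_weak_graph[OF G] pconj_weak_graph[OF G] edge_on_mulop edge_on_conj
  by (auto simp: nedelec_graph_def pscale_def pconj_def)


section \<open>Coercivity of the Maxwell form\<close>

definition curl_op :: "('l::finite) control_data \<Rightarrow> l2 \<times> l2 \<Rightarrow> l2 \<times> l2" where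
  "curl_op D p = (0, mulop (ext0 (Dom D) (\<lambda>x. complex_of_real (inverse (perm D x)))) (snd p))"

definition mass_op :: "('l::finite) control_data \<Rightarrow> 'l \<Rightarrow> l2 \<times> l2 \<Rightarrow> l2 \<times> l2" where
  "mass_op D k p = (- ((freq D)\<^sup>2 *\<^sub>R mulop (ext0 (Part D k) (eps_sigma D)) (fst p)), 0)"

text \<open>Half the lower bounds put the admissible box into the interior, where derivatives can be
  taken, and still keep all components uniformly positive, as coercivity demands.\<close>

definition param_set :: "('l::finite) control_data \<Rightarrow> (real^'l) set" where
  "param_set D = {z. \<forall>k. lower D $ k / 2 \<le> z $ k}"

definition desired :: "('l::finite) control_data \<Rightarrow> l2 \<times> l2" where
  "desired D = (cls (Dom D) (ydes D), cls (Dom D) (Edes D))"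

lemma bounded_linear_pscale: "bounded_linear (pscale c)"
  unfolding pscale_def[abs_def]
  by (intro bounded_linear_Pair bounded_linear_compose[OF bounded_linear_mulop] bounded_linear_fst bounded_linear_snd)

lemma bounded_linear_pconj: "bounded_linear pconj"
  unfolding pconj_def[abs_def]
  by (intro bounded_linear_Pair bounded_linear_compose[OF bounded_linear_conj] bounded_linear_fst bounded_linear_snd)

lemma bounded_linear_curl_op: "bounded_linear (curl_op D)"
  unfolding curl_op_def[abs_def]
  by (intro bounded_linear_Pair bounded_linear_compose[OF bounded_linear_mulop] bounded_linear_snd bounded_linear_zero)

lemma bounded_linear_mass_op: "bounded_linear (mass_op D k)"
  unfolding mass_op_def[abs_def]
  by (intro bounded_linear_Pair bounded_linear_minus bounded_linear_compose[OF bounded_linear_scaleR_right]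
      bounded_linear_compose[OF bounded_linear_mulop] bounded_linear_fst bounded_linear_zero)

lemma pscale_adjoint: "x \<bullet> pscale c y = pscale (cnj c) x \<bullet> y"
  using mulop_adjoint[of "\<lambda>_. cnj c"] by (simp add: pscale_def inner_prod_def)

text \<open>Both sides are the real part of the integral of \<open>m\<close> times the product of
  the two fields without conjugation.\<close>

lemma mulop_conj_sym: "essbdd m \<Longrightarrow> mulop m y \<bullet> conj_l2 z = mulop m z \<bullet> conj_l2 y"
proof -
  assume m: "essbdd m"
  have "mulop m y \<bullet> conj_l2 z = y \<bullet> conj_l2 (mulop m z)" by (simp add: mulop_adjoint m conj_mulop)
  also have "\<dots> = conj_l2 y \<bullet> mulop m z" using conj_inner[of "conj_l2 y" "mulop m z"] by simp
  finally show ?thesis by (simp add: inner_commute)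
qed

lemma mulop_inner_self:
  assumes m: "essbdd m" and v: "sqint v"
  shows "mulop m (abs_l2 v) \<bullet> abs_l2 v = (LINT x|lebesgue. Re (m x) * (norm (v x))\<^sup>2)"
    "integrable lebesgue (\<lambda>x. Re (m x) * (norm (v x))\<^sup>2)"
proof -
  have e: "(c *s w) \<bullet> w = Re c * (norm w)\<^sup>2" for c :: complex and w :: "complex^3"
    by (simp add: power2_norm_eq_inner inner_vec_def inner_complex_def sum_distrib_left algebra_simps)
  show "mulop m (abs_l2 v) \<bullet> abs_l2 v = (LINT x|lebesgue. Re (m x) * (norm (v x))\<^sup>2)"
    using m v by (simp add: mulop_abs abs_l2_simps sqint_smult e)
  show "integrable lebesgue (\<lambda>x. Re (m x) * (norm (v x))\<^sup>2)"
    using sqint_inner[OF sqint_smult[OF m v] v] by (simp add: e)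
qed

text \<open>On the diagonal only the real part of a multiplier contributes to the real inner
  product.\<close>

lemma mulop_inner_mono:
  assumes "essbdd m" "essbdd m'" and le: "AE x in lebesgue. Re (m x) \<le> Re (m' x)"
  shows "mulop m y \<bullet> y \<le> mulop m' y \<bullet> y"
proof (cases y rule: abs_l2_cases)
  case (1 v)
  have "(LINT x|lebesgue. Re (m x) * (norm (v x))\<^sup>2) \<le> (LINT x|lebesgue. Re (m' x) * (norm (v x))\<^sup>2)"
    using le by (intro integral_mono_AE mulop_inner_self(2) assms 1) (auto elim!: eventually_mono intro: mult_right_mono)
  then show ?thesis using 1 assms by (simp add: mulop_inner_self)
qed

lemma mulop_inner_scale: "essbdd m \<Longrightarrow> mulop m y \<bullet> mulop (\<lambda>_. c) y = mulop (\<lambda>x. cnj c * m x) y \<bullet> y"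
  using mulop_adjoint[of "\<lambda>_. cnj c" "mulop m y" y] by (simp add: mulop_mulop)

lemma mulop_scaleR: "essbdd m \<Longrightarrow> r *\<^sub>R mulop m y = mulop (\<lambda>x. complex_of_real r * m x) y"
  by (simp add: mulop_of_real[symmetric] mulop_mulop)

context
  fixes D :: "('l::finite) control_data" assumes data: "admissible_data D"
begin

lemma Dom_sets: "open (Dom D)" "bounded (Dom D)" "Dom D \<in> sets lebesgue"
  and Part_sets: "Part D k \<in> sets lebesgue" "Part D k \<subseteq> Dom D"
  and Part_disjoint: "k \<noteq> m \<Longrightarrow> Part D k \<inter> Part D m = {}"
  and freq_pos: "0 < freq D"
  using data by (auto simp: admissible_data_def subdomain_def)

text \<open>A polygon in space is convex with empty interior, hence a null set. This makes the
  values of fields on the boundary irrelevant for mesh elements.\<close>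

lemma frontier_negligible: "negligible (frontier (Dom D))"
proof -
  obtain F where F: "finite F" "\<And>P. P \<in> F \<Longrightarrow> polytope P \<and> aff_dim P = 2" "frontier (Dom D) = \<Union>F"
    using data by (auto simp: admissible_data_def polyhedral_boundary_def)
  have "negligible P" if "P \<in> F" for P
  proof -
    have "interior P = {}"
      using F(2)[OF that] aff_dim_nonempty_interior[of P] by auto
    then show ?thesis using F(2)[OF that] negligible_convex_interior polytope_imp_convex by blast
  qed
  then show ?thesis using F(1,3) by (auto intro: negligible_Union)
qed

lemma essbdd_inverse_perm: "essbdd (ext0 (Dom D) (\<lambda>x. complex_of_real (inverse (perm D x))))"
proof (rule essbdd_ext0[OF Dom_sets(3)])
  obtain \<mu> where \<mu>: "0 < \<mu>" "AE x in lebesgue_on (Dom D). \<mu> \<le> perm D x" using data by (auto simp: admissible_data_def)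
  have [measurable]: "perm D \<in> borel_measurable (lebesgue_on (Dom D))" using data by (simp add: admissible_data_def Linf_def)
  have "AE x in lebesgue_on (Dom D). norm (complex_of_real (inverse (perm D x))) \<le> inverse \<mu>"
    using \<mu>(2) by eventually_elim (use \<mu>(1) in \<open>simp add: norm_inverse\<close>)
  moreover have "(\<lambda>x. complex_of_real (inverse (perm D x))) \<in> borel_measurable (lebesgue_on (Dom D))" by measurable
  ultimately show "Linf (Dom D) (\<lambda>x. complex_of_real (inverse (perm D x)))" unfolding Linf_def by blast
qed

lemma Linf_eps_sigma: "Linf (Dom D) (eps_sigma D)"
proof -
  obtain B B' where B: "AE x in lebesgue_on (Dom D). norm (epsil D x) \<le> B" "AE x in lebesgue_on (Dom D). norm (conduc D x) \<le> B'"
    using data by (auto simp: admissible_data_def Linf_def)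
  have [measurable]: "epsil D \<in> borel_measurable (lebesgue_on (Dom D))" "conduc D \<in> borel_measurable (lebesgue_on (Dom D))"
    using data by (simp_all add: admissible_data_def Linf_def)
  have "(\<lambda>x. complex_of_real (epsil D x) + \<i> * complex_of_real (conduc D x / freq D)) \<in> borel_measurable (lebesgue_on (Dom D))"
    by measurable
  moreover have "AE x in lebesgue_on (Dom D). cmod (eps_sigma D x) \<le> B + B' / freq D"
    using B
  proof eventually_elim
    case (elim x)
    have "cmod (eps_sigma D x) \<le> \<bar>epsil D x\<bar> + \<bar>conduc D x\<bar> / freq D"
      unfolding eps_sigma_def using freq_pos
      by (intro order_trans[OF norm_triangle_ineq]) (simp add: norm_mult norm_divide)
    also have "\<dots> \<le> B + B' / freq D" using elim freq_pos by (intro add_mono divide_right_mono) auto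
    finally show ?case .
  qed
  ultimately show ?thesis by (auto simp: Linf_def eps_sigma_def[abs_def])
qed

lemma essbdd_Part: assumes "Linf (Dom D) m" shows "essbdd (ext0 (Part D k) m)"
proof -
  have "ext0 (Part D k) m = (\<lambda>x. ext0 (Part D k) (\<lambda>_. 1) x * ext0 (Dom D) m x)"
    using Part_sets(2)[of k] by (intro ext) (auto simp: ext0_def)
  then show ?thesis using essbdd_one[OF Part_sets(1)] essbdd_ext0[OF Dom_sets(3) assms] by simp
qed

lemmas essbdd_eps = essbdd_Part[OF Linf_eps_sigma]

text \<open>Almost every point of the domain lies in exactly one part, so the cutoffs to the parts
  add up to the cutoff to the domain; \<open>y\<close> vanishes outside the domain.\<close>

lemma Part_sum:
  assumes y: "mulop (ext0 (Dom D) (\<lambda>_. 1)) y = y"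
  shows "(\<Sum>k\<in>UNIV. mulop (ext0 (Part D k) (\<lambda>_. 1)) y \<bullet> y) = (norm y)\<^sup>2"
proof (cases y rule: abs_l2_cases)
  case (1 v)
  have e: "essbdd (ext0 (Part D k) (\<lambda>_. 1))" "essbdd (ext0 (Dom D) (\<lambda>_. 1))" for k
    by (rule essbdd_one[OF Part_sets(1)], rule essbdd_one[OF Dom_sets(3)])
  have "negligible (Dom D - (\<Union>k. Part D k))" using data by (simp add: admissible_data_def)
  then have "AE x in lebesgue. x \<notin> Dom D - (\<Union>k. Part D k)" unfolding negligible_iff_null_sets by (rule AE_not_in)
  then have ae: "AE x in lebesgue. (\<Sum>k\<in>UNIV. Re (ext0 (Part D k) (\<lambda>_. 1) x) * (norm (v x))\<^sup>2)
      = Re (ext0 (Dom D) (\<lambda>_. 1) x) * (norm (v x))\<^sup>2"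
  proof eventually_elim
    case (elim x)
    show ?case
    proof (cases "x \<in> Dom D")
      case True
      then obtain m where m: "x \<in> Part D m" using elim by auto
      have "x \<in> Part D k \<longleftrightarrow> k = m" for k using m Part_disjoint[of k m] by blast
      then show ?thesis using True by (simp add: ext0_def if_distrib[of Re] if_distrib[of "\<lambda>a. a * _"] cong: if_cong)
    next
      case False
      then have "x \<notin> Part D k" for k using Part_sets(2) by blast
      then show ?thesis using False by (simp add: ext0_def)
    qed
  qed
  have "(\<Sum>k\<in>UNIV. mulop (ext0 (Part D k) (\<lambda>_. 1)) y \<bullet> y)
      = (LINT x|lebesgue. (\<Sum>k\<in>UNIV. Re (ext0 (Part D k) (\<lambda>_. 1) x) * (norm (v x))\<^sup>2))"
    unfolding 1(2) mulop_inner_self(1)[OF e(1) 1(1)]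
    by (rule Bochner_Integration.integral_sum[symmetric]) (rule mulop_inner_self(2)[OF e(1) 1(1)])
  also have "\<dots> = (LINT x|lebesgue. Re (ext0 (Dom D) (\<lambda>_. 1) x) * (norm (v x))\<^sup>2)"
    using ae by (intro integral_cong_AE borel_measurable_integrable Bochner_Integration.integrable_sum mulop_inner_self(2)[OF e(1) 1(1)] mulop_inner_self(2)[OF e(2) 1(1)])
  also have "\<dots> = mulop (ext0 (Dom D) (\<lambda>_. 1)) y \<bullet> y"
    unfolding 1(2) by (rule mulop_inner_self(1)[OF e(2) 1(1), symmetric])
  finally show ?thesis by (simp add: y power2_norm_eq_inner)
qed

text \<open>Since \<open>Im \<epsilon>\<^sub>\<sigma>\<close> is bounded below, testing with \<open>(1 - \<i> \<theta>) y\<close> for large \<open>\<theta>\<close> makes the indefinite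
  form coercive.\<close>

lemma coercive_maxwell:
  obtains \<theta> c where "0 < c"
    "\<And>z p. z \<in> param_set D \<Longrightarrow> p \<in> weak_graph (Dom D) \<Longrightarrow>
      c * (norm p)\<^sup>2 \<le> (curl_op D p + (\<Sum>k\<in>UNIV. (z $ k) *\<^sub>R mass_op D k p)) \<bullet> pscale (Complex 1 (- \<theta>)) p"
proof -
  obtain Bm where Bm: "AE x in lebesgue_on (Dom D). norm (perm D x) \<le> Bm" using data by (auto simp: admissible_data_def Linf_def)
  obtain \<mu> where \<mu>: "0 < \<mu>" "AE x in lebesgue_on (Dom D). \<mu> \<le> perm D x" using data by (auto simp: admissible_data_def)
  obtain Be where Be: "AE x in lebesgue_on (Dom D). norm (epsil D x) \<le> Be" using data by (auto simp: admissible_data_def Linf_def)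
  obtain s0 where s0: "0 < s0" "AE x in lebesgue_on (Dom D). s0 \<le> conduc D x" using data by (auto simp: admissible_data_def)
  define \<omega> where "\<omega> = freq D"
  have \<omega>: "0 < \<omega>" using freq_pos by (simp add: \<omega>_def)
  \<comment> \<open>Chosen so that \<open>\<theta> * s0 / \<omega> = \<bar>Be\<bar> + 1\<close>:
    then \<open>\<theta>\<close> times the imaginary part of \<open>eps_sigma D\<close> exceeds its
    real part by at least \<open>1\<close>.\<close>
  define \<theta> where "\<theta> = \<omega> * (\<bar>Be\<bar> + 1) / s0"
  define b where "b = Complex 1 (- \<theta>)"
  \<comment> \<open>\<open>c1\<close> bounds the inverse permeability from below, and
    \<open>l\<close> next to it bounds all components of all parameters from below.\<close>
  define c1 where "c1 = inverse (\<bar>Bm\<bar> + 1)"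
  define l where "l = Min (range (\<lambda>k. lower D $ k / 2))"
  have l: "0 < l" using data by (auto simp: l_def admissible_data_def)
  have l_le: "l \<le> lower D $ k / 2" for k unfolding l_def by (rule Min_le) auto
  define c where "c = min c1 (l * \<omega>\<^sup>2)"
  have c: "0 < c" "c \<le> c1" "c \<le> l * \<omega>\<^sup>2" using l \<omega> by (auto simp: c_def c1_def)
  note one = essbdd_one[OF Part_sets(1)] essbdd_one[OF Dom_sets(3)]
  \<comment> \<open>The multiplier of the curl part is real, so only the real part \<open>1\<close>
    of \<open>b\<close> matters and large \<open>\<theta>\<close> does no damage here.\<close>
  have curl: "c1 * (norm y)\<^sup>2 \<le> mulop (ext0 (Dom D) (\<lambda>x. complex_of_real (inverse (perm D x)))) y \<bullet> mulop (\<lambda>_. b) y"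
    if y: "mulop (ext0 (Dom D) (\<lambda>_. 1)) y = y" for y
  proof -
    have "c1 * (norm y)\<^sup>2 = mulop (\<lambda>x. complex_of_real c1 * ext0 (Dom D) (\<lambda>_. 1) x) y \<bullet> y"
      using y by (simp add: mulop_scaleR[symmetric] one power2_norm_eq_inner)
    also have "\<dots> \<le> mulop (\<lambda>x. cnj b * ext0 (Dom D) (\<lambda>x. complex_of_real (inverse (perm D x))) x) y \<bullet> y"
    proof (rule mulop_inner_mono)
      show "AE x in lebesgue. Re (complex_of_real c1 * ext0 (Dom D) (\<lambda>_. 1) x)
          \<le> Re (cnj b * ext0 (Dom D) (\<lambda>x. complex_of_real (inverse (perm D x))) x)"
        using Bm[unfolded AE_lebesgue_on[OF Dom_sets(3)]] \<mu>(2)[unfolded AE_lebesgue_on[OF Dom_sets(3)]]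
      proof eventually_elim
        case (elim x)
        have "c1 \<le> inverse (perm D x)" if "x \<in> Dom D"
          using elim that \<mu>(1) unfolding c1_def by (intro le_imp_inverse_le) auto
        moreover have "Re b = 1" by (simp add: b_def)
        ultimately show ?case by (simp add: ext0_def del: of_real_inverse)
      qed
    qed (intro essbdd_simps one essbdd_inverse_perm)+
    also have "\<dots> = mulop (ext0 (Dom D) (\<lambda>x. complex_of_real (inverse (perm D x)))) y \<bullet> mulop (\<lambda>_. b) y"
      by (rule mulop_inner_scale[OF essbdd_inverse_perm, symmetric])
    finally show ?thesis .
  qed
  have mass: "\<omega>\<^sup>2 * (mulop (ext0 (Part D k) (\<lambda>_. 1)) y \<bullet> y)
      \<le> - (\<omega>\<^sup>2 *\<^sub>R mulop (ext0 (Part D k) (eps_sigma D)) y) \<bullet> mulop (\<lambda>_. b) y" for y k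
  proof -
    have "\<omega>\<^sup>2 * (mulop (ext0 (Part D k) (\<lambda>_. 1)) y \<bullet> y) = mulop (\<lambda>x. complex_of_real (\<omega>\<^sup>2) * ext0 (Part D k) (\<lambda>_. 1) x) y \<bullet> y"
      by (simp add: mulop_scaleR[symmetric] one del: of_real_power)
    also have "\<dots> \<le> mulop (\<lambda>x. complex_of_real (- (\<omega>\<^sup>2)) * (cnj b * ext0 (Part D k) (eps_sigma D) x)) y \<bullet> y"
    proof (rule mulop_inner_mono)
      show "AE x in lebesgue. Re (complex_of_real (\<omega>\<^sup>2) * ext0 (Part D k) (\<lambda>_. 1) x)
          \<le> Re (complex_of_real (- (\<omega>\<^sup>2)) * (cnj b * ext0 (Part D k) (eps_sigma D) x))"
        using Be[unfolded AE_lebesgue_on[OF Dom_sets(3)]] s0(2)[unfolded AE_lebesgue_on[OF Dom_sets(3)]]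
      proof eventually_elim
        case (elim x)
        have "1 \<le> - Re (cnj b * eps_sigma D x)" if "x \<in> Part D k"
        proof -
          have x: "\<bar>epsil D x\<bar> \<le> Be" "s0 \<le> conduc D x" using elim that Part_sets(2) by auto
          have "\<bar>Be\<bar> + 1 = \<theta> * s0 / \<omega>" using s0(1) \<omega> by (simp add: \<theta>_def)
          also have "\<dots> \<le> \<theta> * conduc D x / \<omega>"
            using x s0(1) \<omega> by (intro divide_right_mono mult_left_mono) (auto simp: \<theta>_def)
          finally show ?thesis using x(1) by (simp add: eps_sigma_def b_def \<omega>_def[symmetric])
        qed
        then have "\<omega>\<^sup>2 * 1 \<le> \<omega>\<^sup>2 * (- Re (cnj b * eps_sigma D x))" if "x \<in> Part D k"
          using that by (intro mult_left_mono) auto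
        then show ?case by (auto simp: ext0_def algebra_simps simp del: of_real_power)
      qed
    qed (intro essbdd_simps one essbdd_eps)+
    also have "\<dots> = - (\<omega>\<^sup>2 *\<^sub>R mulop (ext0 (Part D k) (eps_sigma D)) y) \<bullet> mulop (\<lambda>_. b) y"
    proof -
      have "mulop (\<lambda>x. complex_of_real (- (\<omega>\<^sup>2)) * (cnj b * ext0 (Part D k) (eps_sigma D) x)) y
          = (- (\<omega>\<^sup>2)) *\<^sub>R mulop (\<lambda>x. cnj b * ext0 (Part D k) (eps_sigma D) x) y"
        by (rule mulop_scaleR[symmetric]) (intro essbdd_simps essbdd_eps)
      then show ?thesis by (simp only:) (simp add: mulop_inner_scale essbdd_eps)
    qed
    finally show ?thesis .
  qed
  have "c * (norm p)\<^sup>2 \<le> (curl_op D p + (\<Sum>k\<in>UNIV. (z $ k) *\<^sub>R mass_op D k p)) \<bullet> pscale b p"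
    if z: "z \<in> param_set D" and p: "p \<in> weak_graph (Dom D)" for z p
  proof -
    have r: "mulop (ext0 (Dom D) (\<lambda>_. 1)) (fst p) = fst p" "mulop (ext0 (Dom D) (\<lambda>_. 1)) (snd p) = snd p"
      using p by (auto simp: weak_graph_def)
    define N where "N k = mulop (ext0 (Part D k) (\<lambda>_. 1)) (fst p) \<bullet> fst p" for k
    have N: "0 \<le> N k" for k
    proof -
      have "mulop (\<lambda>_. 0) (fst p) \<bullet> fst p \<le> N k"
        unfolding N_def by (rule mulop_inner_mono) (auto simp: ext0_def one)
      then show ?thesis using mulop_of_real[of 0 "fst p"] by simp
    qed
    have sumN: "(\<Sum>k\<in>UNIV. N k) = (norm (fst p))\<^sup>2" unfolding N_def by (rule Part_sum[OF r(1)])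
    have "c * (norm p)\<^sup>2 = c * (norm (fst p))\<^sup>2 + c * (norm (snd p))\<^sup>2"
      by (simp add: norm_prod_def algebra_simps)
    also have "\<dots> \<le> l * \<omega>\<^sup>2 * (norm (fst p))\<^sup>2 + c1 * (norm (snd p))\<^sup>2"
      by (intro add_mono mult_right_mono c) auto
    also have "l * \<omega>\<^sup>2 * (norm (fst p))\<^sup>2 = (\<Sum>k\<in>UNIV. l * (\<omega>\<^sup>2 * N k))"
      by (simp add: sumN[symmetric] sum_distrib_left mult.assoc)
    also have "\<dots> \<le> (\<Sum>k\<in>UNIV. z $ k * (mass_op D k p \<bullet> pscale b p))"
    proof (rule sum_mono)
      fix k
      have "mass_op D k p \<bullet> pscale b p = - (\<omega>\<^sup>2 *\<^sub>R mulop (ext0 (Part D k) (eps_sigma D)) (fst p)) \<bullet> mulop (\<lambda>_. b) (fst p)"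
        by (simp add: mass_op_def pscale_def inner_prod_def \<omega>_def)
      then have "\<omega>\<^sup>2 * N k \<le> mass_op D k p \<bullet> pscale b p" using mass[where y = "fst p"] by (simp add: N_def)
      moreover have "l \<le> z $ k" using l_le[of k] z[unfolded param_set_def, simplified, rule_format, of k] by linarith
      ultimately show "l * (\<omega>\<^sup>2 * N k) \<le> z $ k * (mass_op D k p \<bullet> pscale b p)"
        using l N[of k] by (intro mult_mono) auto
    qed
    also have "c1 * (norm (snd p))\<^sup>2 \<le> curl_op D p \<bullet> pscale b p"
      using curl[OF r(2)] by (simp add: curl_op_def pscale_def inner_prod_def)
    finally show ?thesis by (simp add: inner_add_left inner_sum_left)
  qed
  then show ?thesis unfolding b_def by (rule that[OF c(1)])
qed

lemma tracking_family_maxwell: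
  obtains \<theta> c KM KA where
    "tracking_family (curl_op D) (mass_op D) (pscale (Complex 1 (- \<theta>))) (pscale (Complex 1 \<theta>))
       (weak_graph (Dom D)) (param_set D) c KM KA pconj"
proof -
  obtain \<theta> c where c: "0 < c" and coer:
    "\<And>z p. z \<in> param_set D \<Longrightarrow> p \<in> weak_graph (Dom D) \<Longrightarrow>
      c * (norm p)\<^sup>2 \<le> (curl_op D p + (\<Sum>k\<in>UNIV. (z $ k) *\<^sub>R mass_op D k p)) \<bullet> pscale (Complex 1 (- \<theta>)) p"
    by (rule coercive_maxwell) blast
  obtain KM where KM: "0 < KM" "\<And>x. norm (pscale (Complex 1 (- \<theta>)) x) \<le> norm x * KM"
    using bounded_linear.pos_bounded[OF bounded_linear_pscale] by blast
  have "\<forall>k. \<exists>K>0. \<forall>x. norm (mass_op D k x) \<le> norm x * K"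
    using bounded_linear.pos_bounded[OF bounded_linear_mass_op] by blast
  then obtain K where K: "\<And>k. 0 < K k" "\<And>k x. norm (mass_op D k x) \<le> norm x * K k" by metis
  define KA where "KA = (\<Sum>k\<in>UNIV. K k)"
  have KA: "K k \<le> KA" for k unfolding KA_def using K(1) by (intro member_le_sum) (auto intro: less_imp_le)
  have KA0: "0 < KA" using KA[of undefined] K(1)[of undefined] by linarith
  have KA': "norm (mass_op D k x) \<le> KA * norm x" for k x
    using K(2)[of k x] mult_right_mono[OF KA[of k], of "norm x"] by (simp add: mult.commute)
  have "tracking_family (curl_op D) (mass_op D) (pscale (Complex 1 (- \<theta>))) (pscale (Complex 1 \<theta>))
       (weak_graph (Dom D)) (param_set D) c KM KA pconj"
  proof (intro tracking_family.intro affine_family.intro tracking_family_axioms.intro)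
    show "x \<bullet> pscale (Complex 1 (- \<theta>)) y = pscale (Complex 1 \<theta>) x \<bullet> y" for x y
      by (simp add: pscale_adjoint complex_cnj)
    show "pconj x \<bullet> pconj y = x \<bullet> y" for x y by (simp add: pconj_def inner_prod_def)
    show "curl_op D x \<bullet> pconj y = curl_op D y \<bullet> pconj x" for x y
      using mulop_conj_sym[OF essbdd_inverse_perm] by (simp add: curl_op_def pconj_def inner_prod_def)
    show "mass_op D k x \<bullet> pconj y = mass_op D k y \<bullet> pconj x" for k x y
      using mulop_conj_sym[OF essbdd_eps] by (simp add: mass_op_def pconj_def inner_prod_def)
    show "bounded_linear pconj" by (rule bounded_linear_pconj)
    show "norm (pscale (Complex 1 (- \<theta>)) x) \<le> KM * norm x" for x using KM(2)[of x] by (simp add: mult.commute)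
  qed (rule c coer KM(1) KA0 KA' bounded_linear_curl_op bounded_linear_mass_op bounded_linear_pscale | assumption)+
  then show ?thesis using that by blast
qed

end


section \<open>The control problem in the graph space\<close>

text \<open>Recovers the complex inner product from the real one: the imaginary part of a pairing is
  the real part of the pairing with \<open>\<i>\<close> times the second argument.\<close>

definition cpx :: "l2 \<times> l2 \<Rightarrow> l2 \<times> l2 \<Rightarrow> complex" where
  "cpx p q = Complex (p \<bullet> q) (p \<bullet> pscale \<i> q)"

lemma cpx_Pair: "cpx (a, b) q = cpx (a, 0) q + cpx (0, b) q"
  by (simp add: cpx_def inner_prod_def complex_eq_iff)

lemma L2inner_eq:
  assumes G: "G \<in> sets lebesgue" and v: "L2 G v" and w: "L2 G w"
  shows "L2inner G v w = Complex (cls G v \<bullet> cls G w) (cls G v \<bullet> mulop (\<lambda>_. \<i>) (cls G w))"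
proof -
  have wi: "L2 G (\<lambda>x. \<i> *s w x)"
    using L2_smult[OF G essbdd_ext0[OF G], of "\<lambda>_. \<i>"] w by (auto simp: Linf_def intro!: exI[of _ 1])
  have "L2inner G v (\<lambda>x. \<i> *s w x) = - \<i> * L2inner G v w"
    by (simp only: L2inner_def vcnj_simps cdot_simps complex_cnj_i integral_mult_right_zero)
  then have "Im (L2inner G v w) = Re (L2inner G v (\<lambda>x. \<i> *s w x))" by simp
  also have "\<dots> = cls G v \<bullet> mulop (\<lambda>_. \<i>) (cls G w)" by (simp add: Re_L2inner[OF G v wi] cls_scale[OF G w])
  finally show ?thesis using Re_L2inner[OF G v w] by (simp add: complex_eq_iff)
qed

lemma cpx_L2inner:
  assumes "open G" "w \<in> H0curl G"
  shows "L2 G v \<Longrightarrow> L2inner G v w = cpx (cls G v, 0) (graph_emb G w)"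
    "L2 G v \<Longrightarrow> L2inner G v (weak_curl G w) = cpx (0, cls G v) (graph_emb G w)"
  using assms H0curl_L2[OF assms(2)] by (simp_all add: L2inner_eq cpx_def graph_emb_def pscale_def inner_prod_def)

lemma abs_l2_sum:
  "finite I \<Longrightarrow> (\<And>i. i \<in> I \<Longrightarrow> sqint (v i)) \<Longrightarrow>
    sqint (\<lambda>x. \<Sum>i\<in>I. v i x) \<and> abs_l2 (\<lambda>x. \<Sum>i\<in>I. v i x) = (\<Sum>i\<in>I. abs_l2 (v i))"
proof (induction I rule: finite_induct)
  case empty then show ?case by (simp add: zero_l2.abs_eq)
next
  case (insert i I) then show ?case by (simp add: sqint_add abs_l2_simps[symmetric])
qed

lemma cls_eps_sigma_u:
  assumes data: "admissible_data D" and y: "L2 (Dom D) y"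
  shows "L2 (Dom D) (\<lambda>x. eps_sigma_u D z x *s y x)"
    "cls (Dom D) (\<lambda>x. eps_sigma_u D z x *s y x) = (\<Sum>k\<in>UNIV. (z $ k) *\<^sub>R mulop (ext0 (Part D k) (eps_sigma D)) (cls (Dom D) y))"
proof -
  note G = Dom_sets[OF data]
  let ?v = "\<lambda>k x. complex_of_real (z $ k) *s (ext0 (Part D k) (eps_sigma D) x *s ext0 (Dom D) y x)"
  have sy: "sqint (ext0 (Dom D) y)" using y by (simp add: L2_iff_sqint[OF G(3)])
  have sk: "sqint (\<lambda>x. ext0 (Part D k) (eps_sigma D) x *s ext0 (Dom D) y x)" for k
    by (rule sqint_smult[OF essbdd_eps[OF data] sy])
  have sv: "sqint (?v k)" for k by (rule sqint_smult[OF essbdd_simps(1) sk])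
  have eq: "ext0 (Dom D) (\<lambda>x. eps_sigma_u D z x *s y x) = (\<lambda>x. \<Sum>k\<in>UNIV. ?v k x)"
  proof
    fix x
    have "eps_sigma_u D z x = (\<Sum>k\<in>UNIV. complex_of_real (z $ k) * ext0 (Part D k) (eps_sigma D) x)"
      unfolding eps_sigma_u_def by (rule sum.mono_neutral_cong_left) (auto simp: ext0_def)
    then have "(\<Sum>k\<in>UNIV. ?v k x) = eps_sigma_u D z x *s ext0 (Dom D) y x"
      by (simp add: vec_eq_iff sum_distrib_right mult.assoc)
    then show "ext0 (Dom D) (\<lambda>x. eps_sigma_u D z x *s y x) x = (\<Sum>k\<in>UNIV. ?v k x)" by (simp add: ext0_def)
  qed
  show "L2 (Dom D) (\<lambda>x. eps_sigma_u D z x *s y x)"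
    unfolding L2_iff_sqint[OF G(3)] eq using abs_l2_sum[of UNIV ?v] sv by simp
  have "abs_l2 (?v k) = (z $ k) *\<^sub>R mulop (ext0 (Part D k) (eps_sigma D)) (cls (Dom D) y)" for k
    using mulop_abs[OF essbdd_simps(1) sk, of "complex_of_real (z $ k)" k]
    by (simp add: cls_def mulop_abs[OF essbdd_eps[OF data] sy] mulop_of_real)
  then show "cls (Dom D) (\<lambda>x. eps_sigma_u D z x *s y x)
      = (\<Sum>k\<in>UNIV. (z $ k) *\<^sub>R mulop (ext0 (Part D k) (eps_sigma D)) (cls (Dom D) y))"
    unfolding cls_def eq using abs_l2_sum[of UNIV ?v] sv by simp
qed

lemma scaleR_eq_smult: "r *\<^sub>R v = complex_of_real r *s (v :: complex^3)"
  by (simp add: vec_eq_iff scaleR_conv_of_real[where 'a = complex])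

lemma cls_inverse_perm:
  assumes data: "admissible_data D" and y: "L2 (Dom D) y"
  shows "L2 (Dom D) (\<lambda>x. inverse (perm D x) *\<^sub>R y x)"
    "cls (Dom D) (\<lambda>x. inverse (perm D x) *\<^sub>R y x) = mulop (ext0 (Dom D) (\<lambda>x. complex_of_real (inverse (perm D x)))) (cls (Dom D) y)"
  unfolding scaleR_eq_smult
  by (rule L2_smult[OF Dom_sets(3)[OF data] essbdd_inverse_perm[OF data] y],
      rule cls_smult[OF Dom_sets(3)[OF data] essbdd_inverse_perm[OF data] y])

locale maxwell_control =
  tracking_family "curl_op D" "mass_op D" "pscale (Complex 1 (- \<theta>))" "pscale (Complex 1 \<theta>)"
    "weak_graph (Dom D)" "param_set D" c KM KA pconj "desired D" "(cls (Dom D) f, 0)" "tikh D"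
  for D :: "('l::finite) control_data" and \<theta> c KM KA :: real and f :: vfield +
  assumes data: "admissible_data D" and f: "L2 (Dom D) f"
begin

abbreviation "G \<equiv> Dom D"

lemmas G = Dom_sets(1,2)[OF data] and G_meas = Dom_sets(3)[OF data]

lemma opr_eq:
  "opr z p = (- ((freq D)\<^sup>2 *\<^sub>R (\<Sum>k\<in>UNIV. (z $ k) *\<^sub>R mulop (ext0 (Part D k) (eps_sigma D)) (fst p))),
     mulop (ext0 G (\<lambda>x. complex_of_real (inverse (perm D x)))) (snd p))"
proof -
  have "pert z p = (- ((freq D)\<^sup>2 *\<^sub>R (\<Sum>k\<in>UNIV. (z $ k) *\<^sub>R mulop (ext0 (Part D k) (eps_sigma D)) (fst p))), 0)"
    by (simp add: pert_def mass_op_def prod_eq_iff fst_sum snd_sum scaleR_sum_right sum_negf mult.commute)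
  then show ?thesis by (simp add: opr_def curl_op_def)
qed

lemma form_a_eq:
  assumes y: "y \<in> H0curl G" and w: "w \<in> H0curl G"
  shows "form_a D z y w = cpx (opr z (graph_emb G y)) (graph_emb G w)"
proof -
  note Ly = H0curl_L2[OF y]
  have "form_a D z y w = cpx (0, mulop (ext0 G (\<lambda>x. complex_of_real (inverse (perm D x)))) (cls G (weak_curl G y))) (graph_emb G w)
      - complex_of_real ((freq D)\<^sup>2) * cpx (\<Sum>k\<in>UNIV. (z $ k) *\<^sub>R mulop (ext0 (Part D k) (eps_sigma D)) (cls G y), 0) (graph_emb G w)"
    unfolding form_a_def
    by (simp only: cpx_L2inner[OF G(1) w] cls_inverse_perm[OF data Ly(2)] cls_eps_sigma_u[OF data Ly(1)])
  then show ?thesis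
    by (simp add: opr_eq cpx_def graph_emb_def inner_prod_def pscale_def complex_eq_iff del: of_real_power)
qed

lemma rhs_eq: "w \<in> H0curl G \<Longrightarrow> L2inner G f w = cpx (cls G f, 0) (graph_emb G w)"
  by (rule cpx_L2inner[OF G(1) _ f])

lemma des: "L2 G (ydes D)" "L2 G (Edes D)" using data by (auto simp: admissible_data_def)

lemma adjoint_rhs_eq:
  assumes y: "y \<in> H0curl G" and w: "w \<in> H0curl G"
  shows "adjoint_rhs D y w = cpx (pconj (graph_emb G y - desired D)) (graph_emb G w)"
proof -
  note Ly = H0curl_L2[OF y]
  have L: "L2 G (\<lambda>x. y x - ydes D x)" "L2 G (\<lambda>x. weak_curl G y x - Edes D x)"
    by (intro L2_diff[OF G_meas] Ly des)+
  have "adjoint_rhs D y w = cpx (conj_l2 (cls G y - cls G (ydes D)), 0) (graph_emb G w)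
      + cpx (0, conj_l2 (cls G (weak_curl G y) - cls G (Edes D))) (graph_emb G w)"
    unfolding adjoint_rhs_def
    by (simp only: cpx_L2inner[OF G(1) w] L2_vcnj[OF G_meas] L cls_vcnj[OF G_meas] cls_diff[OF G_meas] Ly des)
  then show ?thesis by (simp add: pconj_def graph_emb_def desired_def cpx_Pair[symmetric])
qed

lemma cost_eq:
  assumes y: "y \<in> H0curl G"
  shows "cost D y z = 1/2 * (norm (graph_emb G y - desired D))\<^sup>2 + tikh D / 2 * (norm z)\<^sup>2"
proof -
  note Ly = H0curl_L2[OF y]
  have L: "L2 G (\<lambda>x. y x - ydes D x)" "L2 G (\<lambda>x. weak_curl G y x - Edes D x)"
    by (intro L2_diff[OF G_meas] Ly des)+
  show ?thesis
    by (simp add: cost_def L2norm_cls[OF G_meas] L cls_diff[OF G_meas] Ly des graph_emb_def desired_def norm_prod_def)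
qed

text \<open>Identifies the multipliers in the critical cone with the abstract gradient. The product
  without conjugate is the real pairing with the conjugated adjoint state, and the sign agrees
  because \<open>mass_op\<close> carries the factor \<open>- ((freq D)\<^sup>2)\<close>.\<close>

lemma dfrak_eq:
  assumes "state D f z \<in> H0curl G" "adjoint_state D f z \<in> H0curl G"
  shows "dfrak D f z k = gradient z (graph_emb G (state D f z)) (graph_emb G (adjoint_state D f z)) $ k"
proof -
  let ?y = "state D f z" and ?p = "adjoint_state D f z"
  let ?m = "\<lambda>x. ext0 (Part D k) (eps_sigma D) x"
  note L = H0curl_L2(1)[OF assms(1)] H0curl_L2(1)[OF assms(2)]
  have em: "ext0 G ?m = ?m" using Part_sets(2)[OF data, of k] by (intro ext) (auto simp: ext0_def)
  have e: "essbdd (ext0 G ?m)" unfolding em by (rule essbdd_eps[OF data])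
  have "(LINT x|lebesgue_on (Part D k). eps_sigma D x * cdot (?y x) (?p x)) = (LINT x|lebesgue_on G. cdot (?m x *s ?y x) (?p x))"
    unfolding integral_lebesgue_on[OF G_meas] integral_lebesgue_on[OF Part_sets(1)[OF data]]
    using Part_sets(2)[OF data, of k] by (intro Bochner_Integration.integral_cong) (auto simp: ext0_def cdot_simps)
  then have "Re (LINT x|lebesgue_on (Part D k). eps_sigma D x * cdot (?y x) (?p x)) = mulop ?m (cls G ?y) \<bullet> conj_l2 (cls G ?p)"
    using Re_integral_cdot[OF G_meas L2_smult[OF G_meas e L(1)] L(2)] cls_smult[OF G_meas e L(1)] cls_vcnj[OF G_meas L(2)]
    by (simp add: em)
  then show ?thesis
    by (simp add: dfrak_def gradient_nth mass_op_def pconj_def graph_emb_def inner_prod_def)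
qed

lemma pscale_inverse: "b \<noteq> 0 \<Longrightarrow> pscale b (pscale (inverse b) p) = p"
  using mulop_of_real[of 1] by (simp add: pscale_def mulop_mulop)

text \<open>The multiplication by \<open>Complex 1 (- \<theta>)\<close> is undone by another complex
  multiplication, so invariance under all of them makes it onto.\<close>

lemma trial_intro:
  assumes "subspace V" "closed V" "V \<subseteq> weak_graph G" and inv: "\<And>c p. p \<in> V \<Longrightarrow> pscale c p \<in> V"
  shows "trial V"
proof -
  have "p \<in> pscale (Complex 1 (- \<theta>)) ` V" if "p \<in> V" for p
    using pscale_inverse[of "Complex 1 (- \<theta>)" p] inv[OF that] by (metis imageI complex.sel(1) one_neq_zero zero_complex.sel(1))
  then show ?thesis using assms by (auto simp: trial_def)
qed

lemma trial_weak_graph: "trial (weak_graph G)" "pconj ` weak_graph G \<subseteq> weak_graph G"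
  using pscale_weak_graph[OF G] pconj_weak_graph[OF G] subspace_weak_graph[OF G] closed_weak_graph[OF G]
  by (auto intro: trial_intro)

lemma trial_nedelec_graph: "trial (nedelec_graph G M)" "pconj ` nedelec_graph G M \<subseteq> nedelec_graph G M"
  using nedelec_graph_invariant[OF G] nedelec_graph_closed_subspace[OF G]
  by (auto intro!: trial_intro simp: nedelec_graph_def)

lemma cpx_eq_iff_sol:
  assumes "\<And>p. p \<in> V \<Longrightarrow> pscale \<i> p \<in> V"
  shows "(\<forall>q\<in>V. cpx p q = cpx p' q) \<longleftrightarrow> (\<forall>q\<in>V. p \<bullet> q = p' \<bullet> q)"
  using assms by (auto simp: cpx_def)

text \<open>Abstract existence guarantees that the choice in \<open>var_solution\<close> selects a
  genuine solution. Stability of the test space under \<open>\<i>\<close> makes the complex equation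
  equivalent to the real one defining \<open>sol\<close>.\<close>

lemma var_solution_sol:
  assumes V: "trial V'" "\<And>p. p \<in> V' \<Longrightarrow> pscale \<i> p \<in> V'" and VV': "V \<subseteq> H0curl G" "graph_emb G ` V = V'"
    and F: "\<And>w. w \<in> H0curl G \<Longrightarrow> F w = cpx r (graph_emb G w)" and z: "z \<in> param_set D"
  shows "var_solution D z V F \<in> V" "sol V' z r (graph_emb G (var_solution D z V F))"
proof -
  have iff: "(\<forall>w\<in>V. form_a D z y w = F w) \<longleftrightarrow> sol V' z r (graph_emb G y)" if y: "y \<in> V" for y
  proof -
    have "(\<forall>w\<in>V. form_a D z y w = F w) \<longleftrightarrow> (\<forall>q\<in>V'. cpx (opr z (graph_emb G y)) q = cpx r q)"
      using VV' y by (auto simp: form_a_eq F subset_iff)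
    also have "\<dots> \<longleftrightarrow> sol V' z r (graph_emb G y)"
    proof -
      have "graph_emb G y \<in> V'" using VV'(2) y by blast
      then show ?thesis
        using cpx_eq_iff_sol[where V = V' and p = "opr z (graph_emb G y)" and p' = r, OF V(2)] by (simp add: sol_def)
    qed
    finally show ?thesis .
  qed
  obtain p where p: "sol V' z r p" using sol_exists[OF V(1) z] by blast
  then obtain y where y: "y \<in> V" "graph_emb G y = p" using VV' by (auto simp: sol_def)
  have "\<exists>y. y \<in> V \<and> (\<forall>w\<in>V. form_a D z y w = F w)" using iff[OF y(1)] y p by auto
  then have *: "var_solution D z V F \<in> V \<and> (\<forall>w\<in>V. form_a D z (var_solution D z V F) w = F w)"
    unfolding var_solution_def by (rule someI_ex)
  then show "var_solution D z V F \<in> V" by blast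
  then show "sol V' z r (graph_emb G (var_solution D z V F))" using * iff by blast
qed

lemma H0curl_graph: "graph_emb G ` H0curl G = weak_graph G"
proof
  show "graph_emb G ` H0curl G \<subseteq> weak_graph G" using graph_emb_H0curl[OF G] by blast
  show "weak_graph G \<subseteq> graph_emb G ` H0curl G"
  proof
    fix p assume "p \<in> weak_graph G"
    then obtain w where "w \<in> H0curl G" "graph_emb G w = p" by (rule weak_graph_obtain[OF G])
    then show "p \<in> graph_emb G ` H0curl G" by blast
  qed
qed

lemma nedelec_graph_image:
  assumes M: "\<And>T. T \<in> M \<Longrightarrow> compact T \<and> T \<subseteq> closure G"
  shows "graph_emb G ` nedelec G M = nedelec_graph G M"
proof -
  note iff = nedelec_iff_graph[OF G frontier_negligible[OF data] M]
  have sub: "nedelec G M \<subseteq> H0curl G" by (auto simp: nedelec_def)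
  show ?thesis
  proof
    show "graph_emb G ` nedelec G M \<subseteq> nedelec_graph G M" using iff sub by blast
    show "nedelec_graph G M \<subseteq> graph_emb G ` nedelec G M"
    proof
      fix p assume p: "p \<in> nedelec_graph G M"
      then have "p \<in> weak_graph G" by (simp add: nedelec_graph_def)
      then obtain w where w: "w \<in> H0curl G" "graph_emb G w = p" by (rule weak_graph_obtain[OF G])
      then show "p \<in> graph_emb G ` nedelec G M" using iff[OF _ w(1)] p by blast
    qed
  qed
qed

end

lemma mesh_element:
  assumes "mesh_family G P H \<T>" "h \<in> H" "T \<in> \<T> h" shows "compact T \<and> T \<subseteq> closure G"
proof -
  have "3 simplex T" "\<Union>(\<T> h) = closure G"
    using assms by (auto simp: mesh_family_def simplicial_mesh_def)
  then show ?thesis using assms(3) polytope_imp_compact[OF simplex_imp_polytope] by blast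
qed

theorem corollary5p7:
  fixes D :: "('l::finite) control_data"
    and H :: "real set" and \<T> :: "real \<Rightarrow> (real^3) set set"
    and f :: vfield
    and u :: "real^'l" and uh :: "real \<Rightarrow> real^'l"
    and s1 s2 t s :: real
  assumes data: "admissible_data D"
    and mesh: "mesh_family (Dom D) (Part D) H \<T>"
    and u_min: "strict_local_min_on (Uad D) (red_cost D f) u"
    and uh_min: "\<And>h. h \<in> H \<Longrightarrow> local_min_on (Uad D) (dred_cost D (\<T> h) f) (uh h)"
    and uh_lim: "(uh \<longlongrightarrow> u) (at 0 within H)"
    and second_order: "\<exists>\<tau>>0. \<exists>\<nu>>0. \<forall>v\<in>critical_cone D f u \<tau>.
          second_deriv (red_cost D f) u v v \<ge> \<nu> * (norm v)\<^sup>2"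
    and f_div: "f \<in> Hdiv (Dom D)"
    and mu_PW: "PW1inf (Dom D) (Part D) (\<lambda>x. complex_of_real (perm D x))"
    and eps_PW: "PW1inf (Dom D) (Part D) (eps_sigma D)"
    and t_reg: "regularity_exponent D H \<T> t"
    and s1: "0 < s1" "s1 \<le> 1" and s2: "0 < s2" "s2 \<le> 1"
    and adj_L2: "\<exists>C>0. \<forall>v\<in>Uad D. \<forall>h\<in>H.
          L2norm (Dom D) (\<lambda>x. adjoint_state D f v x - adjoint_state_fe D (\<T> h) f v x)
            \<le> C * h powr s1"
    and adj_curl: "\<exists>C>0. \<forall>v\<in>Uad D. \<forall>h\<in>H.
          L2norm (Dom D) (weak_curl (Dom D)
              (\<lambda>x. adjoint_state D f v x - adjoint_state_fe D (\<T> h) f v x))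
            \<le> C * h powr s2"
    and s: "0 \<le> s" "s < t"
  shows "\<exists>h0>0. \<exists>C>0. \<forall>h\<in>H. h < h0 \<longrightarrow>
           norm (u - uh h)
           + Hcurl_norm (Dom D) (\<lambda>x. state D f u x - dstate D (\<T> h) f (uh h) x)
           + Hcurl_norm (Dom D) (\<lambda>x. adjoint_state D f u x - dadjoint_state D (\<T> h) f (uh h) x)
           \<le> C * h powr (min s (min s1 s2))"
proof -
  let ?E = "graph_emb (Dom D)"
  have fL: "L2 (Dom D) f" using f_div by (simp add: Hdiv_def)
  obtain \<theta> c KM KA where
    "tracking_family (curl_op D) (mass_op D) (pscale (Complex 1 (- \<theta>))) (pscale (Complex 1 \<theta>))
       (weak_graph (Dom D)) (param_set D) c KM KA pconj"
    by (rule tracking_family_maxwell[OF data])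
  then interpret maxwell_control D \<theta> c KM KA f
    by (intro maxwell_control.intro maxwell_control_axioms.intro data fL)
  \<comment> \<open>For \<open>h < 1\<close> a larger exponent gives a smaller power, so rates with
    different exponents can be compared.\<close>
  define H' where "H' = H \<inter> {..<1}"
  have H': "h \<in> H" "0 < h" "h < 1" if "h \<in> H'" for h
    using that mesh by (auto simp: H'_def mesh_family_def)
  have mesh': "compact T \<and> T \<subseteq> closure (Dom D)" if "h \<in> H'" "T \<in> \<T> h" for h T
    using mesh_element[OF mesh H'(1)[OF that(1)] that(2)] .
  define N where "N h = nedelec (Dom D) (\<T> h)" for h
  define Vh where "Vh h = nedelec_graph (Dom D) (\<T> h)" for h
  have NV: "?E ` N h = Vh h" if "h \<in> H'" for h
    unfolding N_def Vh_def by (rule nedelec_graph_image[OF mesh'[OF that]])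
  have NH: "N h \<subseteq> H0curl (Dom D)" for h by (auto simp: N_def nedelec_def)
  have Vh: "trial (Vh h)" "pconj ` Vh h \<subseteq> Vh h" "\<And>p. p \<in> Vh h \<Longrightarrow> pscale \<i> p \<in> Vh h" for h
    unfolding Vh_def using trial_nedelec_graph nedelec_graph_invariant[OF G] by blast+
  note Wi = pscale_weak_graph[OF G, of _ \<i>]

  have Y: "state D f z \<in> H0curl (Dom D)" "sol (weak_graph (Dom D)) z (cls (Dom D) f, 0) (?E (state D f z))"
    if "z \<in> param_set D" for z
    unfolding state_def
    by (rule var_solution_sol[OF trial_weak_graph(1) Wi order_refl H0curl_graph rhs_eq that]; assumption)+
  have P: "adjoint_state D f z \<in> H0curl (Dom D)"
    "sol (weak_graph (Dom D)) z (pconj (?E (state D f z) - desired D)) (?E (adjoint_state D f z))"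
    if "z \<in> param_set D" for z
    unfolding adjoint_state_def
    by (rule var_solution_sol[OF trial_weak_graph(1) Wi order_refl H0curl_graph adjoint_rhs_eq[OF Y(1)[OF that]] that]; assumption)+
  have Yh: "dstate D (\<T> h) f z \<in> N h" "sol (Vh h) z (cls (Dom D) f, 0) (?E (dstate D (\<T> h) f z))"
    if "h \<in> H'" "z \<in> param_set D" for h z
    unfolding dstate_def N_def[symmetric]
    by (rule var_solution_sol[OF Vh(1,3) NH NV[OF that(1)] rhs_eq that(2)]; assumption)+
  have YhH: "dstate D (\<T> h) f z \<in> H0curl (Dom D)" if "h \<in> H'" "z \<in> param_set D" for h z
    using Yh(1)[OF that] NH by blast
  have Ph: "dadjoint_state D (\<T> h) f z \<in> N h"
    "sol (Vh h) z (pconj (?E (dstate D (\<T> h) f z) - desired D)) (?E (dadjoint_state D (\<T> h) f z))"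
    if "h \<in> H'" "z \<in> param_set D" for h z
    unfolding dadjoint_state_def N_def[symmetric]
    by (rule var_solution_sol[OF Vh(1,3) NH NV[OF that(1)] adjoint_rhs_eq[OF YhH[OF that]] that(2)]; assumption)+
  have Pf: "adjoint_state_fe D (\<T> h) f z \<in> N h"
    "sol (Vh h) z (pconj (?E (state D f z) - desired D)) (?E (adjoint_state_fe D (\<T> h) f z))"
    if "h \<in> H'" "z \<in> param_set D" for h z
    unfolding adjoint_state_fe_def N_def[symmetric]
    by (rule var_solution_sol[OF Vh(1,3) NH NV[OF that(1)] adjoint_rhs_eq[OF Y(1)[OF that(2)]] that(2)]; assumption)+
  have PhH: "dadjoint_state D (\<T> h) f z \<in> H0curl (Dom D)" "adjoint_state_fe D (\<T> h) f z \<in> H0curl (Dom D)"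
    if "h \<in> H'" "z \<in> param_set D" for h z
    using Ph(1)[OF that] Pf(1)[OF that] NH by blast+

  have U: "Uad D = order_box (lower D) (upper D)" by (simp add: Uad_def order_box_def)
  have low: "0 < lower D $ k" "lower D $ k \<le> upper D $ k" for k using data by (auto simp: admissible_data_def less_imp_le)
  have UZ: "order_box (lower D) (upper D) \<subseteq> interior (param_set D)"
  proof (rule order_trans[OF _ interior_maximal])
    let ?S = "\<Inter>k. {z. lower D $ k / 2 < z $ k}"
    show "order_box (lower D) (upper D) \<subseteq> ?S"
    proof
      fix z assume z: "z \<in> order_box (lower D) (upper D)"
      have "lower D $ k / 2 < z $ k" for k
        using z low(1)[of k] by (simp add: order_box_def) (smt (verit) field_sum_of_halves)
      then show "z \<in> ?S" by simp
    qed
    show "?S \<subseteq> param_set D" by (auto simp: param_set_def less_imp_le)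
    show "open ?S" by (intro open_INT finite ballI open_Collect_less continuous_intros)
  qed
  have UP: "z \<in> param_set D" if "z \<in> Uad D" for z using that UZ interior_subset unfolding U by blast
  have diff: "Hcurl_norm (Dom D) (\<lambda>x. v x - w x) = norm (?E v - ?E w)"
    if "v \<in> H0curl (Dom D)" "w \<in> H0curl (Dom D)" for v w
    using norm_graph_emb[OF G graph_emb_diff(1)[OF G that]] graph_emb_diff(2)[OF G that] by simp

  define s' where "s' = (s + t) / 2"
  have s': "0 < s'" "s < s'" "s' < t" "0 \<le> s'" using s t_reg by (auto simp: s'_def regularity_exponent_def)
  \<comment> \<open>\<open>e\<close> is positive, so the gradient errors tend to zero, and it is at
    least the claimed exponent, so for \<open>h < 1\<close> the bound in \<open>e\<close> implies
    the claimed one.\<close>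
  define e where "e = min s' (min s1 s2)"
  have e: "0 < e" "e \<le> s'" "e \<le> s1" "e \<le> s2" "min s (min s1 s2) \<le> e" using s' s1 s2 by (auto simp: e_def)
  have pw: "h powr a \<le> h powr b" if "h \<in> H'" "b \<le> a" for h a b
    using H'[OF that(1)] that(2) by (intro powr_mono') auto
  from t_reg[unfolded regularity_exponent_def, THEN conjunct2, THEN conjunct2, rule_format, OF conjI[OF s'(4,3)], THEN conjunct2]
  obtain C0 where C0: "0 < C0" and C0': "\<forall>g\<in>Hdiv (Dom D). \<forall>z\<in>Uad D. \<forall>h\<in>H.
      Hcurl_norm (Dom D) (\<lambda>x. state D g z x - dstate D (\<T> h) g z x) \<le> C0 * h powr s' * Hdiv_norm (Dom D) g"
    by (elim exE conjE)
  from adj_L2 obtain C1 where C1: "0 < C1" "\<forall>z\<in>Uad D. \<forall>h\<in>H.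
      L2norm (Dom D) (\<lambda>x. adjoint_state D f z x - adjoint_state_fe D (\<T> h) f z x) \<le> C1 * h powr s1"
    by (elim exE conjE)
  from adj_curl obtain C2 where C2: "0 < C2" "\<forall>z\<in>Uad D. \<forall>h\<in>H.
      L2norm (Dom D) (weak_curl (Dom D) (\<lambda>x. adjoint_state D f z x - adjoint_state_fe D (\<T> h) f z x)) \<le> C2 * h powr s2"
    by (elim exE conjE)
  define CY where "CY = C0 * Hdiv_norm (Dom D) f"
  have CY0: "0 \<le> CY" using C0 by (simp add: CY_def Hdiv_norm_def)
  define C where "C = CY + C1 + C2"
  have rateY: "norm (?E (state D f z) - ?E (dstate D (\<T> h) f z)) \<le> C * h powr e"
    if h: "h \<in> H'" and z: "z \<in> Uad D" for h z
  proof -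
    have "norm (?E (state D f z) - ?E (dstate D (\<T> h) f z)) \<le> CY * h powr s'"
      using C0'[rule_format, OF f_div z H'(1)[OF h]] diff[OF Y(1)[OF UP[OF z]] YhH[OF h UP[OF z]]] by (simp add: CY_def mult_ac)
    also have "\<dots> \<le> C * h powr e"
      using pw[OF h e(2)] CY0 C1(1) C2(1) by (intro mult_mono) (auto simp: C_def)
    finally show ?thesis .
  qed
  have rateP: "norm (?E (adjoint_state D f z) - ?E (adjoint_state_fe D (\<T> h) f z)) \<le> C * h powr e"
    if h: "h \<in> H'" and z: "z \<in> Uad D" for h z
  proof -
    let ?d = "\<lambda>x. adjoint_state D f z x - adjoint_state_fe D (\<T> h) f z x"
    have "norm (?E (adjoint_state D f z) - ?E (adjoint_state_fe D (\<T> h) f z)) = Hcurl_norm (Dom D) ?d"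
      by (rule diff[OF P(1)[OF UP[OF z]] PhH(2)[OF h UP[OF z]], symmetric])
    also have "\<dots> \<le> L2norm (Dom D) ?d + L2norm (Dom D) (weak_curl (Dom D) ?d)"
      unfolding Hcurl_norm_def by (rule sqrt_sum_squares_le_sum) (simp_all add: L2norm_def)
    also have "\<dots> \<le> C1 * h powr e + C2 * h powr e"
      using C1(2)[rule_format, OF z H'(1)[OF h]] C2(2)[rule_format, OF z H'(1)[OF h]]
        mult_left_mono[OF pw[OF h e(3)], of C1] mult_left_mono[OF pw[OF h e(4)], of C2] C1(1) C2(1) by linarith
    also have "\<dots> \<le> C * h powr e" using CY0 by (simp add: C_def algebra_simps)
    finally show ?thesis .
  qed
  have \<rho>: "((\<lambda>h. h powr e) \<longlongrightarrow> 0) (at 0 within H')"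
  proof (rule tendsto_zero_powrI)
    show "\<forall>\<^sub>F h in at 0 within H'. 0 \<le> h" using H'(2) by (auto simp: eventually_at_filter less_imp_le)
  qed (use e(1) in \<open>auto intro: tendsto_intros\<close>)
  from second_order obtain \<tau> \<nu> where \<tau>: "0 < \<tau>" "0 < \<nu>"
    and so: "\<forall>v\<in>critical_cone D f u \<tau>. \<nu> * (norm v)\<^sup>2 \<le> second_deriv (red_cost D f) u v v"
    by (elim exE conjE)
  have uU: "u \<in> Uad D" using u_min by (simp add: strict_local_min_on_def)
  have "\<exists>C'. \<forall>\<^sub>F h in at 0 within H'. norm (u - uh h)
      + norm (?E (state D f u) - ?E (dstate D (\<T> h) f (uh h)))
      + norm (?E (adjoint_state D f u) - ?E (dadjoint_state D (\<T> h) f (uh h)))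
      \<le> C' * h powr e"
  proof (rule local_minimizer_error[where Vh = Vh and Pf = "\<lambda>h z. ?E (adjoint_state_fe D (\<T> h) f z)"
        and j = "red_cost D f" and jh = "\<lambda>h. dred_cost D (\<T> h) f" and a = "lower D" and b = "upper D" and H = H'
        and Y = "\<lambda>z. ?E (state D f z)" and P = "\<lambda>z. ?E (adjoint_state D f z)"
        and Yh = "\<lambda>h z. ?E (dstate D (\<T> h) f z)"
        and Ph = "\<lambda>h z. ?E (dadjoint_state D (\<T> h) f z)" and C = C and \<tau> = \<tau> and \<nu> = \<nu>])
    show "local_min_on (order_box (lower D) (upper D)) (red_cost D f) u"
      using strict_local_min_imp_local_min[OF u_min] by (simp add: U)
    show "local_min_on (order_box (lower D) (upper D)) (dred_cost D (\<T> h) f) (uh h)" if "h \<in> H'" for h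
      using uh_min[OF H'(1)[OF that]] by (simp add: U)
    show "(uh \<longlongrightarrow> u) (at 0 within H')" by (rule tendsto_within_subset[OF uh_lim]) (simp add: H'_def)
    show "red_cost D f z = 1/2 * (norm (?E (state D f z) - desired D))\<^sup>2 + tikh D / 2 * (norm z)\<^sup>2"
      if "z \<in> param_set D" for z
      unfolding red_cost_def by (rule cost_eq[OF Y(1)[OF that]])
    show "dred_cost D (\<T> h) f z = 1/2 * (norm (?E (dstate D (\<T> h) f z) - desired D))\<^sup>2 + tikh D / 2 * (norm z)\<^sup>2"
      if "h \<in> H'" "z \<in> param_set D" for h z
      unfolding dred_cost_def by (rule cost_eq[OF YhH[OF that]])
    show "norm (?E (state D f z) - ?E (dstate D (\<T> h) f z)) \<le> C * h powr e"
      "norm (?E (adjoint_state D f z) - ?E (adjoint_state_fe D (\<T> h) f z)) \<le> C * h powr e"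
      if "h \<in> H'" "z \<in> order_box (lower D) (upper D)" for h z
      using rateY rateP that by (simp_all add: U)
    show "\<nu> * (norm v)\<^sup>2 \<le> second_deriv (red_cost D f) u v v"
      if "\<And>k. (u $ k = lower D $ k \<longrightarrow> 0 \<le> v $ k) \<and> (u $ k = upper D $ k \<longrightarrow> v $ k \<le> 0) \<and>
        (\<tau> < \<bar>gradient u (?E (state D f u)) (?E (adjoint_state D f u)) $ k\<bar> \<longrightarrow> v $ k = 0)" for v
      using so that dfrak_eq[OF Y(1)[OF UP[OF uU]] P(1)[OF UP[OF uU]]] by (simp add: critical_cone_def)
  qed (rule trial_weak_graph Vh(1,2) Y(2) P(2) Yh(2) Ph(2) Pf(2) low(2) UZ \<tau> \<rho> | assumption)+
  then obtain C' where C': "\<forall>\<^sub>F h in at 0 within H'. norm (u - uh h)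
      + norm (?E (state D f u) - ?E (dstate D (\<T> h) f (uh h)))
      + norm (?E (adjoint_state D f u) - ?E (dadjoint_state D (\<T> h) f (uh h)))
      \<le> C' * h powr e" ..
  then obtain \<delta> where \<delta>: "0 < \<delta>" "\<And>h. h \<in> H' \<Longrightarrow> h \<noteq> 0 \<Longrightarrow> dist h 0 < \<delta> \<Longrightarrow> norm (u - uh h)
      + norm (?E (state D f u) - ?E (dstate D (\<T> h) f (uh h)))
      + norm (?E (adjoint_state D f u) - ?E (dadjoint_state D (\<T> h) f (uh h)))
      \<le> C' * h powr e"
    unfolding eventually_at by blast
  show ?thesis
  proof (intro exI conjI ballI impI)
    \<comment> \<open>The minimum with \<open>1\<close> keeps \<open>h\<close> in \<open>H'\<close>;
      the maximum with \<open>1\<close> is taken since \<open>C'\<close> may fail to be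
      positive.\<close>
    show "0 < min \<delta> 1" "0 < max C' 1" using \<delta>(1) by auto
    fix h assume h: "h \<in> H" "h < min \<delta> 1"
    then have hH': "h \<in> H'" by (simp add: H'_def)
    note h' = H'[OF hH']
    have uhP: "uh h \<in> param_set D" using uh_min[OF h(1)] by (intro UP) (simp add: local_min_on_def)
    have "norm (u - uh h)
        + Hcurl_norm (Dom D) (\<lambda>x. state D f u x - dstate D (\<T> h) f (uh h) x)
        + Hcurl_norm (Dom D) (\<lambda>x. adjoint_state D f u x - dadjoint_state D (\<T> h) f (uh h) x)
        \<le> C' * h powr e"
      using \<delta>(2)[OF hH'] h h'
      by (simp add: diff[OF Y(1)[OF UP[OF uU]] YhH[OF hH' uhP]] diff[OF P(1)[OF UP[OF uU]] PhH(1)[OF hH' uhP]])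
    also have "\<dots> \<le> max C' 1 * h powr (min s (min s1 s2))"
      using pw[OF hH' e(5)] by (intro mult_mono) auto
    finally show "norm (u - uh h)
        + Hcurl_norm (Dom D) (\<lambda>x. state D f u x - dstate D (\<T> h) f (uh h) x)
        + Hcurl_norm (Dom D) (\<lambda>x. adjoint_state D f u x - dadjoint_state D (\<T> h) f (uh h) x)
        \<le> max C' 1 * h powr (min s (min s1 s2))" .
  qed
qed

end
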